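(* Let $(T,(X_1,\ldots,X_s))$ be a tableau with substitution of dimension $\underline{n}=(n_1,\ldots,n_m)\in\mathbb{N}^m$. Let $1\leq q_1<q_2\leq m$ with $n_{q_1}=n_{q_2}$, and let the vector $\underline{d}\in\mathbb{N}^{m-2}$ be obtained from $\underline{n}$ by eliminating the $q_1$-th and the $q_2$-th coordinates. Then $\mathrm{bpf}_T(X_1,\ldots,X_s)$ is a polynomial in $\mathrm{bpf}_D(Y_1,\ldots,Y_l)$ and $\sigma_k(h)$, where (1) $(D,(Y_1,\ldots,Y_l))$ ranges over tableaux with substitution of dimension $\underline{d}$ such that $Y_1,\ldots,Y_l$ are products of matrices from $X_1,\ldots,X_s,X_1^t,\ldots,X_s^t$; (2) $h$ ranges over products of matrices from $X_1,\ldots,X_s,X_1^t,\ldots,X_s^t$; (3) $k$ ranges over $\{1,\ldots,n_{q_1}\}$. Moreover, the coefficients of this polynomial belong to the image of $\mathbb{Z}$ in $K$ under the natural homomorphism.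
   Context: $K$ is an infinite field of arbitrary characteristic; all matrices have entries in some commutative unital $K$-algebra; $\mathbb{N}$ is the set of non-negative integers; $X^t$ is the transpose of $X$; $\mathcal{S}_n$ is the symmetric group. For a square $N\times N$ matrix $X$, $\sigma_k(X)$ is defined by $\det(\lambda E-X)=\lambda^N-\sigma_1(X)\lambda^{N-1}+\cdots+(-1)^N\sigma_N(X)$. Products of matrices are taken whenever the sizes make them defined (and $\sigma_k(h)$ is taken for square $h$). Shape. A shape of dimension $\underline{n}=(n_1,\ldots,n_m)\in\mathbb{N}^m$ is a collection of $m$ columns of cells, numbered $1,\ldots,m$; the $i$-th column contains exactly $n_i$ cells, numbered $1,\ldots,n_i$ from the top. Tableau with substitution. Let $\underline{n}\in\mathbb{N}^m$ with $n_1+\cdots+n_m$ even. A pair $(T,(X_1,\ldots,X_s))$ is a tableau with substitution of dimension $\underline{n}$ if: (i) $T$ (a tableau) is a shape of dimension $\underline{n}$ filled with arrows; an arrow goes from one cell of the shape to another one, and each cell is the head or the tail of one and only one arrow. We write $a\in T$ for an arrow $a$ of $T$; $a'$ and $a''$ denote the columns containing the head and the tail of $a$, respectively, and ${}'a$ and ${}''a$ denote the numbers of the cells (within their columns) containing the head and the tail of $a$, respectively. (ii) $X_1,\ldots,X_s$ are matrices; to each arrow $a\in T$ an index $\varphi(a)\in\{1,\ldots,s\}$ is assigned such that $X_{\varphi(a)}$ is an $n_{a''}\times n_{a'}$ matrix; $\{\varphi(a)\mid a\in T\}=\{1,\ldots,s\}$; and $\varphi(a)=\varphi(b)$ implies $a'=b'$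 and $a''=b''$. Define $$\mathrm{bpf}_T(X_1,\ldots,X_s)=\sum \mathrm{sgn}(\pi_1)\cdots\mathrm{sgn}(\pi_m)\prod_{a\in T}(X_{\varphi(a)})_{\pi_{a''}({}''a),\,\pi_{a'}({}'a)},$$ where the sum ranges over permutations $\pi_1\in\mathcal{S}_{n_1},\ldots,\pi_m\in\mathcal{S}_{n_m}$ such that for any $a,b\in T$ the conditions $\varphi(a)=\varphi(b)$ and ${}''a<{}''b$ imply $\pi_i({}''a)<\pi_i({}''b)$ for $i=a''=b''$. (For a tableau without cells this equals $1$.) *)

theory Defs
  imports
    "Jordan_Normal_Form.Char_Poly"
    "HOL-Library.Poly_Mapping"
    "HOL-Library.FuncSet"
begin

text \<open>
  A dimension vector is a list \<open>n\<close>, with \<open>m = length n\<close> columns. Columns, cells within a column,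
  matrix indices, and the index set of the matrices of a tableau are all counted from \<open>0\<close>, in
  accordance with lists and with the matrices of Jordan-Normal-Form. A cell is a pair
  (column, number within the column).
\<close>

type_synonym cell = "nat \<times> nat"

datatype arrow = Arrow (tail_cell: cell) (head_cell: cell)

abbreviation tail_col :: "arrow \<Rightarrow> nat" where "tail_col a \<equiv> fst (tail_cell a)"
abbreviation tail_row :: "arrow \<Rightarrow> nat" where "tail_row a \<equiv> snd (tail_cell a)"
abbreviation head_col :: "arrow \<Rightarrow> nat" where "head_col a \<equiv> fst (head_cell a)"
abbreviation head_row :: "arrow \<Rightarrow> nat" where "head_row a \<equiv> snd (head_cell a)"

definition cells :: "nat list \<Rightarrow> cell set" where
  "cells n = {(i, r). i < length n \<and> r < n ! i}"

text \<open>
  Since every cell belongs to exactly one arrow, there are no parallel arrows, so a tableau is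
  a set of arrows.
\<close>

definition tableau :: "nat list \<Rightarrow> arrow set \<Rightarrow> bool" where
  "tableau n T \<longleftrightarrow>
     (\<forall>a\<in>T. tail_cell a \<in> cells n \<and> head_cell a \<in> cells n \<and> tail_cell a \<noteq> head_cell a) \<and>
     (\<forall>c\<in>cells n. \<exists>!a. a \<in> T \<and> (c = head_cell a \<or> c = tail_cell a))"

text \<open>
  The function \<open>\<phi>\<close> is part of the data of a tableau with substitution; only its values on \<open>T\<close>
  matter.
\<close>

definition tableau_with_substitution ::
  "nat list \<Rightarrow> arrow set \<Rightarrow> (arrow \<Rightarrow> nat) \<Rightarrow> 'a mat list \<Rightarrow> bool" where
  "tableau_with_substitution n T \<phi> X \<longleftrightarrow>
     even (sum_list n) \<and> tableau n T \<and>
     \<phi> ` T = {..<length X} \<and>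
     (\<forall>a\<in>T. X ! \<phi> a \<in> carrier_mat (n ! tail_col a) (n ! head_col a)) \<and>
     (\<forall>a\<in>T. \<forall>b\<in>T. \<phi> a = \<phi> b \<longrightarrow> head_col a = head_col b \<and> tail_col a = tail_col b)"

definition admissible_perms ::
  "nat list \<Rightarrow> arrow set \<Rightarrow> (arrow \<Rightarrow> nat) \<Rightarrow> (nat \<Rightarrow> nat \<Rightarrow> nat) set" where
  "admissible_perms n T \<phi> =
     {\<pi> \<in> (\<Pi>\<^sub>E i\<in>{..<length n}. {p. p permutes {..<n ! i}}).
        \<forall>a\<in>T. \<forall>b\<in>T. \<phi> a = \<phi> b \<and> tail_row a < tail_row b \<longrightarrow>
          \<pi> (tail_col a) (tail_row a) < \<pi> (tail_col a) (tail_row b)}"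

definition bpf ::
  "nat list \<Rightarrow> arrow set \<Rightarrow> (arrow \<Rightarrow> nat) \<Rightarrow> 'a::comm_ring_1 mat list \<Rightarrow> 'a" where
  "bpf n T \<phi> X =
     (\<Sum>\<pi>\<in>admissible_perms n T \<phi>.
        (\<Prod>i<length n. of_int (sign (\<pi> i))) *
        (\<Prod>a\<in>T. X ! \<phi> a $$ (\<pi> (tail_col a) (tail_row a), \<pi> (head_col a) (head_row a))))"

text \<open>
  \<open>char_poly X\<close> is \<open>det (\<lambda>E - X)\<close>. For \<open>k\<close> beyond the size of the matrix, where the defining
  identity gives no value, \<open>\<sigma>\<^sub>k\<close> is zero; without the case distinction the truncated subtraction
  would return the constant coefficient.
\<close>

definition sigma :: "nat \<Rightarrow> 'a::comm_ring_1 mat \<Rightarrow> 'a" where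
  "sigma k X =
     (if k \<le> dim_row X then (- 1) ^ k * coeff (char_poly X) (dim_row X - k) else 0)"

text \<open>Nonempty products of matrices from \<open>S\<close>, all sizes matching.\<close>

inductive_set mat_products :: "'a::comm_ring_1 mat set \<Rightarrow> 'a mat set"
  for S :: "'a mat set" where
  base: "A \<in> S \<Longrightarrow> A \<in> mat_products S"
| mult: "A \<in> mat_products S \<Longrightarrow> B \<in> mat_products S \<Longrightarrow> dim_col A = dim_row B \<Longrightarrow>
    A * B \<in> mat_products S"

text \<open>
  A \<open>K\<close>-algebra is given by its structure homomorphism \<open>\<iota>\<close>. A polynomial over \<open>K\<close> in variables
  indexed by \<open>nat\<close> is a finitely supported map from monomials to coefficients, a monomial being a
  finitely supported exponent vector. \<open>polynomial_in \<iota> C G f\<close> says that \<open>f\<close> is obtained from a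
  polynomial with coefficients in \<open>C\<close> by substituting elements of \<open>G\<close> for its variables.
\<close>

definition poly_subst ::
  "('k::zero \<Rightarrow> 'a::comm_ring_1) \<Rightarrow> (nat \<Rightarrow> 'a) \<Rightarrow> ((nat \<Rightarrow>\<^sub>0 nat) \<Rightarrow>\<^sub>0 'k) \<Rightarrow> 'a" where
  "poly_subst \<iota> y P =
     (\<Sum>u\<in>Poly_Mapping.keys P.
        \<iota> (Poly_Mapping.lookup P u) *
        (\<Prod>i\<in>Poly_Mapping.keys u. y i ^ Poly_Mapping.lookup u i))"

definition polynomial_in ::
  "('k::zero \<Rightarrow> 'a::comm_ring_1) \<Rightarrow> 'k set \<Rightarrow> 'a set \<Rightarrow> 'a \<Rightarrow> bool" where
  "polynomial_in \<iota> C G f \<longleftrightarrow>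
     (\<exists>(P :: (nat \<Rightarrow>\<^sub>0 nat) \<Rightarrow>\<^sub>0 'k) y.
        (\<forall>u. Poly_Mapping.lookup P u \<in> C) \<and>
        (\<forall>u\<in>Poly_Mapping.keys P. \<forall>i\<in>Poly_Mapping.keys u. y i \<in> G) \<and>
        f = poly_subst \<iota> y P)"

end

theory Submission
  imports Defs "HOL-Library.Nat_Bijection"
begin

text \<open>
  Up to a factorial, \<open>bpf\<^sub>T(X)\<close> is the coefficient of a monomial \<open>t\<^sup>m\<close> in the (full) Pfaffian sum of the
  block form \<open>J + \<Sum> t\<^bsup>w(j)\<^esup> X\<^sub>j\<close> on the cells, where \<open>J\<close> is an identity block (a link) joining the columns
  \<open>q1\<close> and \<open>q2\<close>: a term of the right degree has no room for \<open>J\<close>, and weights \<open>w(j) = B\<^sup>j\<close> with \<open>B\<close> large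
  separate the multidegrees.

  The Pfaffian sum changes by a determinant under congruence. As \<open>J\<close> is invertible on the two linked
  columns, each block that meets these columns can be cancelled against \<open>J\<close> by an elementary congruence, at
  the cost of new blocks that are products of the old ones and have larger weight. The determinant
  of such a congruence is \<open>1\<close> or \<open>det (1 \<plusminus> t\<^sup>w h) = \<Sum> (\<plusminus>1) \<sigma>\<^sub>k(h) t\<^bsup>k w\<^esup>\<close>. Once all blocks that meet the linked
  columns have weight above \<open>m\<close>, the coefficient of \<open>t\<^sup>m\<close> sees \<open>J\<close> and the other columns only, that is,
  values \<open>bpf\<^sub>D(Y)\<close> for the remaining dimension vector.

  Division by factorials requires characteristic zero, so the argument is carried out for matrices of
  indeterminates over the integers and then specialized.
\<close>

text \<open>The coefficients must be integers, so reaching a multiple of the bpf is not enough: the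
  division by the factorial has to take place inside the ring generated by the allowed values. The
  factor is |T|!: an orbit of labellings of the arrows has |T|! / |stab| members, and the sum over
  unrestricted permutations counts each admissible one |stab| times. The proof therefore carries the
  property \<open>good\<close>: up to a degree D, each coefficient is |T|! times an element of the
  generated ring. It survives the removal of a determinant, because these determinants have constant
  term 1 and coefficients in that ring, hence are units among the power series over it. The tableau
  T stays fixed during all congruences, although the new blocks need not fit its columns. This is
  harmless: a permutation of the cells carries T to a tableau that fits, at the cost of a sign. The
  link has weight 0, so a block of weight w is cancelled by a step of the same weight w, and
  everything the step creates is heavier than w.\<close>

section \<open>Integer polynomials and generated subrings\<close>

text \<open>Differences and products starting from \<open>one\<close> supply all integer constants,
  so these are the values of integer polynomials at elements of G. The argument works with
  membership; an explicit polynomial is produced only once, in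
  \<open>gen_subring_imp_polynomial_in\<close>.\<close>

inductive_set gen_subring :: "'a::comm_ring_1 set \<Rightarrow> 'a set" for G where
  gen: "g \<in> G \<Longrightarrow> g \<in> gen_subring G"
| one: "1 \<in> gen_subring G"
| diff: "x \<in> gen_subring G \<Longrightarrow> y \<in> gen_subring G \<Longrightarrow> x - y \<in> gen_subring G"
| mult: "x \<in> gen_subring G \<Longrightarrow> y \<in> gen_subring G \<Longrightarrow> x * y \<in> gen_subring G"

lemma gen_subring_zero: "0 \<in> gen_subring G"
  using gen_subring.diff[OF gen_subring.one gen_subring.one] by simp

lemma gen_subring_uminus: "x \<in> gen_subring G \<Longrightarrow> - x \<in> gen_subring G"
  using gen_subring.diff[OF gen_subring_zero] by simp

lemma gen_subring_add: "x \<in> gen_subring G \<Longrightarrow> y \<in> gen_subring G \<Longrightarrow> x + y \<in> gen_subring G"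
  using gen_subring.diff[OF _ gen_subring_uminus] by fastforce

lemma gen_subring_sum: "(\<And>i. i \<in> I \<Longrightarrow> f i \<in> gen_subring G) \<Longrightarrow> sum f I \<in> gen_subring G"
  by (induction I rule: infinite_finite_induct) (auto intro: gen_subring_zero gen_subring_add)

lemma gen_subring_mono: "G \<subseteq> H \<Longrightarrow> gen_subring G \<subseteq> gen_subring H"
proof
  fix x assume "G \<subseteq> H" "x \<in> gen_subring G"
  from this(2,1) show "x \<in> gen_subring H"
    by (induction) (auto intro: gen_subring.intros)
qed

text \<open>The variables of \<open>polynomial_in\<close> are indexed by \<open>nat\<close>, while G
  may have any cardinality. One element involves only finitely many generators, and these can be
  numbered.\<close>

lemma gen_subring_finite:
  assumes "x \<in> gen_subring G"
  obtains H where "finite H" "H \<subseteq> G" "x \<in> gen_subring H"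
proof -
  from assms have "\<exists>H. finite H \<and> H \<subseteq> G \<and> x \<in> gen_subring H"
  proof induction
    case (gen g)
    then show ?case by (intro exI[of _ "{g}"]) (auto intro: gen_subring.intros)
  next
    case one
    then show ?case by (intro exI[of _ "{}"]) (auto intro: gen_subring.intros)
  next
    case (diff x y)
    then obtain H H' where H: "finite H" "H \<subseteq> G" "x \<in> gen_subring H" "finite H'" "H' \<subseteq> G" "y \<in> gen_subring H'"
      by blast
    then have "x \<in> gen_subring (H \<union> H')" "y \<in> gen_subring (H \<union> H')"
      using gen_subring_mono[of H "H \<union> H'"] gen_subring_mono[of H' "H \<union> H'"] by auto
    with H show ?case by (intro exI[of _ "H \<union> H'"]) (auto intro: gen_subring.intros)
  next
    case (mult x y)
    then obtain H H' where H: "finite H" "H \<subseteq> G" "x \<in> gen_subring H" "finite H'" "H' \<subseteq> G" "y \<in> gen_subring H'"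
      by blast
    then have "x \<in> gen_subring (H \<union> H')" "y \<in> gen_subring (H \<union> H')"
      using gen_subring_mono[of H "H \<union> H'"] gen_subring_mono[of H' "H \<union> H'"] by auto
    with H show ?case by (intro exI[of _ "H \<union> H'"]) (auto intro: gen_subring.intros)
  qed
  with that show ?thesis by blast
qed

lemma gen_subring_hom:
  assumes "comm_ring_hom h" "x \<in> gen_subring G" "h ` G \<subseteq> H"
  shows "h x \<in> gen_subring H"
proof -
  interpret comm_ring_hom h by fact
  from assms(2) show ?thesis
    by induction (use assms(3) in \<open>auto intro: gen_subring.intros simp: hom_distribs\<close>)
qed

section \<open>Substitution into polynomials as a ring homomorphism\<close>

lemma poly_mapping_eq_sum_single:
  fixes P :: "'x \<Rightarrow>\<^sub>0 'y::comm_monoid_add"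
  shows "P = (\<Sum>u\<in>Poly_Mapping.keys P. Poly_Mapping.single u (Poly_Mapping.lookup P u))"
  by (rule poly_mapping_eqI) (auto simp: lookup_sum lookup_single when_def in_keys_iff)

context
  fixes \<iota> :: "'k::comm_ring_1 \<Rightarrow> 'a::comm_ring_1" and y :: "nat \<Rightarrow> 'a"
  assumes hom: "comm_ring_hom \<iota>"
begin

interpretation comm_ring_hom \<iota> by (rule hom)

lemma poly_subst_superset:
  assumes "finite K" "Poly_Mapping.keys P \<subseteq> K"
  shows "poly_subst \<iota> y P = (\<Sum>u\<in>K. \<iota> (Poly_Mapping.lookup P u) * (\<Prod>i\<in>Poly_Mapping.keys u. y i ^ Poly_Mapping.lookup u i))"
  unfolding poly_subst_def using assms
  by (intro sum.mono_neutral_left) (auto simp: in_keys_iff)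

lemma poly_subst_add: "poly_subst \<iota> y (P + Q) = poly_subst \<iota> y P + poly_subst \<iota> y Q"
proof -
  let ?K = "Poly_Mapping.keys P \<union> Poly_Mapping.keys Q"
  have "Poly_Mapping.keys (P + Q) \<subseteq> ?K" by (rule Poly_Mapping.keys_add)
  then show ?thesis
    using poly_subst_superset[of ?K P] poly_subst_superset[of ?K Q] poly_subst_superset[of ?K "P + Q"]
    by (simp add: lookup_add hom_distribs sum.distrib distrib_right)
qed

lemma poly_subst_zero [simp]: "poly_subst \<iota> y 0 = 0"
  by (simp add: poly_subst_def)

lemma poly_subst_sum: "poly_subst \<iota> y (sum f I) = (\<Sum>i\<in>I. poly_subst \<iota> y (f i))"
  by (induction I rule: infinite_finite_induct) (auto simp: poly_subst_add)

lemma poly_subst_uminus: "poly_subst \<iota> y (- P) = - poly_subst \<iota> y P"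
  using poly_subst_add[of P "- P"] by (simp add: eq_neg_iff_add_eq_0 add.commute)

lemma poly_subst_single:
  "poly_subst \<iota> y (Poly_Mapping.single u c) = \<iota> c * (\<Prod>i\<in>Poly_Mapping.keys u. y i ^ Poly_Mapping.lookup u i)"
  by (cases "c = 0") (auto simp: poly_subst_def)

lemma monomial_subst_add:
  fixes u v :: "nat \<Rightarrow>\<^sub>0 nat"
  shows "(\<Prod>i\<in>Poly_Mapping.keys (u + v). y i ^ Poly_Mapping.lookup (u + v) i) =
    (\<Prod>i\<in>Poly_Mapping.keys u. y i ^ Poly_Mapping.lookup u i) * (\<Prod>i\<in>Poly_Mapping.keys v. y i ^ Poly_Mapping.lookup v i)"
proof -
  let ?K = "Poly_Mapping.keys u \<union> Poly_Mapping.keys v"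
  have *: "(\<Prod>i\<in>Poly_Mapping.keys w. y i ^ Poly_Mapping.lookup w i) = (\<Prod>i\<in>?K. y i ^ Poly_Mapping.lookup w i)"
    if "Poly_Mapping.keys w \<subseteq> ?K" for w :: "nat \<Rightarrow>\<^sub>0 nat"
    using that by (intro prod.mono_neutral_left) (auto simp: in_keys_iff)
  show ?thesis
    using *[of u] *[of v] *[of "u + v"] Poly_Mapping.keys_add[of u v]
    by (simp add: lookup_add power_add prod.distrib)
qed

lemma poly_subst_mult: "poly_subst \<iota> y (P * Q) = poly_subst \<iota> y P * poly_subst \<iota> y Q"
proof -
  let ?s = "\<lambda>P u. Poly_Mapping.single u (Poly_Mapping.lookup P u)"
  have "P * Q = (\<Sum>u\<in>Poly_Mapping.keys P. ?s P u) * (\<Sum>v\<in>Poly_Mapping.keys Q. ?s Q v)"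
    using poly_mapping_eq_sum_single[of P] poly_mapping_eq_sum_single[of Q] by simp
  then have "poly_subst \<iota> y (P * Q) =
      (\<Sum>u\<in>Poly_Mapping.keys P. \<Sum>v\<in>Poly_Mapping.keys Q. poly_subst \<iota> y (?s P u * ?s Q v))"
    by (simp add: sum_product poly_subst_sum)
  also have "\<dots> = (\<Sum>u\<in>Poly_Mapping.keys P. \<Sum>v\<in>Poly_Mapping.keys Q. poly_subst \<iota> y (?s P u) * poly_subst \<iota> y (?s Q v))"
    by (simp add: mult_single poly_subst_single monomial_subst_add hom_distribs mult_ac)
  also have "\<dots> = poly_subst \<iota> y (\<Sum>u\<in>Poly_Mapping.keys P. ?s P u) * poly_subst \<iota> y (\<Sum>v\<in>Poly_Mapping.keys Q. ?s Q v)"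
    by (simp add: sum_product poly_subst_sum)
  finally show ?thesis
    using poly_mapping_eq_sum_single[of P] poly_mapping_eq_sum_single[of Q] by simp
qed

lemma poly_subst_one: "poly_subst \<iota> y 1 = 1"
  using poly_subst_single[of 0 1] by simp

text \<open>With integer coefficients this homomorphism specializes matrices of indeterminates to
  given matrices.\<close>

lemma comm_ring_hom_poly_subst: "comm_ring_hom (poly_subst \<iota> y)"
  by unfold_locales (auto simp: poly_subst_add poly_subst_mult poly_subst_one)

end

lemma int_coeffs_mult:
  fixes P Q :: "'x::monoid_add \<Rightarrow>\<^sub>0 'k::ring_1"
  assumes "\<forall>u. Poly_Mapping.lookup P u \<in> \<int>" "\<forall>u. Poly_Mapping.lookup Q u \<in> \<int>"
  shows "Poly_Mapping.lookup (P * Q) u \<in> \<int>"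
proof -
  let ?s = "\<lambda>P u. Poly_Mapping.single u (Poly_Mapping.lookup P u)"
  have "P * Q = (\<Sum>u\<in>Poly_Mapping.keys P. ?s P u) * (\<Sum>v\<in>Poly_Mapping.keys Q. ?s Q v)"
    using poly_mapping_eq_sum_single[of P] poly_mapping_eq_sum_single[of Q] by simp
  also have "\<dots> = (\<Sum>u\<in>Poly_Mapping.keys P. \<Sum>v\<in>Poly_Mapping.keys Q. Poly_Mapping.single (u + v) (Poly_Mapping.lookup P u * Poly_Mapping.lookup Q v))"
    by (simp add: sum_product mult_single)
  finally show ?thesis
    using assms by (auto simp: lookup_sum lookup_single when_def intro!: Ints_sum)
qed

lemma gen_subring_imp_polynomial_in:
  fixes \<iota> :: "'k::field \<Rightarrow> 'a::comm_ring_1"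
  assumes hom: "comm_ring_hom \<iota>" and f: "f \<in> gen_subring G"
  shows "polynomial_in \<iota> \<int> G f"
proof -
  interpret comm_ring_hom \<iota> by fact
  obtain H where H: "finite H" "H \<subseteq> G" "f \<in> gen_subring H"
    using gen_subring_finite[OF f] .
  obtain y N where yN: "H = y ` {i::nat. i < N}"
    using H(1) by (auto simp: finite_conv_nat_seg_image)
  \<comment> \<open>Only the values y i with i < N are known to be generators, so the variables are
    confined to that range.\<close>
  define ok where "ok P \<longleftrightarrow> (\<forall>u. Poly_Mapping.lookup P u \<in> \<int>) \<and> (\<forall>u\<in>Poly_Mapping.keys P. Poly_Mapping.keys u \<subseteq> {i. i < N})"
    for P :: "(nat \<Rightarrow>\<^sub>0 nat) \<Rightarrow>\<^sub>0 'k"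
  from H(3) have "\<exists>P. ok P \<and> f = poly_subst \<iota> y P"
  proof induction
    case (gen g)
    then obtain i where i: "i < N" "g = y i" using yN by auto
    show ?case
      by (intro exI[of _ "Poly_Mapping.single (Poly_Mapping.single i 1) 1"])
         (use i in \<open>auto simp: ok_def poly_subst_single[OF hom] lookup_single when_def\<close>)
  next
    case one
    then show ?case
      by (intro exI[of _ 1]) (auto simp: ok_def poly_subst_one[OF hom] lookup_one when_def)
  next
    case (diff f g)
    then obtain P Q where P: "ok P" "f = poly_subst \<iota> y P" and Q: "ok Q" "g = poly_subst \<iota> y Q" by auto
    have "Poly_Mapping.keys (P - Q) \<subseteq> Poly_Mapping.keys P \<union> Poly_Mapping.keys Q"
      by (auto simp: in_keys_iff lookup_minus)
    with P Q have "ok (P - Q)" by (fastforce simp: ok_def lookup_minus)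
    moreover have "f - g = poly_subst \<iota> y (P - Q)"
      using P Q poly_subst_add[OF hom, of y P "- Q"] poly_subst_uminus[OF hom, of y Q] by simp
    ultimately show ?case by blast
  next
    case (mult f g)
    then obtain P Q where P: "ok P" "f = poly_subst \<iota> y P" and Q: "ok Q" "g = poly_subst \<iota> y Q" by auto
    have "Poly_Mapping.keys w \<subseteq> {i. i < N}" if w: "w \<in> Poly_Mapping.keys (P * Q)" for w
    proof -
      from w Poly_Mapping.keys_mult[of P Q] obtain u v where "u \<in> Poly_Mapping.keys P" "v \<in> Poly_Mapping.keys Q" "w = u + v"
        by blast
      with P Q Poly_Mapping.keys_add[of u v] show ?thesis by (force simp: ok_def)
    qed
    with P Q have "ok (P * Q)" by (auto simp: ok_def intro: int_coeffs_mult)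
    moreover have "f * g = poly_subst \<iota> y (P * Q)"
      using P Q poly_subst_mult[OF hom] by simp
    ultimately show ?case by blast
  qed
  then obtain P where P: "ok P" "f = poly_subst \<iota> y P" by blast
  show ?thesis unfolding polynomial_in_def
    using P H(2) yN by (intro exI[of _ P] exI[of _ y]) (fastforce simp: ok_def)
qed

section \<open>Pfaffian sums over a matching\<close>

text \<open>The tableau condition over an arbitrary set of cells, because the Pfaffian identities
  know nothing of columns.\<close>

definition matching :: "cell set \<Rightarrow> arrow set \<Rightarrow> bool" where
  "matching C T \<longleftrightarrow>
     (\<forall>a\<in>T. tail_cell a \<in> C \<and> head_cell a \<in> C \<and> tail_cell a \<noteq> head_cell a) \<and>
     (\<forall>c\<in>C. \<exists>!a. a \<in> T \<and> (c = head_cell a \<or> c = tail_cell a))"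

lemma tableau_iff_matching: "tableau n T \<longleftrightarrow> matching (cells n) T"
  by (simp add: tableau_def matching_def)

lemma finite_cells [simp]: "finite (cells n)"
proof -
  have "cells n = (SIGMA i:{..<length n}. {..<n ! i})"
    by (auto simp: cells_def)
  then show ?thesis by simp
qed

context
  fixes C :: "cell set" and T :: "arrow set"
  assumes M: "matching C T"
begin

lemma matching_cell: "a \<in> T \<Longrightarrow> tail_cell a \<in> C" "a \<in> T \<Longrightarrow> head_cell a \<in> C"
  using M by (auto simp: matching_def)

lemma matching_unique:
  assumes "a \<in> T" "b \<in> T" "{tail_cell a, head_cell a} \<inter> {tail_cell b, head_cell b} \<noteq> {}"
  shows "a = b"
proof -
  obtain c where c: "c \<in> {tail_cell a, head_cell a}" "c \<in> {tail_cell b, head_cell b}"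
    using assms(3) by blast
  then have "c \<in> C" using matching_cell assms(1) by auto
  then have "\<exists>!a. a \<in> T \<and> (c = head_cell a \<or> c = tail_cell a)"
    using M by (simp add: matching_def)
  then show ?thesis using c assms(1,2) by (auto elim!: ex1E)
qed

lemma matching_tail_neq_head: "a \<in> T \<Longrightarrow> b \<in> T \<Longrightarrow> tail_cell a \<noteq> head_cell b"
  using matching_unique[of a b] M by (auto simp: matching_def)

lemma inj_on_tail_cell: "inj_on tail_cell T"
  by (rule inj_onI) (use matching_unique in blast)

lemma inj_on_head_cell: "inj_on head_cell T"
  by (rule inj_onI) (use matching_unique in blast)

lemma matching_disjoint: "tail_cell ` T \<inter> head_cell ` T = {}"
proof -
  have False if "a \<in> T" "b \<in> T" "tail_cell a = head_cell b" for a b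
    using matching_tail_neq_head[OF that(1,2)] that(3) by simp
  then show ?thesis by blast
qed

lemma matching_cover: "tail_cell ` T \<union> head_cell ` T = C"
proof
  show "tail_cell ` T \<union> head_cell ` T \<subseteq> C" using matching_cell by auto
  show "C \<subseteq> tail_cell ` T \<union> head_cell ` T"
  proof
    fix c assume "c \<in> C"
    then obtain a where "a \<in> T" "c = head_cell a \<or> c = tail_cell a"
      using M unfolding matching_def by blast
    then show "c \<in> tail_cell ` T \<union> head_cell ` T" by auto
  qed
qed

lemma matching_finite: "finite C \<Longrightarrow> finite T"
  using matching_cover inj_on_tail_cell by (metis finite_Un finite_imageD)

lemma prod_matching:
  assumes "finite C"
  shows "prod g C = (\<Prod>a\<in>T. g (tail_cell a) * g (head_cell a) :: 'a::comm_monoid_mult)"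
proof -
  have fin: "finite (tail_cell ` T)" "finite (head_cell ` T)"
    using assms matching_finite by auto
  have "prod g C = prod g (tail_cell ` T) * prod g (head_cell ` T)"
    using prod.union_disjoint[OF fin matching_disjoint] matching_cover by metis
  also have "\<dots> = (\<Prod>a\<in>T. g (tail_cell a)) * (\<Prod>a\<in>T. g (head_cell a))"
    using inj_on_tail_cell inj_on_head_cell by (simp add: prod.reindex)
  finally show ?thesis by (simp add: prod.distrib)
qed

lemma card_matching:
  assumes "finite C"
  shows "card C = 2 * card T"
proof -
  have fin: "finite (tail_cell ` T)" "finite (head_cell ` T)"
    using assms matching_finite by auto
  show ?thesis
    using card_Un_disjoint[OF fin matching_disjoint] matching_cover
      card_image[OF inj_on_tail_cell] card_image[OF inj_on_head_cell] by simp
qed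

text \<open>tau moves the tails and the heads in the same way, so its sign enters twice and
  cancels.\<close>

lemma arrow_permutation_lift:
  assumes "finite C" "\<tau> permutes T"
  obtains p where "p permutes C" "sign p = 1"
    "\<And>a. a \<in> T \<Longrightarrow> p (tail_cell a) = tail_cell (\<tau> a)"
    "\<And>a. a \<in> T \<Longrightarrow> p (head_cell a) = head_cell (\<tau> a)"
proof -
  let ?t = "map_permutation T tail_cell \<tau>" and ?h = "map_permutation T head_cell \<tau>"
  have t: "?t permutes tail_cell ` T" and h: "?h permutes head_cell ` T"
    using assms(2) inj_on_tail_cell inj_on_head_cell
    by (auto intro!: map_permutation_permutes simp: inj_on_imp_bij_betw)
  have tC: "?t permutes C" and hC: "?h permutes C"
    using permutes_subset[OF t] permutes_subset[OF h] matching_cover by auto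
  have s: "sign ?t = sign \<tau>" "sign ?h = sign \<tau>"
    using assms matching_finite inj_on_tail_cell inj_on_head_cell
    by (auto intro!: sign_map_permutation)
  show thesis
  proof (rule that[of "?t \<circ> ?h"])
    show "?t \<circ> ?h permutes C" by (rule permutes_compose[OF hC tC])
    show "sign (?t \<circ> ?h) = 1"
      using permutes_imp_permutation[OF assms(1) tC] permutes_imp_permutation[OF assms(1) hC]
      by (simp add: sign_compose s)
    fix a assume a: "a \<in> T"
    then have \<tau>a: "\<tau> a \<in> T" using permutes_in_image[OF assms(2)] by simp
    have "tail_cell a \<notin> head_cell ` T" "head_cell (\<tau> a) \<notin> tail_cell ` T"
      using a \<tau>a matching_disjoint by auto
    then have "?h (tail_cell a) = tail_cell a" "?t (head_cell (\<tau> a)) = head_cell (\<tau> a)"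
      using permutes_not_in[OF h] permutes_not_in[OF t] by auto
    moreover have "?t (tail_cell a) = tail_cell (\<tau> a)" "?h (head_cell a) = head_cell (\<tau> a)"
      using a assms(2) inj_on_tail_cell inj_on_head_cell by (auto intro!: map_permutation_apply)
    ultimately show "(?t \<circ> ?h) (tail_cell a) = tail_cell (\<tau> a)" "(?t \<circ> ?h) (head_cell a) = head_cell (\<tau> a)"
      by simp_all
  qed
qed

end

text \<open>A polarized Pfaffian. For a matching T of a finite C and one form Z on all arrows, the
  value is, up to sign, |T|! times the Pfaffian of Z minus its transpose. Separate forms on the
  arrows permit multilinear expansion.\<close>

definition pf_sum :: "cell set \<Rightarrow> arrow set \<Rightarrow> (arrow \<Rightarrow> cell \<Rightarrow> cell \<Rightarrow> 'b) \<Rightarrow> 'b::comm_ring_1" where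
  "pf_sum C T Z = (\<Sum>p | p permutes C. of_int (sign p) *
     (\<Prod>a\<in>T. Z a (p (tail_cell a)) (p (head_cell a))))"

text \<open>Rows and columns are indexed by cells, for which no numbering is chosen.\<close>

definition det_on :: "'c set \<Rightarrow> ('c \<Rightarrow> 'c \<Rightarrow> 'b) \<Rightarrow> 'b::comm_ring_1" where
  "det_on C P = (\<Sum>p | p permutes C. of_int (sign p) * (\<Prod>c\<in>C. P c (p c)))"

lemma sum_permutes_compose_right:
  assumes "q permutes C"
  shows "(\<Sum>p | p permutes C. f p) = (\<Sum>p | p permutes C. f (p \<circ> q))"
  using assms
  by (intro sum.reindex_bij_witness[of _ "\<lambda>p. p \<circ> q" "\<lambda>p. p \<circ> inv_into UNIV q"])
     (auto intro: permutes_compose permutes_inv simp: comp_assoc permutes_inv_o)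

lemma sign_permutes_compose:
  assumes "finite C" "p permutes C" "q permutes C"
  shows "sign (p \<circ> q) = sign p * sign q"
  using assms permutes_imp_permutation sign_compose by metis

text \<open>The product depends on p only through the relative permutation q o p^-1, whose sign is
  sign q * sign p and which runs through all permutations of C.\<close>

lemma det_on_permuted:
  assumes "finite C" "q permutes C"
  shows "(\<Sum>p | p permutes C. of_int (sign p) * (\<Prod>c\<in>C. P (p c) (q c))) = of_int (sign q) * det_on C P"
proof -
  have "(\<Sum>p | p permutes C. of_int (sign p) * (\<Prod>c\<in>C. P (p c) (q c)))
    = (\<Sum>r | r permutes C. of_int (sign q) * (of_int (sign r) * (\<Prod>c\<in>C. P c (r c))))"
  proof (rule sum.reindex_bij_witness[of _ "\<lambda>r. inv_into UNIV r \<circ> q" "\<lambda>p. q \<circ> inv_into UNIV p"])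
    fix p assume "p \<in> {p. p permutes C}"
    then have p: "p permutes C" by simp
    show "inv_into UNIV (q \<circ> inv_into UNIV p) \<circ> q = p"
    proof -
      have "inv_into UNIV (q \<circ> inv_into UNIV p) = p \<circ> inv_into UNIV q"
        using o_inv_distrib[OF permutes_bij[OF assms(2)] permutes_bij[OF permutes_inv[OF p]]]
          inv_inv_eq[OF permutes_bij[OF p]] by simp
      then show ?thesis by (simp add: comp_assoc permutes_inv_o[OF assms(2)])
    qed
    show "q \<circ> inv_into UNIV p \<in> {p. p permutes C}"
      using p assms(2) by (simp add: permutes_compose permutes_inv)
    have "sign (q \<circ> inv_into UNIV p) = sign q * sign p"
      using sign_permutes_compose[OF assms(1,2) permutes_inv[OF p]]
        sign_inverse[OF permutes_imp_permutation[OF assms(1) p]] by simp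
    moreover have "(\<Prod>c\<in>C. P (p c) (q c)) = (\<Prod>c\<in>C. P c ((q \<circ> inv_into UNIV p) c))"
      using prod.permute[OF p, of "\<lambda>c. P c ((q \<circ> inv_into UNIV p) c)"] permutes_inverses(2)[OF p]
      by (simp add: comp_def)
    ultimately show "of_int (sign q) * (of_int (sign (q \<circ> inv_into UNIV p)) * (\<Prod>c\<in>C. P c ((q \<circ> inv_into UNIV p) c)))
      = of_int (sign p) * (\<Prod>c\<in>C. P (p c) (q c))"
      by (simp add: mult.assoc[symmetric] of_int_mult[symmetric] del: of_int_mult)
  next
    fix r assume "r \<in> {p. p permutes C}"
    then have r: "r permutes C" by simp
    show "q \<circ> inv_into UNIV (inv_into UNIV r \<circ> q) = r"
    proof -
      have "inv_into UNIV (inv_into UNIV r \<circ> q) = inv_into UNIV q \<circ> r"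
        using o_inv_distrib[OF permutes_bij[OF permutes_inv[OF r]] permutes_bij[OF assms(2)]]
          inv_inv_eq[OF permutes_bij[OF r]] by simp
      then show ?thesis by (simp add: comp_assoc[symmetric] permutes_inv_o[OF assms(2)])
    qed
    show "inv_into UNIV r \<circ> q \<in> {p. p permutes C}"
      using r assms(2) by (simp add: permutes_compose permutes_inv)
  qed
  then show ?thesis by (simp add: det_on_def sum_distrib_left)
qed

lemma eq_uminus_imp_zero:
  fixes x :: "'b::{idom,ring_char_0}"
  assumes "x = - x"
  shows "x = 0"
proof -
  have "2 * x = 0" using eq_neg_iff_add_eq_0[THEN iffD1, OF assms] by (simp only: mult_2)
  then show ?thesis by simp
qed

text \<open>A determinant with two equal columns: exchanging them turns the sum into its own
  negative, so in characteristic zero it vanishes.\<close>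

lemma det_on_not_inj:
  fixes P :: "'c \<Rightarrow> 'c \<Rightarrow> 'b::{idom,ring_char_0}"
  assumes "finite C" "\<not> inj_on g C"
  shows "(\<Sum>p | p permutes C. of_int (sign p) * (\<Prod>c\<in>C. P (p c) (g c))) = 0" (is "?S = 0")
proof -
  obtain x y where xy: "x \<in> C" "y \<in> C" "x \<noteq> y" "g x = g y"
    using assms(2) by (auto simp: inj_on_def)
  let ?t = "Transposition.transpose x y"
  have t: "?t permutes C" using xy by (simp add: permutes_swap_id)
  have g: "g (?t c) = g c" for c
    using xy by (auto simp: transpose_def)
  have "?S = (\<Sum>p | p permutes C. of_int (sign (p \<circ> ?t)) * (\<Prod>c\<in>C. P ((p \<circ> ?t) c) (g c)))"
    by (rule sum_permutes_compose_right[OF t])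
  also have "\<dots> = (\<Sum>p | p permutes C. - (of_int (sign p) * (\<Prod>c\<in>C. P (p c) (g c))))"
  proof (rule sum.cong[OF refl])
    fix p assume "p \<in> {p. p permutes C}"
    then have p: "p permutes C" by simp
    have "(\<Prod>c\<in>C. P (p c) (g c)) = (\<Prod>c\<in>C. P ((p \<circ> ?t) c) (g c))"
      using prod.permute[OF t, of "\<lambda>c. P (p c) (g c)"] g by (simp add: comp_def)
    then show "of_int (sign (p \<circ> ?t)) * (\<Prod>c\<in>C. P ((p \<circ> ?t) c) (g c))
      = - (of_int (sign p) * (\<Prod>c\<in>C. P (p c) (g c)))"
      using sign_permutes_compose[OF assms(1) p t] xy by (simp add: sign_swap_id)
  qed
  also have "\<dots> = - ?S" by (simp add: sum_negf)
  finally show ?thesis by (rule eq_uminus_imp_zero)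
qed

lemma pf_sum_cong:
  assumes "matching C T" "\<And>a c d. a \<in> T \<Longrightarrow> c \<in> C \<Longrightarrow> d \<in> C \<Longrightarrow> Z a c d = Z' a c d"
  shows "pf_sum C T Z = pf_sum C T Z'"
  unfolding pf_sum_def
proof (intro sum.cong refl arg_cong2[where f = "(*)"] prod.cong)
  fix p a assume "p \<in> {p. p permutes C}" "a \<in> T"
  then show "Z a (p (tail_cell a)) (p (head_cell a)) = Z' a (p (tail_cell a)) (p (head_cell a))"
    using matching_cell[OF assms(1)] permutes_in_image by (intro assms(2)) fastforce+
qed

text \<open>The rule Pf(P Z P^t) = det P * Pf Z in polarized form. Each cell is an end of exactly
  one arrow, so expanding the product amounts to choosing a map g from C to C. For fixed g the sum
  over p is the determinant of P with its columns selected by g: it vanishes unless g is injective,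
  and otherwise g is a permutation that contributes its sign.\<close>

lemma pf_sum_congruence:
  fixes P :: "cell \<Rightarrow> cell \<Rightarrow> 'b::{idom,ring_char_0}"
  assumes "finite C" and M: "matching C T"
  shows "pf_sum C T (\<lambda>a c d. \<Sum>c'\<in>C. \<Sum>d'\<in>C. P c c' * P d d' * Z a c' d') = det_on C P * pf_sum C T Z"
proof -
  let ?w = "\<lambda>p a x. P (p (tail_cell a)) (fst x) * P (p (head_cell a)) (snd x) * Z a (fst x) (snd x)"
  let ?zz = "\<lambda>g. \<Prod>a\<in>T. Z a (g (tail_cell a)) (g (head_cell a))"
  note finT = matching_finite[OF M assms(1)]
  have exp: "(\<Prod>a\<in>T. \<Sum>c'\<in>C. \<Sum>d'\<in>C. P (p (tail_cell a)) c' * P (p (head_cell a)) d' * Z a c' d')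
    = (\<Sum>g\<in>C \<rightarrow>\<^sub>E C. (\<Prod>c\<in>C. P (p c) (g c)) * ?zz g)" for p
  proof -
    have "(\<Prod>a\<in>T. \<Sum>c'\<in>C. \<Sum>d'\<in>C. P (p (tail_cell a)) c' * P (p (head_cell a)) d' * Z a c' d')
      = (\<Prod>a\<in>T. \<Sum>x\<in>C \<times> C. ?w p a x)"
      by (simp add: sum.cartesian_product case_prod_unfold)
    also have "\<dots> = (\<Sum>h\<in>T \<rightarrow>\<^sub>E C \<times> C. \<Prod>a\<in>T. ?w p a (h a))"
      using finT assms(1) by (intro prod_sum_PiE) auto
    \<comment> \<open>A pair of cells for every arrow is the same as one cell for every cell: the
      pair gives the values at the tail and at the head.\<close>
    also have "\<dots> = (\<Sum>g\<in>C \<rightarrow>\<^sub>E C. \<Prod>a\<in>T. ?w p a (g (tail_cell a), g (head_cell a)))"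
    proof (rule sum.reindex_bij_witness[of _
          "\<lambda>g. restrict (\<lambda>a. (g (tail_cell a), g (head_cell a))) T"
          "\<lambda>h. restrict (\<lambda>c. if c \<in> tail_cell ` T then fst (h (inv_into T tail_cell c)) else snd (h (inv_into T head_cell c))) C"])
      fix h assume h: "h \<in> T \<rightarrow>\<^sub>E C \<times> C"
      let ?h = "restrict (\<lambda>c. if c \<in> tail_cell ` T then fst (h (inv_into T tail_cell c)) else snd (h (inv_into T head_cell c))) C"
      have *: "?h (tail_cell a) = fst (h a)" "?h (head_cell a) = snd (h a)" if a: "a \<in> T" for a
      proof -
        have "head_cell a \<notin> tail_cell ` T" using a matching_disjoint[OF M] by auto
        then show "?h (tail_cell a) = fst (h a)" "?h (head_cell a) = snd (h a)"
          using a matching_cell[OF M] inj_on_tail_cell[OF M] inj_on_head_cell[OF M] by simp_all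
      qed
      show "restrict (\<lambda>a. (?h (tail_cell a), ?h (head_cell a))) T = h"
      proof
        fix a
        show "restrict (\<lambda>a. (?h (tail_cell a), ?h (head_cell a))) T a = h a"
        proof (cases "a \<in> T")
          case True
          then show ?thesis unfolding restrict_apply'[OF True] *[OF True] by simp
        next
          case False
          then show ?thesis using PiE_arb[OF h False] by (simp only: restrict_apply if_False)
        qed
      qed
      show "?h \<in> C \<rightarrow>\<^sub>E C"
      proof
        fix c assume "c \<in> C"
        then obtain a where a: "a \<in> T" "c = tail_cell a \<or> c = head_cell a"
          using matching_cover[OF M] by blast
        then have "h a \<in> C \<times> C" using h by auto
        then have "?h (tail_cell a) \<in> C" "?h (head_cell a) \<in> C"
          unfolding *[OF a(1)] by (simp_all add: mem_Times_iff)
        then show "?h c \<in> C" using a(2) by (elim disjE) (simp_all only:)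
      qed auto
      show "(\<Prod>a\<in>T. ?w p a (?h (tail_cell a), ?h (head_cell a))) = (\<Prod>a\<in>T. ?w p a (h a))"
        using * by (intro prod.cong) auto
    next
      fix g assume g: "g \<in> C \<rightarrow>\<^sub>E C"
      let ?k = "restrict (\<lambda>a. (g (tail_cell a), g (head_cell a))) T"
      show "restrict (\<lambda>c. if c \<in> tail_cell ` T then fst (?k (inv_into T tail_cell c)) else snd (?k (inv_into T head_cell c))) C = g"
        (is "restrict ?l C = g")
      proof
        fix c
        show "restrict ?l C c = g c"
        proof (cases "c \<in> C")
          case True
          then obtain a where "a \<in> T" "c = tail_cell a \<or> c = head_cell a \<and> c \<notin> tail_cell ` T"
            using matching_cover[OF M] matching_disjoint[OF M] by auto
          then show ?thesis
            using inj_on_tail_cell[OF M] inj_on_head_cell[OF M] True by auto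
        next
          case False
          then show ?thesis using PiE_arb[of g C "\<lambda>_. C" c] g by simp
        qed
      qed
      show "?k \<in> T \<rightarrow>\<^sub>E C \<times> C"
        using g matching_cell[OF M] by auto
    qed
    also have "\<dots> = (\<Sum>g\<in>C \<rightarrow>\<^sub>E C. (\<Prod>c\<in>C. P (p c) (g c)) * ?zz g)"
      by (simp add: prod.distrib prod_matching[OF M assms(1)])
    finally show ?thesis .
  qed
  let ?D = "\<lambda>g. \<Sum>p | p permutes C. of_int (sign p) * (\<Prod>c\<in>C. P (p c) (g c))"
  have "pf_sum C T (\<lambda>a c d. \<Sum>c'\<in>C. \<Sum>d'\<in>C. P c c' * P d d' * Z a c' d')
    = (\<Sum>p | p permutes C. \<Sum>g\<in>C \<rightarrow>\<^sub>E C. of_int (sign p) * (\<Prod>c\<in>C. P (p c) (g c)) * ?zz g)"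
    unfolding pf_sum_def exp by (simp only: sum_distrib_left mult.assoc)
  also have "\<dots> = (\<Sum>g\<in>C \<rightarrow>\<^sub>E C. ?D g * ?zz g)"
    by (subst sum.swap) (simp add: sum_distrib_right)
  also have "\<dots> = (\<Sum>g\<in>{g \<in> C \<rightarrow>\<^sub>E C. inj_on g C}. ?D g * ?zz g)"
    using assms(1) det_on_not_inj[OF assms(1), of _ P]
    by (intro sum.mono_neutral_right finite_PiE) auto
  also have "\<dots> = (\<Sum>q | q permutes C. of_int (sign q) * det_on C P * ?zz q)"
  proof (rule sum.reindex_bij_witness[of _ "\<lambda>q. restrict q C" "\<lambda>g x. if x \<in> C then g x else x"])
    fix g assume g: "g \<in> {g \<in> C \<rightarrow>\<^sub>E C. inj_on g C}"
    let ?q = "\<lambda>x. if x \<in> C then g x else x"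
    show "restrict ?q C = g" using g by (auto simp: PiE_def extensional_def restrict_def fun_eq_iff)
    have gC: "g ` C = C" using g assms(1) by (intro endo_inj_surj) auto
    then have "bij_betw g C C" using g by (auto simp: bij_betw_def)
    then have "bij_betw ?q C C" by (rule bij_betw_cong[THEN iffD1, rotated]) simp
    then have q: "?q permutes C" by (intro bij_imp_permutes) auto
    then show "?q \<in> {q. q permutes C}" by simp
    have "?D g = ?D ?q" by (intro sum.cong refl arg_cong2[where f = "(*)"] prod.cong) auto
    moreover have "?zz g = ?zz ?q" using matching_cell[OF M] by (intro prod.cong) auto
    ultimately show "of_int (sign ?q) * det_on C P * ?zz ?q = ?D g * ?zz g"
      using det_on_permuted[OF assms(1) q, of P] by simp
  next
    fix q assume "q \<in> {q. q permutes C}"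
    then have q: "q permutes C" by simp
    show "(\<lambda>x. if x \<in> C then restrict q C x else x) = q"
      using permutes_not_in[OF q] by (auto simp: fun_eq_iff)
    show "restrict q C \<in> {g \<in> C \<rightarrow>\<^sub>E C. inj_on g C}"
      using permutes_in_image[OF q] permutes_inj_on[OF q, of C] by (auto simp: inj_on_def)
  qed
  finally show ?thesis by (simp add: pf_sum_def sum_distrib_left mult_ac)
qed

lemma pf_sum_update_diff:
  assumes "finite T" "a \<in> T"
  shows "pf_sum C T (Z(a := \<lambda>c d. V c d - V' c d)) = pf_sum C T (Z(a := V)) - pf_sum C T (Z(a := V'))"
proof -
  have *: "(\<Prod>b\<in>T. (Z(a := V)) b (p (tail_cell b)) (p (head_cell b))) =
    V (p (tail_cell a)) (p (head_cell a)) * (\<Prod>b\<in>T-{a}. Z b (p (tail_cell b)) (p (head_cell b)))" for p V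
    using assms by (subst prod.remove[of _ a]) auto
  show ?thesis
    unfolding pf_sum_def * by (simp add: algebra_simps sum_subtractf)
qed

text \<open>Reversing one arrow is the transposition of its two cells, which leaves all other arrows
  alone and changes the sign.\<close>

lemma pf_sum_transpose_arrow:
  assumes "finite C" and M: "matching C T" and "a \<in> T"
  shows "pf_sum C T (Z(a := \<lambda>c d. V d c)) = - pf_sum C T (Z(a := V))"
proof -
  let ?t = "Transposition.transpose (tail_cell a) (head_cell a)"
  note finT = matching_finite[OF M assms(1)]
  have t: "?t permutes C" using matching_cell[OF M \<open>a \<in> T\<close>] by (simp add: permutes_swap_id)
  have neq: "tail_cell a \<noteq> head_cell a" using M \<open>a \<in> T\<close> by (auto simp: matching_def)
  have tt: "(p \<circ> ?t) (tail_cell a) = p (head_cell a)" "(p \<circ> ?t) (head_cell a) = p (tail_cell a)" for p :: "cell \<Rightarrow> cell"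
    by simp_all
  have *: "(\<Prod>b\<in>T. (Z(a := V)) b (p (tail_cell b)) (p (head_cell b))) =
    V (p (tail_cell a)) (p (head_cell a)) * (\<Prod>b\<in>T-{a}. Z b (p (tail_cell b)) (p (head_cell b)))" for p V
    using assms finT by (subst prod.remove[of _ a]) auto
  have **: "(\<Prod>b\<in>T-{a}. Z b ((p \<circ> ?t) (tail_cell b)) ((p \<circ> ?t) (head_cell b))) =
    (\<Prod>b\<in>T-{a}. Z b (p (tail_cell b)) (p (head_cell b)))" for p
  proof (rule prod.cong[OF refl])
    fix b assume "b \<in> T - {a}"
    then have "{tail_cell a, head_cell a} \<inter> {tail_cell b, head_cell b} = {}"
      using matching_unique[OF M \<open>a \<in> T\<close>, of b] by auto
    then show "Z b ((p \<circ> ?t) (tail_cell b)) ((p \<circ> ?t) (head_cell b)) = Z b (p (tail_cell b)) (p (head_cell b))"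
      by (auto simp: transpose_def)
  qed
  have "pf_sum C T (Z(a := \<lambda>c d. V d c)) = (\<Sum>p | p permutes C. - (of_int (sign p) *
      (\<Prod>b\<in>T. (Z(a := V)) b (p (tail_cell b)) (p (head_cell b)))))"
    unfolding pf_sum_def
    by (subst sum_permutes_compose_right[OF t], rule sum.cong[OF refl])
       (use neq in \<open>simp del: fun_upd_apply comp_apply add: * ** tt sign_permutes_compose[OF assms(1) _ t] sign_swap_id\<close>)
  then show ?thesis by (simp add: pf_sum_def sum_negf)
qed

text \<open>Only the antisymmetric part of each form counts. The arrows are changed one at a time;
  at each, the difference of the two forms is symmetric, so the Pfaffian sum with this difference
  equals its own negative.\<close>

lemma pf_sum_cong_antisym:
  fixes Z :: "arrow \<Rightarrow> cell \<Rightarrow> cell \<Rightarrow> 'b::{idom,ring_char_0}"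
  assumes "finite C" and M: "matching C T"
    and eq: "\<And>a c d. a \<in> T \<Longrightarrow> c \<in> C \<Longrightarrow> d \<in> C \<Longrightarrow> Z a c d - Z a d c = Z' a c d - Z' a d c"
  shows "pf_sum C T Z = pf_sum C T Z'"
proof -
  note finT = matching_finite[OF M assms(1)]
  have "pf_sum C T (\<lambda>a. if a \<in> B then Z' a else Z a) = pf_sum C T Z" if "B \<subseteq> T" for B
    using finite_subset[OF that finT] that
  proof (induction B)
    case empty
    then show ?case by simp
  next
    case (insert b B)
    let ?Y = "\<lambda>a. if a \<in> B then Z' a else Z a"
    let ?D = "\<lambda>c d. Z b c d - Z' b c d"
    have b: "b \<in> T" using insert by auto
    have "pf_sum C T (?Y(b := ?D)) = pf_sum C T (?Y(b := \<lambda>c d. ?D d c))"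
    proof (rule pf_sum_cong[OF M])
      fix a c d assume "a \<in> T" "c \<in> C" "d \<in> C"
      then show "(?Y(b := ?D)) a c d = (?Y(b := \<lambda>c d. ?D d c)) a c d"
        using eq[OF b, of c d] by (auto simp: algebra_simps)
    qed
    also have "\<dots> = - pf_sum C T (?Y(b := ?D))"
      by (rule pf_sum_transpose_arrow[OF assms(1) M b])
    finally have "pf_sum C T (?Y(b := ?D)) = 0" by (rule eq_uminus_imp_zero)
    then have "pf_sum C T (?Y(b := Z b)) = pf_sum C T (?Y(b := Z' b))"
      using pf_sum_update_diff[OF finT b, of C ?Y "Z b" "Z' b"] by simp
    moreover have "?Y(b := Z b) = ?Y" using insert by auto
    moreover have "?Y(b := Z' b) = (\<lambda>a. if a \<in> insert b B then Z' a else Z a)" by auto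
    ultimately show ?case using insert by simp
  qed
  from this[of T] have "pf_sum C T Z = pf_sum C T (\<lambda>a. if a \<in> T then Z' a else Z a)" by simp
  also have "\<dots> = pf_sum C T Z'" by (rule pf_sum_cong[OF M]) auto
  finally show ?thesis .
qed

section \<open>Permutations preserving a labelling of the arrows\<close>

definition class_rank :: "'x set \<Rightarrow> ('x \<Rightarrow> 'l) \<Rightarrow> ('x \<Rightarrow> nat) \<Rightarrow> 'x \<Rightarrow> nat" where
  "class_rank T f w a = card {b \<in> T. f b = f a \<and> w b < w a}"

lemma class_rank_less_iff:
  assumes "finite T" "a \<in> T" "b \<in> T" "f a = f b"
  shows "class_rank T f w a < class_rank T f w b \<longleftrightarrow> w a < w b"
proof -
  have less: "class_rank T f w a < class_rank T f w b"
    if "a \<in> T" "f a = f b" "w a < w b" for a b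
    unfolding class_rank_def
  proof (rule psubset_card_mono)
    show "{c \<in> T. f c = f a \<and> w c < w a} \<subset> {c \<in> T. f c = f b \<and> w c < w b}"
      using that by auto
  qed (use assms(1) in simp)
  have "class_rank T f w a = class_rank T f w b" if "w a = w b"
    using that assms(4) by (simp add: class_rank_def)
  then show ?thesis
    using less[of a b] less[of b a] assms by (metis linorder_neqE_nat order_less_asym less_irrefl)
qed

lemma bij_betw_class_rank:
  assumes "finite T" "\<And>b c. b \<in> T \<Longrightarrow> c \<in> T \<Longrightarrow> f b = l \<Longrightarrow> f c = l \<Longrightarrow> w b = w c \<Longrightarrow> b = c"
  shows "bij_betw (class_rank T f w) {b \<in> T. f b = l} {..<card {b \<in> T. f b = l}}"
proof -
  let ?K = "{b \<in> T. f b = l}"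
  have inj: "inj_on (class_rank T f w) ?K"
  proof (rule inj_onI)
    fix b c assume bc: "b \<in> ?K" "c \<in> ?K" "class_rank T f w b = class_rank T f w c"
    then have "\<not> w b < w c" "\<not> w c < w b"
      using class_rank_less_iff[OF assms(1), of b c f w] class_rank_less_iff[OF assms(1), of c b f w]
      by auto
    then show "b = c" using bc assms(2) by simp
  qed
  have "class_rank T f w ` ?K \<subseteq> {..<card ?K}"
  proof (rule image_subsetI)
    fix b assume b: "b \<in> ?K"
    then have "{c \<in> T. f c = f b \<and> w c < w b} \<subset> ?K" by auto
    then show "class_rank T f w b \<in> {..<card ?K}"
      using assms(1) by (auto simp: class_rank_def intro!: psubset_card_mono)
  qed
  then have "class_rank T f w ` ?K = {..<card ?K}"
    by (rule card_subset_eq[rotated]) (use card_image[OF inj] in auto)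
  then show ?thesis using inj by (simp add: bij_betw_def)
qed

text \<open>Within each class of f, tau has to send the k-th element in the order of u to the k-th
  in the order of v, which determines it. It will be applied with u the row of a tail and v its row
  after a column-preserving permutation: then exactly one rearrangement of equally labelled arrows
  meets the ordering condition of bpf.\<close>

lemma ex1_sorting_permutation:
  fixes u v :: "'x \<Rightarrow> nat"
  assumes "finite T"
    and u: "\<And>a b. a \<in> T \<Longrightarrow> b \<in> T \<Longrightarrow> f a = f b \<Longrightarrow> u a = u b \<Longrightarrow> a = b"
    and v: "\<And>a b. a \<in> T \<Longrightarrow> b \<in> T \<Longrightarrow> f a = f b \<Longrightarrow> v a = v b \<Longrightarrow> a = b"
  shows "\<exists>!\<tau>. \<tau> permutes T \<and> (\<forall>a\<in>T. f (\<tau> a) = f a) \<and>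
    (\<forall>a\<in>T. \<forall>b\<in>T. f a = f b \<and> u a < u b \<longrightarrow> v (\<tau> a) < v (\<tau> b))" (is "\<exists>!\<tau>. ?Q \<tau>")
proof -
  let ?K = "\<lambda>a. {b \<in> T. f b = f a}"
  let ?ru = "class_rank T f u" and ?rv = "class_rank T f v"
  have bu: "bij_betw ?ru (?K a) {..<card (?K a)}" and bv: "bij_betw ?rv (?K a) {..<card (?K a)}" for a
    by (rule bij_betw_class_rank[OF assms(1)]; use u v in simp)+
  \<comment> \<open>For uniqueness: tau maps the predecessors of a in its class onto the
    predecessors of tau a, so it preserves ranks.\<close>
  have rank: "?rv (\<tau> a) = ?ru a" if Q: "?Q \<tau>" and a: "a \<in> T" for \<tau> a
  proof -
    have \<tau>: "\<tau> permutes T" using Q by blast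
    have "{b \<in> T. f b = f (\<tau> a) \<and> v b < v (\<tau> a)} = \<tau> ` {b \<in> T. f b = f a \<and> u b < u a}" (is "?L = ?R")
    proof
      show "?R \<subseteq> ?L" using Q a permutes_in_image[OF \<tau>] by auto
      show "?L \<subseteq> ?R"
      proof
        fix b assume b: "b \<in> ?L"
        obtain b' where b': "b' \<in> T" "b = \<tau> b'"
          using b permutes_image[OF \<tau>] by blast
        then have fb: "f b' = f a" using b a Q by auto
        have "v (\<tau> a) < v (\<tau> b')" if "u a < u b'"
          using Q a b'(1) fb that by simp
        then have "\<not> u a < u b'" using b b'(2) by fastforce
        moreover have "u a \<noteq> u b'" using u[of a b'] b b' fb a by auto
        ultimately show "b \<in> ?R" using b' fb by auto
      qed
    qed
    then show ?thesis
      using card_image[OF permutes_inj_on[OF \<tau>]] by (simp add: class_rank_def)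
  qed
  define \<tau> where "\<tau> a = (if a \<in> T then inv_into (?K a) ?rv (?ru a) else a)" for a
  have \<tau>: "\<tau> a \<in> ?K a \<and> ?rv (\<tau> a) = ?ru a" if "a \<in> T" for a
  proof -
    have "?ru a \<in> ?rv ` ?K a"
      using bij_betw_apply[OF bu, of a a] bij_betw_imp_surj_on[OF bv, of a] that by simp
    then show ?thesis
      using inv_into_into[of "?ru a" ?rv "?K a"] f_inv_into_f[of "?ru a" ?rv "?K a"] that by (simp add: \<tau>_def)
  qed
  have "\<tau> permutes T"
  proof (rule bij_imp_permutes)
    have "inj_on \<tau> T"
    proof (rule inj_onI)
      fix a b assume ab: "a \<in> T" "b \<in> T" "\<tau> a = \<tau> b"
      then have "f a = f b" "?ru a = ?ru b" using \<tau>[of a] \<tau>[of b] by auto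
      then show "a = b" using bij_betw_imp_inj_on[OF bu, of b] ab by (auto simp: inj_on_def)
    qed
    moreover have "\<tau> ` T \<subseteq> T" using \<tau> by auto
    ultimately show "bij_betw \<tau> T T"
      using endo_inj_surj[OF assms(1)] by (simp add: bij_betw_def)
  qed (simp add: \<tau>_def)
  moreover have "v (\<tau> a) < v (\<tau> b)" if "a \<in> T" "b \<in> T" "f a = f b" "u a < u b" for a b
  proof -
    have "?rv (\<tau> a) < ?rv (\<tau> b)"
      using class_rank_less_iff[OF assms(1) that(1,2,3), of u] \<tau>[of a] \<tau>[of b] that by simp
    then show ?thesis
      using class_rank_less_iff[OF assms(1), of "\<tau> a" "\<tau> b" f v] \<tau>[of a] \<tau>[of b] that by simp
  qed
  ultimately have "?Q \<tau>" using \<tau> by auto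
  moreover have "\<sigma> = \<tau>" if Q: "?Q \<sigma>" for \<sigma>
  proof
    fix a
    show "\<sigma> a = \<tau> a"
    proof (cases "a \<in> T")
      case True
      have "\<sigma> a \<in> ?K a" using Q True by (auto simp: permutes_in_image)
      moreover have "?rv (\<sigma> a) = ?rv (\<tau> a)" using rank[OF Q True] \<tau>[OF True] by simp
      ultimately show ?thesis
        using bij_betw_imp_inj_on[OF bv, of a] \<tau>[OF True] by (auto simp: inj_on_def)
    next
      case False
      moreover have "\<sigma> permutes T" using Q by blast
      ultimately show ?thesis using permutes_not_in[of \<sigma> T a] by (simp add: \<tau>_def)
    qed
  qed
  ultimately show ?thesis by (rule ex1I[of ?Q])
qed

definition stab :: "'x set \<Rightarrow> ('x \<Rightarrow> 'l) \<Rightarrow> ('x \<Rightarrow> 'x) set" where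
  "stab T f = {\<tau>. \<tau> permutes T \<and> (\<forall>a\<in>T. f (\<tau> a) = f a)}"

lemma finite_stab: "finite T \<Longrightarrow> finite (stab T f)"
  unfolding stab_def by (rule finite_subset[OF _ finite_permutations]) auto

text \<open>For f with values in L this is its orbit under the permutations of T. Equality of
  multisets is the form in which a prescribed multidegree arises.\<close>

definition orbit_of :: "'x set \<Rightarrow> 'l set \<Rightarrow> ('x \<Rightarrow> 'l) \<Rightarrow> ('x \<Rightarrow> 'l) set" where
  "orbit_of T L f = {g \<in> T \<rightarrow>\<^sub>E L. image_mset g (mset_set T) = image_mset f (mset_set T)}"

lemma image_mset_permutes:
  assumes "\<tau> permutes T"
  shows "image_mset (\<lambda>a. f (\<tau> a)) (mset_set T) = image_mset f (mset_set T)"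
proof -
  have "image_mset \<tau> (mset_set T) = mset_set T"
    using image_mset_mset_set[OF permutes_inj_on[OF assms, of T]] permutes_image[OF assms] by simp
  then show ?thesis
    using image_mset.compositionality[of f \<tau> "mset_set T"] by (simp add: comp_def)
qed

lemma orbit_of_permutes:
  assumes "finite T" "g \<in> orbit_of T L f"
  obtains \<tau> where "\<tau> permutes T" "\<And>a. a \<in> T \<Longrightarrow> g a = f (\<tau> a)"
proof -
  have "image_mset g (mset_set T) = image_mset f (mset_set T)"
    using assms(2) by (simp add: orbit_of_def)
  then obtain \<tau> where "\<tau> permutes T" "\<forall>a\<in>T. g a = f (\<tau> a)"
    by (rule image_mset_eq_implies_permutes[OF assms(1)])
  then show thesis by (intro that[of \<tau>]) simp_all
qed

text \<open>The orbit-stabilizer theorem for permutations of T acting on labellings: the tau for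
  which f o tau is a given labelling form a coset of the stabilizer.\<close>

lemma card_orbit_stab:
  assumes "finite T" "finite L" "f \<in> T \<rightarrow>\<^sub>E L"
  shows "card (orbit_of T L f) * card (stab T f) = fact (card T)"
proof -
  let ?P = "{\<tau>. \<tau> permutes T}"
  let ?r = "\<lambda>\<tau>. restrict (\<lambda>a. f (\<tau> a)) T"
  have finO: "finite (orbit_of T L f)"
    unfolding orbit_of_def using assms by (intro finite_subset[OF _ finite_PiE[of T "\<lambda>_. L"]]) auto
  have into: "?r ` ?P \<subseteq> orbit_of T L f"
  proof (rule image_subsetI)
    fix \<tau> assume "\<tau> \<in> ?P"
    then have \<tau>: "\<tau> permutes T" by simp
    have "image_mset (?r \<tau>) (mset_set T) = image_mset (\<lambda>a. f (\<tau> a)) (mset_set T)"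
      using assms(1) by (intro image_mset_cong) auto
    then show "?r \<tau> \<in> orbit_of T L f"
      using image_mset_permutes[OF \<tau>, of f] assms(3) permutes_in_image[OF \<tau>]
      by (auto simp: orbit_of_def)
  qed
  have fiber: "card {\<tau> \<in> ?P. ?r \<tau> = g} = card (stab T f)" if g: "g \<in> orbit_of T L f" for g
  proof -
    obtain \<tau>0 where \<tau>0: "\<tau>0 permutes T" "\<And>a. a \<in> T \<Longrightarrow> g a = f (\<tau>0 a)"
      using orbit_of_permutes[OF assms(1) g] by blast
    have gr: "?r \<tau> = g \<longleftrightarrow> (\<forall>a\<in>T. f (\<tau> a) = f (\<tau>0 a))" for \<tau>
    proof -
      have "g \<in> extensional T" using g by (auto simp: orbit_of_def PiE_def)
      then show ?thesis using \<tau>0(2)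
        by (auto simp: fun_eq_iff restrict_def extensional_def)
    qed
    have inv: "inv_into UNIV \<tau>0 permutes T" by (rule permutes_inv[OF \<tau>0(1)])
    have "bij_betw (\<lambda>\<sigma>. \<sigma> \<circ> \<tau>0) (stab T f) {\<tau> \<in> ?P. ?r \<tau> = g}"
    proof (rule bij_betwI[where g = "\<lambda>\<tau>. \<tau> \<circ> inv_into UNIV \<tau>0"])
      show "(\<lambda>\<sigma>. \<sigma> \<circ> \<tau>0) \<in> stab T f \<rightarrow> {\<tau> \<in> ?P. ?r \<tau> = g}"
        unfolding gr using \<tau>0(1) permutes_in_image[OF \<tau>0(1)]
        by (auto simp: stab_def intro: permutes_compose)
      show "(\<lambda>\<tau>. \<tau> \<circ> inv_into UNIV \<tau>0) \<in> {\<tau> \<in> ?P. ?r \<tau> = g} \<rightarrow> stab T f"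
        unfolding gr using inv permutes_in_image[OF inv] permutes_inverses(1)[OF \<tau>0(1)]
        by (auto simp: stab_def intro: permutes_compose)
    qed (auto simp: comp_assoc permutes_inv_o[OF \<tau>0(1)])
    then show ?thesis by (rule bij_betw_same_card[symmetric])
  qed
  have "fact (card T) = card ?P" using card_permutations[OF refl assms(1)] by simp
  also have "\<dots> = (\<Sum>g\<in>orbit_of T L f. card {\<tau> \<in> ?P. ?r \<tau> = g})"
    using sum.group[OF finite_permutations[OF assms(1)] finO into, of "\<lambda>_. 1::nat"] by simp
  also have "\<dots> = card (orbit_of T L f) * card (stab T f)" using fiber by simp
  finally show ?thesis by simp
qed

text \<open>Conjugation by kappa maps one stabilizer onto the other.\<close>

lemma card_stab_bij:
  assumes \<kappa>: "bij_betw \<kappa> T T'" and f: "\<And>a. a \<in> T \<Longrightarrow> f' (\<kappa> a) = f a"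
  shows "card (stab T f) = card (stab T' f')"
proof -
  have \<kappa>': "bij_betw (inv_into T \<kappa>) T' T" using \<kappa> by (rule bij_betw_inv_into)
  have inj: "inj_on \<kappa> T" and inj': "inj_on (inv_into T \<kappa>) T'" and im: "\<kappa> ` T = T'"
    using \<kappa> \<kappa>' by (auto simp: bij_betw_def)
  have "bij_betw (map_permutation T \<kappa>) (stab T f) (stab T' f')"
  proof (rule bij_betwI[where g = "map_permutation T' (inv_into T \<kappa>)"])
    show "map_permutation T \<kappa> \<in> stab T f \<rightarrow> stab T' f'"
    proof
      fix \<tau> assume "\<tau> \<in> stab T f"
      then have \<tau>: "\<tau> permutes T" "\<And>a. a \<in> T \<Longrightarrow> f (\<tau> a) = f a" by (auto simp: stab_def)
      have "f' (map_permutation T \<kappa> \<tau> b) = f' b" if "b \<in> T'" for b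
      proof -
        obtain a where a: "a \<in> T" "b = \<kappa> a" using \<open>b \<in> T'\<close> im by auto
        then show ?thesis
          using \<tau> f map_permutation_apply[OF inj a(1)] permutes_in_image[OF \<tau>(1)] by simp
      qed
      then show "map_permutation T \<kappa> \<tau> \<in> stab T' f'"
        using map_permutation_permutes[OF \<kappa> \<tau>(1)] by (auto simp: stab_def)
    qed
    show "map_permutation T' (inv_into T \<kappa>) \<in> stab T' f' \<rightarrow> stab T f"
    proof
      fix \<tau> assume "\<tau> \<in> stab T' f'"
      then have \<tau>: "\<tau> permutes T'" "\<And>a. a \<in> T' \<Longrightarrow> f' (\<tau> a) = f' a" by (auto simp: stab_def)
      have ff: "f (inv_into T \<kappa> b) = f' b" if "b \<in> T'" for b
        using f[of "inv_into T \<kappa> b"] that im by (simp add: f_inv_into_f inv_into_into)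
      have "f (map_permutation T' (inv_into T \<kappa>) \<tau> a) = f a" if a: "a \<in> T" for a
      proof -
        have \<kappa>a: "\<kappa> a \<in> T'" "a = inv_into T \<kappa> (\<kappa> a)" using a im inj by auto
        then show ?thesis
          using map_permutation_apply[OF inj' \<kappa>a(1), of \<tau>] \<tau>(2)[OF \<kappa>a(1)] ff[of "\<tau> (\<kappa> a)"] ff[of "\<kappa> a"]
            permutes_in_image[OF \<tau>(1)] by metis
      qed
      then show "map_permutation T' (inv_into T \<kappa>) \<tau> \<in> stab T f"
        using map_permutation_permutes[OF \<kappa>' \<tau>(1)] by (auto simp: stab_def)
    qed
    show "map_permutation T' (inv_into T \<kappa>) (map_permutation T \<kappa> \<tau>) = \<tau>" if "\<tau> \<in> stab T f" for \<tau>
      using that by (intro map_permutation_compose_inv[OF \<kappa>]) (auto simp: stab_def inj)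
    show "map_permutation T \<kappa> (map_permutation T' (inv_into T \<kappa>) \<tau>) = \<tau>" if "\<tau> \<in> stab T' f'" for \<tau>
      using that by (intro map_permutation_compose_inv[OF \<kappa>']) (auto simp: stab_def f_inv_into_f im)
  qed
  then show ?thesis by (rule bij_betw_same_card)
qed

section \<open>Block partial linearizations as Pfaffian sums\<close>

definition blk :: "nat \<Rightarrow> nat \<Rightarrow> 'a::zero mat \<Rightarrow> cell \<Rightarrow> cell \<Rightarrow> 'a" where
  "blk i j Y c d = (if fst c = i \<and> fst d = j then Y $$ (snd c, snd d) else 0)"

text \<open>Labels will be positions in a list of letters, of which a labelling uses only some,
  whereas a tableau with substitution has to use every index of its list. Hence a variant of
  \<open>bpf\<close> for arbitrary families.\<close>

definition bpf_fam :: "nat list \<Rightarrow> arrow set \<Rightarrow> (arrow \<Rightarrow> nat) \<Rightarrow> (nat \<Rightarrow> 'a mat) \<Rightarrow> 'a::comm_ring_1" where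
  "bpf_fam n T \<phi> M =
     (\<Sum>\<pi>\<in>admissible_perms n T \<phi>.
        (\<Prod>i<length n. of_int (sign (\<pi> i))) *
        (\<Prod>a\<in>T. M (\<phi> a) $$ (\<pi> (tail_col a) (tail_row a), \<pi> (head_col a) (head_row a))))"

text \<open>The cut-off k serves to compute the sign one column at a time, by induction.\<close>

definition col_perm :: "nat \<Rightarrow> (nat \<Rightarrow> nat \<Rightarrow> nat) \<Rightarrow> cell \<Rightarrow> cell" where
  "col_perm k \<pi> c = (if fst c < k then (fst c, \<pi> (fst c) (snd c)) else c)"

lemma col_perm_Suc:
  assumes "\<pi> k permutes {..<n ! k}"
  shows "col_perm (Suc k) \<pi> = col_perm k \<pi> \<circ> map_permutation {..<n ! k} (Pair k) (\<pi> k)"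
proof
  fix c :: cell
  obtain i r where c: "c = (i, r)" by (cases c)
  let ?m = "map_permutation {..<n ! k} (Pair k) (\<pi> k)"
  have p: "?m permutes Pair k ` {..<n ! k}"
    using assms by (intro map_permutation_permutes) (auto simp: bij_betw_def inj_on_def)
  show "col_perm (Suc k) \<pi> c = (col_perm k \<pi> \<circ> ?m) c"
  proof (cases "i = k \<and> r < n ! k")
    case True
    then have "?m (k, r) = (k, \<pi> k r)"
      by (intro map_permutation_apply) (auto simp: inj_on_def)
    then show ?thesis using True by (simp add: c col_perm_def)
  next
    case False
    then have "?m c = c" using p by (intro permutes_not_in) (auto simp: c)
    moreover have "\<pi> k r = r" if "i = k"
      using that False assms by (intro permutes_not_in) auto
    ultimately show ?thesis by (auto simp: c col_perm_def less_Suc_eq)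
  qed
qed

lemma col_perm_sign:
  assumes "\<And>i. i < length n \<Longrightarrow> \<pi> i permutes {..<n ! i}" "k \<le> length n"
  shows "col_perm k \<pi> permutes cells n \<and> sign (col_perm k \<pi>) = (\<Prod>i<k. sign (\<pi> i))"
  using assms(2)
proof (induction k)
  case 0
  have id: "col_perm 0 \<pi> = id" by (auto simp: col_perm_def)
  show ?case unfolding id by (intro conjI permutes_id) simp
next
  case (Suc k)
  let ?m = "map_permutation {..<n ! k} (Pair k) (\<pi> k)"
  have \<pi>: "\<pi> k permutes {..<n ! k}" using Suc assms by simp
  have "?m permutes Pair k ` {..<n ! k}"
    using \<pi> by (intro map_permutation_permutes) (auto simp: bij_betw_def inj_on_def)
  then have m: "?m permutes cells n"
    by (rule permutes_subset) (use Suc in \<open>auto simp: cells_def\<close>)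
  have s: "sign ?m = sign (\<pi> k)"
    using \<pi> by (intro sign_map_permutation) (auto simp: inj_on_def)
  have IH: "col_perm k \<pi> permutes cells n" "sign (col_perm k \<pi>) = (\<Prod>i<k. sign (\<pi> i))"
    using Suc by auto
  show ?case
    unfolding col_perm_Suc[where \<pi> = \<pi> and n = n, OF \<pi>] sign_permutes_compose[OF finite_cells IH(1) m]
    by (intro conjI permutes_compose m IH(1)) (simp add: IH(2) s)
qed

lemma fst_cell_mem: "c \<in> cells n \<Longrightarrow> fst c < length n"
  and snd_cell_mem: "c \<in> cells n \<Longrightarrow> snd c < n ! fst c"
  by (auto simp: cells_def)

text \<open>A block vanishes outside its pair of columns, so a permutation that moves some cell to
  another column contributes zero.\<close>

lemma pf_sum_eq_col_sum:
  assumes "tableau n T" and col: "\<And>a. a \<in> T \<Longrightarrow> src a = tail_col a \<and> tgt a = head_col a"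
  shows "pf_sum (cells n) T (\<lambda>a. blk (src a) (tgt a) (M (\<phi> a))) =
    (\<Sum>p | p permutes cells n \<and> (\<forall>c\<in>cells n. fst (p c) = fst c).
      of_int (sign p) * (\<Prod>a\<in>T. M (\<phi> a) $$ (snd (p (tail_cell a)), snd (p (head_cell a)))))"
proof -
  have M: "matching (cells n) T" using assms(1) by (simp add: tableau_iff_matching)
  note finT = matching_finite[OF M finite_cells]
  let ?B = "\<lambda>p a. blk (src a) (tgt a) (M (\<phi> a)) (p (tail_cell a)) (p (head_cell a))"
  have "pf_sum (cells n) T (\<lambda>a. blk (src a) (tgt a) (M (\<phi> a))) =
    (\<Sum>p | p permutes cells n \<and> (\<forall>c\<in>cells n. fst (p c) = fst c). of_int (sign p) * (\<Prod>a\<in>T. ?B p a))"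
    unfolding pf_sum_def
  proof (rule sum.mono_neutral_right)
    show "\<forall>p\<in>{p. p permutes cells n} - {p. p permutes cells n \<and> (\<forall>c\<in>cells n. fst (p c) = fst c)}.
       of_int (sign p) * (\<Prod>a\<in>T. ?B p a) = 0"
    proof
      fix p assume "p \<in> {p. p permutes cells n} - {p. p permutes cells n \<and> (\<forall>c\<in>cells n. fst (p c) = fst c)}"
      then obtain c where c: "c \<in> cells n" "fst (p c) \<noteq> fst c" by auto
      then obtain a where a: "a \<in> T" "c = tail_cell a \<or> c = head_cell a"
        using matching_cover[OF M] by blast
      then have "?B p a = 0" using c col[OF a(1)] by (auto simp: blk_def)
      then show "of_int (sign p) * (\<Prod>a\<in>T. ?B p a) = 0"
        using prod_zero[OF finT] a(1) by fastforce
    qed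
  qed (auto simp: finite_permutations)
  also have "\<dots> = (\<Sum>p | p permutes cells n \<and> (\<forall>c\<in>cells n. fst (p c) = fst c).
      of_int (sign p) * (\<Prod>a\<in>T. M (\<phi> a) $$ (snd (p (tail_cell a)), snd (p (head_cell a)))))"
    using col matching_cell[OF M]
    by (intro sum.cong refl arg_cong2[where f = "(*)"] prod.cong) (auto simp: blk_def)
  finally show ?thesis .
qed

text \<open>A permutation of the cells that preserves columns is the same as one permutation for
  each column, and its sign is the product of their signs.\<close>

lemma bpf_fam_eq_col_sum:
  assumes "tableau n T" and col: "\<And>a b. a \<in> T \<Longrightarrow> b \<in> T \<Longrightarrow> \<phi> a = \<phi> b \<Longrightarrow> tail_col a = tail_col b"
  shows "bpf_fam n T \<phi> M =
    (\<Sum>p | p permutes cells n \<and> (\<forall>c\<in>cells n. fst (p c) = fst c) \<and>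
        (\<forall>a\<in>T. \<forall>b\<in>T. \<phi> a = \<phi> b \<and> tail_row a < tail_row b \<longrightarrow> snd (p (tail_cell a)) < snd (p (tail_cell b))).
      of_int (sign p) * (\<Prod>a\<in>T. M (\<phi> a) $$ (snd (p (tail_cell a)), snd (p (head_cell a)))))"
  unfolding bpf_fam_def
proof (rule sum.reindex_bij_witness[where j = "col_perm (length n)" and
      i = "\<lambda>p. restrict (\<lambda>i r. snd (p (i, r))) {..<length n}"])
  have M: "matching (cells n) T" using assms(1) by (simp add: tableau_iff_matching)
  let ?l = "length n"
  {
    fix \<pi> assume \<pi>: "\<pi> \<in> admissible_perms n T \<phi>"
    then have ext: "\<pi> \<in> extensional {..<?l}" and perm: "\<And>i. i < ?l \<Longrightarrow> \<pi> i permutes {..<n ! i}"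
      by (auto simp: admissible_perms_def PiE_def)
    note cs = col_perm_sign[OF perm order.refl]
    have sn: "snd (col_perm ?l \<pi> c) = \<pi> (fst c) (snd c)" if "c \<in> cells n" for c
      using fst_cell_mem[OF that] by (simp add: col_perm_def)
    show "restrict (\<lambda>i r. snd (col_perm ?l \<pi> (i, r))) {..<?l} = \<pi>"
      using ext by (auto simp: col_perm_def fun_eq_iff extensional_def)
    have "snd (col_perm ?l \<pi> (tail_cell a)) < snd (col_perm ?l \<pi> (tail_cell b))"
      if ab: "a \<in> T" "b \<in> T" "\<phi> a = \<phi> b" "tail_row a < tail_row b" for a b
    proof -
      have "\<pi> (tail_col a) (tail_row a) < \<pi> (tail_col a) (tail_row b)"
        using \<pi> ab by (auto simp: admissible_perms_def)
      then show ?thesis using sn matching_cell[OF M] ab col[OF ab(1-3)] by simp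
    qed
    then show "col_perm ?l \<pi> \<in> {p. p permutes cells n \<and> (\<forall>c\<in>cells n. fst (p c) = fst c) \<and>
        (\<forall>a\<in>T. \<forall>b\<in>T. \<phi> a = \<phi> b \<and> tail_row a < tail_row b \<longrightarrow> snd (p (tail_cell a)) < snd (p (tail_cell b)))}"
      using cs by (auto simp: col_perm_def)
    have "(\<Prod>a\<in>T. M (\<phi> a) $$ (snd (col_perm ?l \<pi> (tail_cell a)), snd (col_perm ?l \<pi> (head_cell a)))) =
      (\<Prod>a\<in>T. M (\<phi> a) $$ (\<pi> (tail_col a) (tail_row a), \<pi> (head_col a) (head_row a)))"
      using sn matching_cell[OF M] by (intro prod.cong refl) simp
    then show "of_int (sign (col_perm ?l \<pi>)) *
        (\<Prod>a\<in>T. M (\<phi> a) $$ (snd (col_perm ?l \<pi> (tail_cell a)), snd (col_perm ?l \<pi> (head_cell a)))) =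
      (\<Prod>i<?l. of_int (sign (\<pi> i))) *
        (\<Prod>a\<in>T. M (\<phi> a) $$ (\<pi> (tail_col a) (tail_row a), \<pi> (head_col a) (head_row a)))"
      using cs by simp
  next
    fix p assume "p \<in> {p. p permutes cells n \<and> (\<forall>c\<in>cells n. fst (p c) = fst c) \<and>
        (\<forall>a\<in>T. \<forall>b\<in>T. \<phi> a = \<phi> b \<and> tail_row a < tail_row b \<longrightarrow> snd (p (tail_cell a)) < snd (p (tail_cell b)))}"
    then have p: "p permutes cells n" and fstp: "\<And>c. c \<in> cells n \<Longrightarrow> fst (p c) = fst c"
      and ord: "\<And>a b. a \<in> T \<Longrightarrow> b \<in> T \<Longrightarrow> \<phi> a = \<phi> b \<Longrightarrow> tail_row a < tail_row b \<Longrightarrow> snd (p (tail_cell a)) < snd (p (tail_cell b))"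
      by auto
    let ?\<pi> = "restrict (\<lambda>i r. snd (p (i, r))) {..<?l}"
    have pp: "p (i, r) = (i, snd (p (i, r)))" for i r
    proof (cases "(i, r) \<in> cells n")
      case True
      then show ?thesis using fstp[OF True] by (metis fst_conv prod.collapse)
    next
      case False
      then show ?thesis using permutes_not_in[OF p False] by simp
    qed
    show "col_perm ?l ?\<pi> = p"
    proof
      fix c :: cell
      show "col_perm ?l ?\<pi> c = p c"
      proof (cases "fst c < ?l")
        case True
        then show ?thesis using pp[of "fst c" "snd c"] by (simp add: col_perm_def)
      next
        case False
        then have "c \<notin> cells n" using fst_cell_mem by blast
        then show ?thesis using permutes_not_in[OF p] False by (simp add: col_perm_def)
      qed
    qed
    have "?\<pi> i permutes {..<n ! i}" if i: "i < ?l" for i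
    proof (rule bij_imp_permutes)
      let ?f = "\<lambda>r. snd (p (i, r))"
      have "inj_on ?f {..<n ! i}"
      proof (rule inj_onI)
        fix r r' assume "?f r = ?f r'"
        then have "p (i, r) = p (i, r')" using pp[of i r] pp[of i r'] by simp
        then show "r = r'" using permutes_inj[OF p] by (auto dest: injD)
      qed
      moreover have "?f ` {..<n ! i} \<subseteq> {..<n ! i}"
      proof (rule image_subsetI)
        fix r assume "r \<in> {..<n ! i}"
        then have "p (i, r) \<in> cells n" using i permutes_in_image[OF p] by (simp add: cells_def)
        then show "?f r \<in> {..<n ! i}" using snd_cell_mem pp[of i r] by (metis fst_conv lessThan_iff)
      qed
      ultimately have "bij_betw ?f {..<n ! i} {..<n ! i}"
        using endo_inj_surj[of "{..<n ! i}" ?f] by (simp add: bij_betw_def)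
      then show "bij_betw (?\<pi> i) {..<n ! i} {..<n ! i}" using i by (simp add: restrict_def)
      fix r assume "r \<notin> {..<n ! i}"
      then have "(i, r) \<notin> cells n" by (auto simp: cells_def)
      then show "?\<pi> i r = r" using i permutes_not_in[OF p] by simp
    qed
    moreover have "?\<pi> (tail_col a) (tail_row a) < ?\<pi> (tail_col a) (tail_row b)"
      if ab: "a \<in> T" "b \<in> T" "\<phi> a = \<phi> b" "tail_row a < tail_row b" for a b
    proof -
      have "(tail_col a, tail_row b) = tail_cell b" using col[OF ab(1-3)] by simp
      then show ?thesis using ord[OF ab] fst_cell_mem[OF matching_cell(1)[OF M ab(1)]] by simp
    qed
    ultimately show "?\<pi> \<in> admissible_perms n T \<phi>"
      by (auto simp: admissible_perms_def)
  }
qed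

text \<open>Each column-preserving permutation p meets the ordering condition after rearrangement by
  exactly one tau in the stabilizer. Sorting the terms by tau gives |stab| sums. Reindexing p by the
  lift of tau, which has sign 1 and preserves columns, shows that each of them equals the admissible
  sum.\<close>

lemma pf_sum_blocks:
  assumes T: "tableau n T"
    and col: "\<And>a b. a \<in> T \<Longrightarrow> b \<in> T \<Longrightarrow> \<phi> a = \<phi> b \<Longrightarrow> tail_col a = tail_col b \<and> head_col a = head_col b"
    and sc: "\<And>a. a \<in> T \<Longrightarrow> src a = tail_col a \<and> tgt a = head_col a"
  shows "pf_sum (cells n) T (\<lambda>a. blk (src a) (tgt a) (M (\<phi> a))) = of_nat (card (stab T \<phi>)) * bpf_fam n T \<phi> M"
proof -
  have M: "matching (cells n) T" using assms(1) by (simp add: tableau_iff_matching)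
  note finT = matching_finite[OF M finite_cells]
  define P0 where "P0 = {p. p permutes cells n \<and> (\<forall>c\<in>cells n. fst (p c) = fst c)}"
  define g where "g p = of_int (sign p) * (\<Prod>a\<in>T. M (\<phi> a) $$ (snd (p (tail_cell a)), snd (p (head_cell a))))"
    for p :: "cell \<Rightarrow> cell"
  define inc where "inc p \<tau> \<longleftrightarrow> (\<forall>a\<in>T. \<forall>b\<in>T. \<phi> a = \<phi> b \<and> tail_row a < tail_row b \<longrightarrow>
      snd (p (tail_cell (\<tau> a))) < snd (p (tail_cell (\<tau> b))))" for p :: "cell \<Rightarrow> cell" and \<tau>
  have finP0: "finite P0"
    unfolding P0_def by (rule finite_subset[OF _ finite_permutations[OF finite_cells]]) auto
  have one: "card {\<tau> \<in> stab T \<phi>. inc p \<tau>} = 1" if p: "p \<in> P0" for p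
  proof -
    have "\<exists>!\<tau>. \<tau> permutes T \<and> (\<forall>a\<in>T. \<phi> (\<tau> a) = \<phi> a) \<and>
      (\<forall>a\<in>T. \<forall>b\<in>T. \<phi> a = \<phi> b \<and> tail_row a < tail_row b \<longrightarrow>
        snd (p (tail_cell (\<tau> a))) < snd (p (tail_cell (\<tau> b))))"
    proof (rule ex1_sorting_permutation[OF finT])
      fix a b assume ab: "a \<in> T" "b \<in> T" "\<phi> a = \<phi> b"
      have c: "tail_col a = tail_col b" using col[OF ab] by simp
      show "a = b" if "tail_row a = tail_row b"
        using that c ab inj_on_tail_cell[OF M] by (auto simp: inj_on_def prod_eq_iff)
      show "a = b" if s: "snd (p (tail_cell a)) = snd (p (tail_cell b))"
      proof -
        have "fst (p (tail_cell a)) = fst (p (tail_cell b))"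
          using p c matching_cell(1)[OF M] ab by (auto simp: P0_def)
        then have "p (tail_cell a) = p (tail_cell b)" using s by (simp add: prod_eq_iff)
        then have "tail_cell a = tail_cell b" using p permutes_inj by (auto simp: P0_def dest: injD)
        then show ?thesis using ab inj_on_tail_cell[OF M] by (auto simp: inj_on_def)
      qed
    qed
    then have "\<exists>!\<tau>. \<tau> \<in> {\<tau> \<in> stab T \<phi>. inc p \<tau>}" by (simp add: stab_def inc_def conj_assoc)
    then obtain \<tau> where "{\<tau> \<in> stab T \<phi>. inc p \<tau>} = {\<tau>}" by blast
    then show ?thesis by simp
  qed
  have shift: "(\<Sum>p\<in>P0. if inc p \<tau> then g p else 0) = (\<Sum>p\<in>P0. if inc p id then g p else 0)"
    if \<tau>: "\<tau> \<in> stab T \<phi>" for \<tau>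
  proof -
    have \<tau>p: "\<tau> permutes T" and \<tau>\<phi>: "\<And>a. a \<in> T \<Longrightarrow> \<phi> (\<tau> a) = \<phi> a" using \<tau> by (auto simp: stab_def)
    obtain q where q: "q permutes cells n" "sign q = 1"
      "\<And>a. a \<in> T \<Longrightarrow> q (tail_cell a) = tail_cell (\<tau> a)"
      "\<And>a. a \<in> T \<Longrightarrow> q (head_cell a) = head_cell (\<tau> a)"
      using arrow_permutation_lift[OF M finite_cells \<tau>p] by blast
    \<comment> \<open>The lift stays within columns because arrows with equal labels have the same
      tail column and the same head column.\<close>
    have fq: "fst (q c) = fst c" if c: "c \<in> cells n" for c
    proof -
      obtain a where a: "a \<in> T" "c = tail_cell a \<or> c = head_cell a"
        using matching_cover[OF M] c by blast
      have "\<tau> a \<in> T" using a(1) permutes_in_image[OF \<tau>p] by simp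
      then show ?thesis using a q col[OF _ a(1) \<tau>\<phi>[OF a(1)]] by auto
    qed
    have q': "inv_into UNIV q permutes cells n" by (rule permutes_inv[OF q(1)])
    have fq': "fst (inv_into UNIV q c) = fst c" if c: "c \<in> cells n" for c
      using fq[of "inv_into UNIV q c"] c permutes_in_image[OF q'] permutes_inverses(1)[OF q(1)] by simp
    have gq: "g (p \<circ> q) = g p" if p: "p \<in> P0" for p
    proof -
      let ?h = "\<lambda>a. M (\<phi> a) $$ (snd (p (tail_cell a)), snd (p (head_cell a)))"
      have "(\<Prod>a\<in>T. M (\<phi> a) $$ (snd ((p \<circ> q) (tail_cell a)), snd ((p \<circ> q) (head_cell a)))) = (\<Prod>a\<in>T. ?h (\<tau> a))"
        using q \<tau>\<phi> by (intro prod.cong refl) simp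
      also have "\<dots> = (\<Prod>a\<in>T. ?h a)"
        using prod.permute[OF \<tau>p, of ?h] by (simp add: comp_def)
      finally show ?thesis
        using p sign_permutes_compose[OF finite_cells _ q(1), of p] q(2) by (simp add: g_def P0_def)
    qed
    show ?thesis
    proof (rule sum.reindex_bij_witness[of _ "\<lambda>p. p \<circ> inv_into UNIV q" "\<lambda>p. p \<circ> q"])
      fix p assume p: "p \<in> P0"
      show "p \<circ> q \<circ> inv_into UNIV q = p" by (simp add: comp_assoc permutes_inv_o[OF q(1)])
      show "p \<circ> inv_into UNIV q \<circ> q = p" by (simp add: comp_assoc permutes_inv_o[OF q(1)])
      show "p \<circ> q \<in> P0"
        using p fq q(1) permutes_in_image[OF q(1)] by (auto simp: P0_def intro: permutes_compose)
      show "p \<circ> inv_into UNIV q \<in> P0"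
        using p fq' q' permutes_in_image[OF q'] by (auto simp: P0_def intro: permutes_compose)
      have "inc (p \<circ> q) id \<longleftrightarrow> inc p \<tau>" using q(3) by (auto simp: inc_def)
      then show "(if inc (p \<circ> q) id then g (p \<circ> q) else 0) = (if inc p \<tau> then g p else 0)"
        using gq[OF p] by simp
    qed
  qed
  have "pf_sum (cells n) T (\<lambda>a. blk (src a) (tgt a) (M (\<phi> a))) = (\<Sum>p\<in>P0. g p)"
    using pf_sum_eq_col_sum[OF T sc, of M \<phi>] by (simp add: P0_def g_def)
  also have "\<dots> = (\<Sum>p\<in>P0. \<Sum>\<tau>\<in>stab T \<phi>. if inc p \<tau> then g p else 0)"
  proof (rule sum.cong[OF refl])
    fix p assume p: "p \<in> P0"
    have "(\<Sum>\<tau>\<in>stab T \<phi>. if inc p \<tau> then g p else 0) = (\<Sum>\<tau>\<in>{\<tau> \<in> stab T \<phi>. inc p \<tau>}. g p)"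
      by (rule sum.inter_filter[symmetric]) (rule finite_stab[OF finT])
    also have "\<dots> = g p" using one[OF p] by simp
    finally show "g p = (\<Sum>\<tau>\<in>stab T \<phi>. if inc p \<tau> then g p else 0)" by simp
  qed
  also have "\<dots> = (\<Sum>\<tau>\<in>stab T \<phi>. \<Sum>p\<in>P0. if inc p id then g p else 0)"
    by (subst sum.swap) (simp add: shift)
  also have "\<dots> = of_nat (card (stab T \<phi>)) * (\<Sum>p\<in>P0. if inc p id then g p else 0)" by simp
  also have "(\<Sum>p\<in>P0. if inc p id then g p else 0) = bpf_fam n T \<phi> M"
  proof -
    have "(\<Sum>p\<in>P0. if inc p id then g p else 0) = (\<Sum>p\<in>{p \<in> P0. inc p id}. g p)"
      by (rule sum.inter_filter[OF finP0, symmetric])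
    also have "{p \<in> P0. inc p id} = {p. p permutes cells n \<and> (\<forall>c\<in>cells n. fst (p c) = fst c) \<and>
        (\<forall>a\<in>T. \<forall>b\<in>T. \<phi> a = \<phi> b \<and> tail_row a < tail_row b \<longrightarrow> snd (p (tail_cell a)) < snd (p (tail_cell b)))}"
      by (simp add: P0_def inc_def conj_assoc)
    also have "(\<Sum>p\<in>\<dots>. g p) = bpf_fam n T \<phi> M"
      unfolding g_def by (rule bpf_fam_eq_col_sum[OF T, symmetric], rule col[THEN conjunct1])
    finally show ?thesis .
  qed
  finally show ?thesis .
qed

section \<open>Moving arrows, and sums over an orbit of labellings\<close>

lemma pf_sum_permute_arrows:
  assumes "finite C" and M: "matching C T" and \<tau>: "\<tau> permutes T"
  shows "pf_sum C T (\<lambda>a. Z (\<tau> a)) = pf_sum C T Z"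
proof -
  obtain q where q: "q permutes C" "sign q = 1"
      "\<And>a. a \<in> T \<Longrightarrow> q (tail_cell a) = tail_cell (\<tau> a)"
      "\<And>a. a \<in> T \<Longrightarrow> q (head_cell a) = head_cell (\<tau> a)"
    using arrow_permutation_lift[OF M assms(1) \<tau>] by blast
  show ?thesis
    unfolding pf_sum_def
  proof (subst sum_permutes_compose_right[OF q(1)], rule sum.cong[OF refl])
    fix p assume "p \<in> {p. p permutes C}"
    then have p: "p permutes C" by simp
    let ?h = "\<lambda>a. Z a (p (tail_cell a)) (p (head_cell a))"
    have "(\<Prod>a\<in>T. Z (\<tau> a) ((p \<circ> q) (tail_cell a)) ((p \<circ> q) (head_cell a))) = (\<Prod>a\<in>T. ?h (\<tau> a))"
      using q by (intro prod.cong refl) simp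
    also have "\<dots> = (\<Prod>a\<in>T. ?h a)"
      using prod.permute[OF \<tau>, of ?h] by (simp add: comp_def)
    finally show "of_int (sign (p \<circ> q)) * (\<Prod>a\<in>T. Z (\<tau> a) ((p \<circ> q) (tail_cell a)) ((p \<circ> q) (head_cell a))) =
      of_int (sign p) * (\<Prod>a\<in>T. ?h a)"
      by (simp only: sign_permutes_compose[OF assms(1) p q(1)] q(2) mult_1_right)
  qed
qed

definition move_arrow :: "(cell \<Rightarrow> cell) \<Rightarrow> arrow \<Rightarrow> arrow" where
  "move_arrow p a = Arrow (p (tail_cell a)) (p (head_cell a))"

lemma move_arrow_sel [simp]:
  "tail_cell (move_arrow p a) = p (tail_cell a)" "head_cell (move_arrow p a) = p (head_cell a)"
  by (simp_all add: move_arrow_def)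

lemma inj_on_move_arrow: "p permutes C \<Longrightarrow> inj_on (move_arrow p) T"
  unfolding move_arrow_def
  by (rule inj_onI, rule arrow.expand) (metis arrow.inject injD permutes_inj)

lemma matching_move:
  assumes M: "matching C T" and p: "p permutes C"
  shows "matching C (move_arrow p ` T)"
  unfolding matching_def
proof (intro conjI ballI)
  fix b assume "b \<in> move_arrow p ` T"
  then obtain a where a: "a \<in> T" "b = move_arrow p a" by auto
  show "tail_cell b \<in> C" "head_cell b \<in> C"
    using a matching_cell[OF M] permutes_in_image[OF p] by auto
  have "tail_cell a \<noteq> head_cell a" using M a by (auto simp: matching_def)
  then show "tail_cell b \<noteq> head_cell b" using a permutes_inj[OF p] by (auto dest: injD)
next
  fix c assume c: "c \<in> C"
  then obtain c' where c': "c' \<in> C" "c = p c'" using permutes_image[OF p] by blast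
  then obtain a where a: "a \<in> T" "c' = head_cell a \<or> c' = tail_cell a"
    using matching_cover[OF M] by blast
  show "\<exists>!b. b \<in> move_arrow p ` T \<and> (c = head_cell b \<or> c = tail_cell b)"
  proof (rule ex1I[of _ "move_arrow p a"])
    show "move_arrow p a \<in> move_arrow p ` T \<and> (c = head_cell (move_arrow p a) \<or> c = tail_cell (move_arrow p a))"
      using a c' by auto
    fix b assume b: "b \<in> move_arrow p ` T \<and> (c = head_cell b \<or> c = tail_cell b)"
    then obtain a' where a': "a' \<in> T" "b = move_arrow p a'" by auto
    have "c' = head_cell a' \<or> c' = tail_cell a'"
      using b a' c' permutes_inj[OF p] by (auto dest: injD)
    then have "a = a'" using matching_unique[OF M a(1) a'(1)] a(2) by auto
    then show "b = move_arrow p a" using a' by simp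
  qed
qed

text \<open>Replacing the summation index q by q o p turns the moved matching back into T. So moving
  a matching together with its forms changes a Pfaffian sum by a sign only.\<close>

lemma pf_sum_move:
  assumes "finite C" and M: "matching C T" and p: "p permutes C"
  shows "pf_sum C T Z = of_int (sign p) * pf_sum C (move_arrow p ` T) (\<lambda>b. Z (inv_into T (move_arrow p) b))"
proof -
  note inj = inj_on_move_arrow[OF p, of T]
  have "pf_sum C (move_arrow p ` T) (\<lambda>b. Z (inv_into T (move_arrow p) b)) =
     (\<Sum>q | q permutes C. of_int (sign q) * (\<Prod>a\<in>T. Z a ((q \<circ> p) (tail_cell a)) ((q \<circ> p) (head_cell a))))"
    unfolding pf_sum_def
    by (intro sum.cong refl) (simp add: prod.reindex[OF inj] inv_into_f_f[OF inj])
  then have "of_int (sign p) * pf_sum C (move_arrow p ` T) (\<lambda>b. Z (inv_into T (move_arrow p) b)) =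
     (\<Sum>q | q permutes C. of_int (sign (q \<circ> p)) * (\<Prod>a\<in>T. Z a ((q \<circ> p) (tail_cell a)) ((q \<circ> p) (head_cell a))))"
    by (simp add: sum_distrib_left sign_permutes_compose[OF assms(1) _ p] mult_ac)
  also have "\<dots> = pf_sum C T Z"
    unfolding pf_sum_def by (rule sum_permutes_compose_right[OF p, symmetric])
  finally show ?thesis by simp
qed

context
  fixes n :: "nat list" and T :: "arrow set" and src tgt :: "nat \<Rightarrow> nat" and M :: "nat \<Rightarrow> 'a::comm_ring_1 mat"
    and L :: "nat set" and f :: "arrow \<Rightarrow> nat"
  assumes T: "tableau n T" and L: "finite L" and f: "f \<in> T \<rightarrow>\<^sub>E L"
begin

lemma orbit_sum_aux:
  "(\<Sum>g\<in>orbit_of T L f. pf_sum (cells n) T (\<lambda>a. blk (src (g a)) (tgt (g a)) (M (g a)))) =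
    of_nat (card (orbit_of T L f)) * pf_sum (cells n) T (\<lambda>a. blk (src (f a)) (tgt (f a)) (M (f a)))"
proof -
  have mt: "matching (cells n) T" using T by (simp add: tableau_iff_matching)
  note finT = matching_finite[OF mt finite_cells]
  have "pf_sum (cells n) T (\<lambda>a. blk (src (g a)) (tgt (g a)) (M (g a))) =
    pf_sum (cells n) T (\<lambda>a. blk (src (f a)) (tgt (f a)) (M (f a)))" if g: "g \<in> orbit_of T L f" for g
  proof -
    obtain \<tau> where \<tau>: "\<tau> permutes T" "\<And>a. a \<in> T \<Longrightarrow> g a = f (\<tau> a)"
      using orbit_of_permutes[OF finT g] by blast
    have "pf_sum (cells n) T (\<lambda>a. blk (src (g a)) (tgt (g a)) (M (g a))) =
      pf_sum (cells n) T (\<lambda>a. blk (src (f (\<tau> a))) (tgt (f (\<tau> a))) (M (f (\<tau> a))))"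
      using \<tau>(2) by (intro pf_sum_cong[OF mt]) simp
    then show ?thesis
      using pf_sum_permute_arrows[OF finite_cells mt \<tau>(1), of "\<lambda>a. blk (src (f a)) (tgt (f a)) (M (f a))"]
      by simp
  qed
  then show ?thesis by simp
qed

text \<open>All members of the orbit have the same Pfaffian sum; the factors |orbit| and |stab|
  multiply to |T|!.\<close>

lemma orbit_sum_eq_bpf:
  assumes "\<And>a. a \<in> T \<Longrightarrow> src (f a) = tail_col a \<and> tgt (f a) = head_col a"
  shows "(\<Sum>g\<in>orbit_of T L f. pf_sum (cells n) T (\<lambda>a. blk (src (g a)) (tgt (g a)) (M (g a)))) =
    of_nat (fact (card T)) * bpf_fam n T f M"
proof -
  have mt: "matching (cells n) T" using T by (simp add: tableau_iff_matching)
  have "pf_sum (cells n) T (\<lambda>a. blk (src (f a)) (tgt (f a)) (M (f a))) = of_nat (card (stab T f)) * bpf_fam n T f M"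
    by (rule pf_sum_blocks[OF T]) (use assms in metis)+
  then show ?thesis
    using orbit_sum_aux card_orbit_stab[OF matching_finite[OF mt finite_cells] L f]
    by (metis mult.assoc of_nat_mult)
qed

text \<open>The labels may demand columns that T does not offer. If no permutation of the cells
  brings the ends of the arrows into the demanded columns, every term has a zero block. Otherwise
  such a permutation moves T to a tableau on which the labelling fits, and the stabilizer keeps its
  order.\<close>

lemma orbit_sum_cases:
  obtains (zero) "(\<Sum>g\<in>orbit_of T L f. pf_sum (cells n) T (\<lambda>a. blk (src (g a)) (tgt (g a)) (M (g a)))) = 0"
  | (bpf) T' \<phi>' s where "tableau n T'" "s = 1 \<or> s = - 1" "\<phi>' ` T' = f ` T"
      "\<And>b. b \<in> T' \<Longrightarrow> tail_col b = src (\<phi>' b) \<and> head_col b = tgt (\<phi>' b)"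
      "(\<Sum>g\<in>orbit_of T L f. pf_sum (cells n) T (\<lambda>a. blk (src (g a)) (tgt (g a)) (M (g a)))) =
        s * (of_nat (fact (card T)) * bpf_fam n T' \<phi>' M)"
proof -
  have mt: "matching (cells n) T" using T by (simp add: tableau_iff_matching)
  note finT = matching_finite[OF mt finite_cells]
  let ?Z = "\<lambda>a. blk (src (f a)) (tgt (f a)) (M (f a))"
  show thesis
  proof (cases "\<exists>p. p permutes cells n \<and> (\<forall>a\<in>T. fst (p (tail_cell a)) = src (f a) \<and> fst (p (head_cell a)) = tgt (f a))")
    case False
    have "pf_sum (cells n) T ?Z = 0"
      unfolding pf_sum_def
    proof (rule sum.neutral, rule ballI)
      fix p assume "p \<in> {p. p permutes cells n}"
      then obtain a where "a \<in> T" "?Z a (p (tail_cell a)) (p (head_cell a)) = 0"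
        using False by (auto simp: blk_def)
      then show "of_int (sign p) * (\<Prod>a\<in>T. ?Z a (p (tail_cell a)) (p (head_cell a))) = 0"
        using prod_zero[OF finT] by fastforce
    qed
    then show thesis using zero orbit_sum_aux by simp
  next
    case True
    then obtain p where p: "p permutes cells n"
      and pc: "\<And>a. a \<in> T \<Longrightarrow> fst (p (tail_cell a)) = src (f a) \<and> fst (p (head_cell a)) = tgt (f a)" by blast
    let ?\<kappa> = "move_arrow p"
    define T' where "T' = ?\<kappa> ` T"
    define \<phi>' where "\<phi>' b = f (inv_into T ?\<kappa> b)" for b
    note inj = inj_on_move_arrow[OF p, of T]
    have \<phi>'\<kappa>: "\<phi>' (?\<kappa> a) = f a" if "a \<in> T" for a using that inj by (simp add: \<phi>'_def)
    have T': "tableau n T'" using matching_move[OF mt p] by (simp add: tableau_iff_matching T'_def)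
    have im: "\<phi>' ` T' = f ` T" using \<phi>'\<kappa> by (auto simp: T'_def image_image)
    have cols: "tail_col b = src (\<phi>' b) \<and> head_col b = tgt (\<phi>' b)" if "b \<in> T'" for b
      using that pc \<phi>'\<kappa> by (auto simp: T'_def)
    have "pf_sum (cells n) T' (\<lambda>b. blk (src (\<phi>' b)) (tgt (\<phi>' b)) (M (\<phi>' b))) =
        of_nat (card (stab T' \<phi>')) * bpf_fam n T' \<phi>' M"
      by (rule pf_sum_blocks[OF T']) (use cols in auto)
    moreover have "card (stab T' \<phi>') = card (stab T f)"
      using card_stab_bij[of ?\<kappa> T T' \<phi>' f] inj \<phi>'\<kappa> by (simp add: bij_betw_def T'_def)
    ultimately have "pf_sum (cells n) T ?Z = of_int (sign p) * (of_nat (card (stab T f)) * bpf_fam n T' \<phi>' M)"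
      using pf_sum_move[OF finite_cells mt p, of ?Z] by (simp add: T'_def \<phi>'_def)
    then have "(\<Sum>g\<in>orbit_of T L f. pf_sum (cells n) T (\<lambda>a. blk (src (g a)) (tgt (g a)) (M (g a)))) =
        of_int (sign p) * (of_nat (card (orbit_of T L f) * card (stab T f)) * bpf_fam n T' \<phi>' M)"
      using orbit_sum_aux by (simp add: mult_ac)
    then show thesis
      using bpf[OF T' _ im cols, of "of_int (sign p)"] card_orbit_stab[OF finT L f]
      by (simp add: sign_def)
  qed
qed

end

section \<open>Determinants of elementary congruences\<close>

lemma const_poly_prod: "(\<Prod>i\<in>I. [:f i:]) = [:\<Prod>i\<in>I. f i :: 'a::comm_ring_1:]"
  by (induction I rule: infinite_finite_induct) (auto simp: one_pCons)

lemma const_poly_sum: "(\<Sum>i\<in>I. [:f i:]) = [:\<Sum>i\<in>I. f i :: 'a::comm_ring_1:]"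
  by (induction I rule: infinite_finite_induct) auto

lemma const_poly_of_int: "of_int k = [:of_int k :: 'a::comm_ring_1:]"
  by (simp add: of_int_poly)

text \<open>Both sides are det(xE - zY). Choosing in each row either the x-term or the z-term gives
  coefficients independent of x and z; they are identified at x = t, z = 1, where the determinant is
  the characteristic polynomial. The values x = 1, z = -u will give det(E + uY).\<close>

lemma homogenized_char_poly:
  fixes Y :: "'a::comm_ring_1 mat" and x z :: "'a poly"
  assumes Y: "Y \<in> carrier_mat N N"
  shows "(\<Sum>p | p permutes {..<N}. of_int (sign p) *
      (\<Prod>i<N. (if i = p i then x else 0) + z * [:- (Y $$ (i, p i)):])) =
    (\<Sum>k\<le>N. [:coeff (char_poly Y) k:] * x ^ k * z ^ (N - k))"
proof -
  \<comment> \<open>B is the set of rows in which the diagonal x-term is chosen.\<close>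
  define \<kappa> where "\<kappa> k = (\<Sum>p | p permutes {..<N}. \<Sum>B | B \<subseteq> {..<N} \<and> card B = k. of_int (sign p) *
      ((\<Prod>i\<in>B. if i = p i then 1 else 0) * (\<Prod>i\<in>{..<N}-B. - (Y $$ (i, p i)))))" for k
  have main: "(\<Sum>p | p permutes {..<N}. of_int (sign p) *
      (\<Prod>i<N. (if i = p i then x else 0) + z * [:- (Y $$ (i, p i)):])) =
    (\<Sum>k\<le>N. [:\<kappa> k:] * x ^ k * z ^ (N - k))" for x z :: "'a poly"
  proof -
    let ?t = "\<lambda>p B. of_int (sign p) * ((\<Prod>i\<in>B. if i = p i then 1 else 0) * (\<Prod>i\<in>{..<N}-B. - (Y $$ (i, p i))))"
    have "(\<Prod>i<N. (if i = p i then x else 0) + z * [:- (Y $$ (i, p i)):]) =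
      (\<Sum>B\<in>Pow {..<N}. [:(\<Prod>i\<in>B. if i = p i then 1 else 0) * (\<Prod>i\<in>{..<N}-B. - (Y $$ (i, p i))):] * x ^ card B * z ^ (N - card B))" for p
    proof (subst prod_add, simp, rule sum.cong[OF refl])
      fix B assume "B \<in> Pow {..<N}"
      then have B: "B \<subseteq> {..<N}" "finite B" by (auto intro: finite_subset)
      have "(\<Prod>i\<in>B. if i = p i then x else 0) = (\<Prod>i\<in>B. x * [:if i = p i then 1 else 0:])"
        by (intro prod.cong) auto
      also have "\<dots> = x ^ card B * [:\<Prod>i\<in>B. if i = p i then 1 else 0:]"
        by (simp add: prod.distrib const_poly_prod del: mult_pCons_right)
      finally have 1: "(\<Prod>i\<in>B. if i = p i then x else 0) = x ^ card B * [:\<Prod>i\<in>B. if i = p i then 1 else 0:]" .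
      have 2: "(\<Prod>i\<in>{..<N} - B. z * [:- (Y $$ (i, p i)):]) = z ^ (N - card B) * [:\<Prod>i\<in>{..<N}-B. - (Y $$ (i, p i)):]"
        using B by (simp add: prod.distrib const_poly_prod card_Diff_subset del: mult_pCons_right)
      have 3: "[:a * b:] = [:a:] * [:b:]" for a b :: 'a by simp
      show "(\<Prod>i\<in>B. if i = p i then x else 0) * (\<Prod>i\<in>{..<N} - B. z * [:- (Y $$ (i, p i)):]) =
        [:(\<Prod>i\<in>B. if i = p i then 1 else 0) * (\<Prod>i\<in>{..<N}-B. - (Y $$ (i, p i))):] * x ^ card B * z ^ (N - card B)"
        unfolding 1 2 3 by (simp only: mult_ac)
    qed
    then have "(\<Sum>p | p permutes {..<N}. of_int (sign p) *
      (\<Prod>i<N. (if i = p i then x else 0) + z * [:- (Y $$ (i, p i)):])) =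
      (\<Sum>p | p permutes {..<N}. \<Sum>B\<in>Pow {..<N}. [:?t p B:] * x ^ card B * z ^ (N - card B))"
      by (simp add: sum_distrib_left const_poly_of_int mult_ac)
    also have "\<dots> = (\<Sum>p | p permutes {..<N}. \<Sum>k\<le>N. \<Sum>B | B \<subseteq> {..<N} \<and> card B = k. [:?t p B:] * x ^ k * z ^ (N - k))"
    proof (rule sum.cong[OF refl])
      fix p
      have "(\<Sum>k\<le>N. \<Sum>B | B \<subseteq> {..<N} \<and> card B = k. [:?t p B:] * x ^ k * z ^ (N - k)) =
        (\<Sum>k\<le>N. \<Sum>B | B \<in> Pow {..<N} \<and> card B = k. [:?t p B:] * x ^ card B * z ^ (N - card B))"
        by (intro sum.cong) auto
      also have "\<dots> = (\<Sum>B\<in>Pow {..<N}. [:?t p B:] * x ^ card B * z ^ (N - card B))"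
      proof (rule sum.group)
        show "card ` Pow {..<N} \<subseteq> {..N}"
          using card_mono[of "{..<N}"] by fastforce
      qed simp_all
      finally show "(\<Sum>B\<in>Pow {..<N}. [:?t p B:] * x ^ card B * z ^ (N - card B)) =
        (\<Sum>k\<le>N. \<Sum>B | B \<subseteq> {..<N} \<and> card B = k. [:?t p B:] * x ^ k * z ^ (N - k))"
        by (rule sym)
    qed
    also have "\<dots> = (\<Sum>k\<le>N. \<Sum>p | p permutes {..<N}. \<Sum>B | B \<subseteq> {..<N} \<and> card B = k. [:?t p B:] * x ^ k * z ^ (N - k))"
      by (rule sum.swap)
    also have "\<dots> = (\<Sum>k\<le>N. [:\<kappa> k:] * x ^ k * z ^ (N - k))"
      by (simp only: \<kappa>_def const_poly_sum[symmetric] sum_distrib_right)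
    finally show ?thesis .
  qed
  have "char_poly Y = det (char_poly_matrix Y)" by (simp add: char_poly_def)
  also have "\<dots> = (\<Sum>p | p permutes {0..<N}. signof p * (\<Prod>i = 0..<N. char_poly_matrix Y $$ (i, p i)))"
    using Y by (intro det_def') simp
  also have "\<dots> = (\<Sum>p | p permutes {..<N}. of_int (sign p) *
      (\<Prod>i<N. (if i = p i then [:0, 1:] else 0) + 1 * [:- (Y $$ (i, p i)):]))"
    unfolding lessThan_atLeast0
  proof (intro sum.cong refl arg_cong2[where f = "(*)"] prod.cong)
    fix p i assume "p \<in> {p. p permutes {0..<N}}" "i \<in> {0..<N}"
    then have "i < N" "p i < N" using permutes_in_image[of p "{0..<N}" i] by auto
    then show "char_poly_matrix Y $$ (i, p i) = (if i = p i then [:0, 1:] else 0) + 1 * [:- (Y $$ (i, p i)):]"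
      using Y by (auto simp: char_poly_matrix_def)
  qed
  also have "\<dots> = (\<Sum>k\<le>N. [:\<kappa> k:] * [:0, 1:] ^ k * 1 ^ (N - k))" by (rule main)
  also have "\<dots> = (\<Sum>k\<le>N. monom (\<kappa> k) k)"
    by (simp add: monom_altdef)
  finally have "coeff (char_poly Y) k = \<kappa> k" if "k \<le> N" for k
    using that by (simp add: coeff_sum)
  then show ?thesis unfolding main by simp
qed

text \<open>A cell moved by a contributing permutation passes from column i to column j. Its image
  cannot move again, since j differs from i, so injectivity leaves only the identity.\<close>

lemma det_on_transvection:
  assumes "i \<noteq> j"
  shows "det_on (cells n) (\<lambda>c d. (if c = d then 1 else 0) + u * [:blk i j Y c d:]) = (1 :: 'a::comm_ring_1 poly)"
proof -
  let ?P = "\<lambda>c d. (if c = d then 1 else 0) + u * [:blk i j Y c d:]"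
  have "det_on (cells n) ?P = (\<Sum>p\<in>{id}. of_int (sign p) * (\<Prod>c\<in>cells n. ?P c (p c)))"
    unfolding det_on_def
  proof (rule sum.mono_neutral_right)
    show "\<forall>p\<in>{p. p permutes cells n} - {id}. of_int (sign p) * (\<Prod>c\<in>cells n. ?P c (p c)) = 0"
    proof
      fix p assume p: "p \<in> {p. p permutes cells n} - {id}"
      have "\<exists>c\<in>cells n. ?P c (p c) = 0"
      proof (rule ccontr)
        assume nz: "\<not> (\<exists>c\<in>cells n. ?P c (p c) = 0)"
        have *: "p c = c \<or> fst c = i \<and> fst (p c) = j" if "c \<in> cells n" for c
        proof (rule ccontr)
          assume "\<not> ?thesis"
          then have "?P c (p c) = 0" by (auto simp: blk_def)
          then show False using nz that by blast
        qed
        have "p c = c" for c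
        proof (cases "c \<in> cells n")
          case True
          then have "p c \<in> cells n" using p permutes_in_image[of p "cells n" c] by simp
          then have "p c = c \<or> p (p c) = p c" using *[OF True] *[of "p c"] assms by metis
          moreover have "inj p" using p permutes_inj by blast
          ultimately show ?thesis using injD[of p "p c" c] by blast
        next
          case False
          then show ?thesis using p permutes_not_in[of p "cells n" c] by simp
        qed
        then have "p = id" by (simp add: fun_eq_iff)
        then show False using p by simp
      qed
      then show "of_int (sign p) * (\<Prod>c\<in>cells n. ?P c (p c)) = 0"
        using prod_zero[OF finite_cells] by fastforce
    qed
  qed (auto simp: finite_permutations permutes_id)
  also have "\<dots> = 1"
  proof -
    have "blk i j Y c c = 0" for c using assms by (auto simp: blk_def)
    then show ?thesis by simp
  qed
  finally show ?thesis .
qed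

text \<open>Rows outside column j are rows of the unit matrix, so only permutations inside that
  column contribute. What remains is det(E + uY), the homogenized characteristic polynomial at x =
  1, z = -u.\<close>

lemma det_on_block:
  fixes Y :: "'a::comm_ring_1 mat"
  assumes j: "j < length n" and Y: "Y \<in> carrier_mat (n ! j) (n ! j)"
  shows "det_on (cells n) (\<lambda>c d. (if c = d then 1 else 0) + u * [:blk j j Y c d:]) =
    (\<Sum>k\<le>n ! j. [:coeff (char_poly Y) k:] * (- u) ^ (n ! j - k))"
proof -
  let ?N = "n ! j"
  let ?K = "Pair j ` {..<?N}"
  let ?P = "\<lambda>c d. (if c = d then 1 else 0) + u * [:blk j j Y c d:]"
  have K: "?K \<subseteq> cells n" using j by (auto simp: cells_def)
  have bij: "bij_betw (Pair j) {..<?N} ?K" by (auto simp: bij_betw_def inj_on_def)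
  have bij': "bij_betw snd ?K {..<?N}" by (auto simp: bij_betw_def inj_on_def image_image)
  have "det_on (cells n) ?P = (\<Sum>p | p permutes ?K. of_int (sign p) * (\<Prod>c\<in>cells n. ?P c (p c)))"
    unfolding det_on_def
  proof (rule sum.mono_neutral_right)
    show "{p. p permutes ?K} \<subseteq> {p. p permutes cells n}" using permutes_subset[OF _ K] by auto
    show "\<forall>p\<in>{p. p permutes cells n} - {p. p permutes ?K}. of_int (sign p) * (\<Prod>c\<in>cells n. ?P c (p c)) = 0"
    proof
      fix p assume p: "p \<in> {p. p permutes cells n} - {p. p permutes ?K}"
      have "\<exists>c\<in>cells n. ?P c (p c) = 0"
      proof (rule ccontr)
        assume nz: "\<not> (\<exists>c\<in>cells n. ?P c (p c) = 0)"
        have "p c = c" if "c \<in> cells n - ?K" for c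
        proof (rule ccontr)
          assume "p c \<noteq> c"
          moreover have "?P c (p c) \<noteq> 0" using nz that by blast
          ultimately have "fst c = j" by (auto simp: blk_def split: if_splits)
          then have "c \<in> ?K" using that snd_cell_mem[of c n] by (auto simp: image_iff prod_eq_iff)
          then show False using that by simp
        qed
        then have "p permutes ?K" using p by (auto intro: permutes_superset)
        then show False using p by simp
      qed
      then show "of_int (sign p) * (\<Prod>c\<in>cells n. ?P c (p c)) = 0"
        using prod_zero[OF finite_cells] by fastforce
    qed
  qed (auto simp: finite_permutations)
  also have "\<dots> = (\<Sum>p | p permutes {..<?N}. of_int (sign p) *
      (\<Prod>i<?N. (if i = p i then 1 else 0) + (- u) * [:- (Y $$ (i, p i)):]))"
  proof (rule sum.reindex_bij_witness[of _ "map_permutation {..<?N} (Pair j)" "map_permutation ?K snd"])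
    fix p assume p: "p \<in> {p. p permutes {..<?N}}"
    show "map_permutation {..<?N} (Pair j) p \<in> {p. p permutes ?K}"
      using p map_permutation_permutes[OF bij] by simp
    show "map_permutation ?K snd (map_permutation {..<?N} (Pair j) p) = p"
      using p by (intro map_permutation_compose_inv[OF bij]) auto
  next
    fix p assume "p \<in> {p. p permutes ?K}"
    then have p: "p permutes ?K" by simp
    let ?p = "map_permutation ?K snd p"
    have p': "?p permutes {..<?N}" by (rule map_permutation_permutes[OF bij' p])
    then show "?p \<in> {p. p permutes {..<?N}}" by simp
    show "map_permutation {..<?N} (Pair j) ?p = p"
      using p by (intro map_permutation_compose_inv[OF bij']) auto
    have inj': "inj_on snd ?K" using bij' by (simp add: bij_betw_def)
    have s: "sign ?p = sign p" using p inj' by (intro sign_map_permutation) auto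
    have val: "p (j, i) = (j, ?p i)" if "i < ?N" for i
    proof -
      have "(j, i) \<in> ?K" using that by simp
      moreover from this have "p (j, i) \<in> ?K" using permutes_in_image[OF p] by simp
      ultimately show ?thesis using map_permutation_apply[OF inj', of "(j, i)" p] by auto
    qed
    have "(\<Prod>c\<in>cells n. ?P c (p c)) = (\<Prod>c\<in>?K. ?P c (p c))"
    proof (rule prod.mono_neutral_right[OF finite_cells K], rule ballI)
      fix c assume c: "c \<in> cells n - ?K"
      then have "fst c \<noteq> j" using snd_cell_mem[of c n] by (auto simp: image_iff prod_eq_iff)
      then show "?P c (p c) = 1" using c permutes_not_in[OF p, of c] by (simp add: blk_def)
    qed
    also have "\<dots> = (\<Prod>i<?N. ?P (j, i) (p (j, i)))"
      by (subst prod.reindex) (auto simp: inj_on_def)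
    also have "\<dots> = (\<Prod>i<?N. (if i = ?p i then 1 else 0) + (- u) * [:- (Y $$ (i, ?p i)):])"
      by (intro prod.cong refl) (auto simp: val blk_def)
    finally show "of_int (sign ?p) * (\<Prod>i<?N. (if i = ?p i then 1 else 0) + (- u) * [:- (Y $$ (i, ?p i)):]) =
       of_int (sign p) * (\<Prod>c\<in>cells n. ?P c (p c))" by (simp only: s)
  qed
  also have "\<dots> = (\<Sum>k\<le>?N. [:coeff (char_poly Y) k:] * 1 ^ k * (- u) ^ (?N - k))"
    by (rule homogenized_char_poly[OF Y])
  finally show ?thesis by simp
qed

section \<open>Coefficients of the determinants, and divisibility of coefficients\<close>

lemma coeff_mult_gen_subring:
  assumes "\<And>k. coeff f k \<in> gen_subring G" "\<And>k. coeff g k \<in> gen_subring G"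
  shows "coeff (f * g) k \<in> gen_subring G"
  unfolding coeff_mult using assms by (intro gen_subring_sum gen_subring.mult)

lemma coeff_power_gen_subring:
  assumes "\<And>k. coeff f k \<in> gen_subring G"
  shows "coeff (f ^ m) k \<in> gen_subring G"
proof (induction m arbitrary: k)
  case 0
  then show ?case by (simp add: one_pCons coeff_pCons gen_subring_zero gen_subring.one split: nat.split)
next
  case (Suc m)
  then show ?case using coeff_mult_gen_subring[OF assms, of "f ^ m"] by simp
qed

lemma gen_subring_pm_one: "s = 1 \<or> s = - 1 \<Longrightarrow> s \<in> gen_subring G"
  using gen_subring.one gen_subring_uminus by blast

lemma char_poly_coeff_gen_subring:
  fixes Y :: "'a::idom mat"
  assumes Y: "Y \<in> carrier_mat N N" and \<sigma>: "\<And>k. k \<in> {1..N} \<Longrightarrow> sigma k Y \<in> gen_subring G" and k: "k \<le> N"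
  shows "coeff (char_poly Y) k \<in> gen_subring G"
proof (cases "k = N")
  \<comment> \<open>\<open>sigma k Y\<close> is available for k at least 1 only; the coefficient
    that corresponds to k = 0 is 1, as the polynomial is monic.\<close>
  case True
  then show ?thesis using degree_monic_char_poly[OF Y] gen_subring.one by (metis)
next
  case False
  let ?j = "N - k"
  have "sigma ?j Y = (- 1) ^ ?j * coeff (char_poly Y) k"
    using Y k by (simp add: sigma_def)
  then have "coeff (char_poly Y) k = (- 1) ^ ?j * sigma ?j Y"
    by (simp add: mult.assoc[symmetric] power_add[symmetric] mult_2[symmetric])
  moreover have "(- 1 :: 'a) ^ ?j \<in> gen_subring G"
    by (rule gen_subring_pm_one) (metis minus_one_power_iff)
  moreover have "sigma ?j Y \<in> gen_subring G" using \<sigma>[of ?j] False k by simp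
  ultimately show ?thesis using gen_subring.mult by metis
qed

text \<open>As w is at least 1, all powers of the monomial but the zeroth have constant term 0, and
  degree 0 retains only the leading coefficient of the characteristic polynomial. These two facts
  make f a unit among the power series over the subring, as \<open>good_cancel_unit\<close>
  requires.\<close>

lemma det_on_block_coeffs:
  fixes Y :: "'a::idom mat"
  assumes j: "j < length n" and Y: "Y \<in> carrier_mat (n ! j) (n ! j)"
    and \<sigma>: "\<And>k. k \<in> {1..n ! j} \<Longrightarrow> sigma k Y \<in> gen_subring G"
    and s: "s = 1 \<or> s = - 1" and w: "w \<ge> 1"
  defines "f \<equiv> det_on (cells n) (\<lambda>c d. (if c = d then 1 else 0) + monom s w * [:blk j j Y c d:])"
  shows "coeff f 0 = 1" "coeff f k \<in> gen_subring G"
proof -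
  let ?N = "n ! j" and ?u = "- monom s w"
  have f: "f = (\<Sum>k\<le>?N. [:coeff (char_poly Y) k:] * ?u ^ (?N - k))"
    unfolding f_def by (rule det_on_block[OF j Y])
  have u: "coeff ?u k \<in> gen_subring G" for k
    using gen_subring_pm_one[of "- s"] s gen_subring_zero by (auto simp: minus_monom)
  have c: "coeff [:coeff (char_poly Y) i:] k \<in> gen_subring G" if "i \<le> ?N" for i k
    using char_poly_coeff_gen_subring[OF Y \<sigma> that] gen_subring_zero by (auto simp: coeff_pCons split: nat.split)
  show "coeff f k \<in> gen_subring G"
    unfolding f coeff_sum
    by (intro gen_subring_sum coeff_mult_gen_subring coeff_power_gen_subring u c) simp
  have "coeff ([:coeff (char_poly Y) k:] * ?u ^ (?N - k)) 0 = (if k = ?N then 1 else 0)" if "k \<le> ?N" for k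
  proof (cases "k = ?N")
    case True
    then show ?thesis using degree_monic_char_poly[OF Y] by simp
  next
    case False
    then have "coeff (?u ^ (?N - k)) 0 = 0"
      using that w by (simp add: coeff_0_power)
    then show ?thesis using False by (simp add: coeff_mult_0)
  qed
  then show "coeff f 0 = 1" unfolding f coeff_sum by simp
qed

text \<open>Divisibility by m inside S, not merely in the ring, is what permits the final division.
  The bound D allows letters of large weight to be ignored.\<close>

definition good :: "nat \<Rightarrow> nat \<Rightarrow> 'a set \<Rightarrow> 'a::comm_ring_1 poly \<Rightarrow> bool" where
  "good m D S f \<longleftrightarrow> (\<forall>k\<le>D. \<exists>s\<in>S. coeff f k = of_nat m * s)"

lemma good_zero: "good m D (gen_subring G) 0"
  by (auto simp: good_def intro: bexI[OF _ gen_subring_zero])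

lemma good_add:
  assumes "good m D (gen_subring G) f" "good m D (gen_subring G) g"
  shows "good m D (gen_subring G) (f + g)"
  unfolding good_def
proof (intro allI impI)
  fix k assume "k \<le> D"
  then obtain s t where "s \<in> gen_subring G" "coeff f k = of_nat m * s" "t \<in> gen_subring G" "coeff g k = of_nat m * t"
    using assms unfolding good_def by blast
  then show "\<exists>s\<in>gen_subring G. coeff (f + g) k = of_nat m * s"
    by (intro bexI[of _ "s + t"]) (auto simp: distrib_left gen_subring_add)
qed

lemma good_sum:
  assumes "\<And>i. i \<in> I \<Longrightarrow> good m D (gen_subring G) (f i)"
  shows "good m D (gen_subring G) (sum f I)"
  using assms by (induction I rule: infinite_finite_induct) (auto simp: good_zero good_add)

text \<open>u is invertible as a power series over the subring: the coefficients of f can be solved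
  for successively from those of u * f.\<close>

lemma good_cancel_unit:
  assumes u0: "coeff u 0 = 1" and u: "\<And>k. coeff u k \<in> gen_subring G"
    and uf: "good m D (gen_subring G) (u * f)"
  shows "good m D (gen_subring G) f"
proof -
  have "k \<le> D \<Longrightarrow> \<exists>s\<in>gen_subring G. coeff f k = of_nat m * s" for k
  proof (induction k rule: less_induct)
    case (less k)
    have "coeff (u * f) k = (\<Sum>i\<le>k. coeff u i * coeff f (k - i))" by (simp add: coeff_mult)
    also have "\<dots> = coeff f k + (\<Sum>i\<in>{..k} - {0}. coeff u i * coeff f (k - i))"
      by (subst sum.remove[of _ 0]) (auto simp: u0)
    finally have *: "coeff f k = coeff (u * f) k - (\<Sum>i\<in>{..k} - {0}. coeff u i * coeff f (k - i))" by simp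
    obtain s where s: "s \<in> gen_subring G" "coeff (u * f) k = of_nat m * s"
      using uf less.prems unfolding good_def by blast
    have "\<forall>i\<in>{..k} - {0}. \<exists>t\<in>gen_subring G. coeff f (k - i) = of_nat m * t"
      using less by auto
    then obtain t where t: "\<And>i. i \<in> {..k} - {0} \<Longrightarrow> t i \<in> gen_subring G \<and> coeff f (k - i) = of_nat m * t i"
      by metis
    have "(\<Sum>i\<in>{..k} - {0}. coeff u i * coeff f (k - i)) = of_nat m * (\<Sum>i\<in>{..k} - {0}. coeff u i * t i)"
      unfolding sum_distrib_left using t by (intro sum.cong) (auto simp: mult_ac)
    then have "coeff f k = of_nat m * (s - (\<Sum>i\<in>{..k} - {0}. coeff u i * t i))"
      using * s by (simp add: right_diff_distrib)
    moreover have "s - (\<Sum>i\<in>{..k} - {0}. coeff u i * t i) \<in> gen_subring G"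
      using s t u by (intro gen_subring.diff gen_subring_sum gen_subring.mult) auto
    ultimately show ?case by blast
  qed
  then show ?thesis by (simp add: good_def)
qed

section \<open>Letters and their elimination\<close>

text \<open>One summand of the block form: \<open>sg\<close> times t to the power \<open>wt\<close>
  times a matrix in block (\<open>src\<close>, \<open>tgt\<close>). Weights and factorizations have
  to be followed through the congruences, hence lists of summands instead of their sum.\<close>

datatype 'a letter = Letter (src: nat) (tgt: nat) (sg: 'a) (wt: nat) (lmat: "'a mat")

definition wf_letter :: "nat list \<Rightarrow> 'a letter \<Rightarrow> bool" where
  "wf_letter n l \<longleftrightarrow> src l < length n \<and> tgt l < length n \<and> lmat l \<in> carrier_mat (n ! src l) (n ! tgt l)"

definition lform :: "'a::comm_ring_1 letter \<Rightarrow> cell \<Rightarrow> cell \<Rightarrow> 'a poly" where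
  "lform l c d = monom (sg l * blk (src l) (tgt l) (lmat l) c d) (wt l)"

definition form :: "'a::comm_ring_1 letter list \<Rightarrow> cell \<Rightarrow> cell \<Rightarrow> 'a poly" where
  "form Ls c d = (\<Sum>l\<leftarrow>Ls. lform l c d)"

lemma form_simps [simp]:
  "form [] c d = 0" "form (l # Ls) c d = lform l c d + form Ls c d"
  "form (Ls @ Ls') c d = form Ls c d + form Ls' c d"
  by (simp_all add: form_def)

lemma form_mset: "mset Ls = mset Ls' \<Longrightarrow> form Ls = form Ls'"
  unfolding form_def by (intro ext) (metis mset_map sum_mset_sum_list)

text \<open>The negative transpose has the same antisymmetrization, so flipping a letter leaves
  Pfaffian sums unchanged. This lets either end of a letter serve as its target.\<close>

definition flip :: "'a::comm_ring_1 letter \<Rightarrow> 'a letter" where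
  "flip l = Letter (tgt l) (src l) (- sg l) (wt l) (transpose_mat (lmat l))"

lemma flip_sel [simp]:
  "src (flip l) = tgt l" "tgt (flip l) = src l" "sg (flip l) = - sg l" "wt (flip l) = wt l"
  "lmat (flip l) = transpose_mat (lmat l)"
  by (simp_all add: flip_def)

lemma wf_flip: "wf_letter n l \<Longrightarrow> wf_letter n (flip l)"
  by (auto simp: wf_letter_def)

lemma blk_transpose:
  assumes "Y \<in> carrier_mat (n ! i) (n ! j)" "c \<in> cells n" "d \<in> cells n"
  shows "blk j i (transpose_mat Y) d c = blk i j Y c d"
  using assms snd_cell_mem[of c n] snd_cell_mem[of d n] by (auto simp: blk_def)

lemma blk_mult:
  fixes Y Y' :: "'a::comm_ring_1 mat"
  assumes Y: "Y \<in> carrier_mat (n ! i) (n ! j)" and Y': "Y' \<in> carrier_mat (n ! j) (n ! k)"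
    and j: "j < length n" and c: "c \<in> cells n" "d \<in> cells n"
  shows "(\<Sum>e\<in>cells n. blk i j Y c e * blk j k Y' e d) = blk i k (Y * Y') c d"
proof -
  have "(\<Sum>e\<in>cells n. blk i j Y c e * blk j k Y' e d) = (\<Sum>e\<in>Pair j ` {..<n ! j}. blk i j Y c e * blk j k Y' e d)"
  proof (rule sum.mono_neutral_right)
    show "\<forall>e\<in>cells n - Pair j ` {..<n ! j}. blk i j Y c e * blk j k Y' e d = 0"
    proof
      fix e assume e: "e \<in> cells n - Pair j ` {..<n ! j}"
      then have "fst e \<noteq> j" using snd_cell_mem[of e n] by (auto simp: image_iff prod_eq_iff)
      then show "blk i j Y c e * blk j k Y' e d = 0" by (simp add: blk_def)
    qed
    show "Pair j ` {..<n ! j} \<subseteq> cells n" using j by (auto simp: cells_def)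
  qed simp
  also have "\<dots> = (\<Sum>r<n ! j. blk i j Y c (j, r) * blk j k Y' (j, r) d)"
    by (subst sum.reindex) (auto simp: inj_on_def)
  also have "\<dots> = blk i k (Y * Y') c d"
  proof (cases "fst c = i \<and> fst d = k")
    case True
    then have "snd c < n ! i" "snd d < n ! k" using c snd_cell_mem by auto
    then show ?thesis using True Y Y' by (simp add: blk_def scalar_prod_def lessThan_atLeast0)
  next
    case False
    then show ?thesis by (auto simp: blk_def)
  qed
  finally show ?thesis .
qed

lemma lform_flip:
  assumes "wf_letter n l" "c \<in> cells n" "d \<in> cells n"
  shows "lform (flip l) d c = - lform l c d"
  using assms blk_transpose[of "lmat l" n "src l" "tgt l" c d]
  by (simp add: lform_def wf_letter_def minus_monom)

lemma pf_sum_flip: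
  fixes l :: "'a::{idom,ring_char_0} letter"
  assumes T: "tableau n T" and l: "wf_letter n l"
  shows "pf_sum (cells n) T (\<lambda>_. form (flip l # Ls)) = pf_sum (cells n) T (\<lambda>_. form (l # Ls))"
proof (rule pf_sum_cong_antisym[OF finite_cells])
  show "matching (cells n) T" using T by (simp add: tableau_iff_matching)
  fix c d assume "c \<in> cells n" "d \<in> cells n"
  then show "form (flip l # Ls) c d - form (flip l # Ls) d c = form (l # Ls) c d - form (l # Ls) d c"
    using lform_flip[OF l, of c d] lform_flip[OF l, of d c] by simp
qed

text \<open>\<open>pre\<close> and \<open>post\<close> give the new terms in (1 + S) Z (1 + S)^t,
  where S is the block of l with its sign replaced by the scalar u: \<open>pre\<close> multiplies m
  by S from the left, \<open>post\<close> by the transpose of S from the right.\<close>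

definition pre :: "'a::comm_ring_1 \<Rightarrow> 'a letter \<Rightarrow> 'a letter \<Rightarrow> 'a letter" where
  "pre u l m = Letter (src l) (tgt m) (u * sg m) (wt l + wt m) (lmat l * lmat m)"

definition post :: "'a::comm_ring_1 \<Rightarrow> 'a letter \<Rightarrow> 'a letter \<Rightarrow> 'a letter" where
  "post u l m = Letter (src m) (src l) (u * sg m) (wt l + wt m) (lmat m * transpose_mat (lmat l))"

lemma pre_post_sel [simp]:
  "src (pre u l m) = src l" "tgt (pre u l m) = tgt m" "sg (pre u l m) = u * sg m"
  "wt (pre u l m) = wt l + wt m" "lmat (pre u l m) = lmat l * lmat m"
  "src (post u l m) = src m" "tgt (post u l m) = src l" "sg (post u l m) = u * sg m"
  "wt (post u l m) = wt l + wt m" "lmat (post u l m) = lmat m * transpose_mat (lmat l)"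
  by (simp_all add: pre_def post_def)

lemma sum_monom: "(\<Sum>i\<in>I. monom (f i) k) = monom (\<Sum>i\<in>I. f i) k"
  by (induction I rule: infinite_finite_induct) (auto simp: add_monom)

text \<open>The block is placed in column q although l ends in q': multiplication by the link, which
  joins q to q', then reproduces l up to a scalar.\<close>

definition step_mat :: "'a::comm_ring_1 \<Rightarrow> 'a letter \<Rightarrow> nat \<Rightarrow> cell \<Rightarrow> cell \<Rightarrow> 'a poly" where
  "step_mat u l q c d = monom (u * blk (src l) q (lmat l) c d) (wt l)"

context
  fixes n :: "nat list" and q q' :: nat and l :: "'a::comm_ring_1 letter" and u :: 'a
  assumes l: "wf_letter n l" "tgt l = q'" and q: "q < length n" "n ! q = n ! q'"
begin

lemma step_mat_left:
  assumes "\<And>m. m \<in> set Ls \<Longrightarrow> wf_letter n m" and c: "c \<in> cells n" "d \<in> cells n"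
  shows "(\<Sum>e\<in>cells n. step_mat u l q c e * form Ls e d) = form (map (pre u l) (filter (\<lambda>m. src m = q) Ls)) c d"
  using assms(1)
proof (induction Ls)
  case Nil
  then show ?case by simp
next
  case (Cons m Ls)
  have m: "wf_letter n m" using Cons by simp
  have "step_mat u l q c e * lform m e d =
    monom (u * sg m * (blk (src l) q (lmat l) c e * blk (src m) (tgt m) (lmat m) e d)) (wt l + wt m)" for e
    by (simp add: step_mat_def lform_def mult_monom mult_ac)
  then have "(\<Sum>e\<in>cells n. step_mat u l q c e * lform m e d) =
    monom (u * sg m * (\<Sum>e\<in>cells n. blk (src l) q (lmat l) c e * blk (src m) (tgt m) (lmat m) e d)) (wt l + wt m)"
    by (simp add: sum_monom sum_distrib_left)
  also have "(\<Sum>e\<in>cells n. blk (src l) q (lmat l) c e * blk (src m) (tgt m) (lmat m) e d) =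
    (if src m = q then blk (src l) (tgt m) (lmat l * lmat m) c d else 0)"
  proof (cases "src m = q")
    case True
    then show ?thesis
      using blk_mult[of "lmat l" n "src l" q "lmat m" "tgt m" c d] l q m c by (auto simp: wf_letter_def)
  next
    case False
    then show ?thesis by (auto simp: blk_def intro!: sum.neutral)
  qed
  finally show ?case
    using Cons by (simp add: distrib_left sum.distrib lform_def)
qed

lemma step_mat_right:
  assumes "\<And>m. m \<in> set Ls \<Longrightarrow> wf_letter n m" and c: "c \<in> cells n" "d \<in> cells n"
  shows "(\<Sum>e\<in>cells n. step_mat u l q d e * form Ls c e) = form (map (post u l) (filter (\<lambda>m. tgt m = q) Ls)) c d"
  using assms(1)
proof (induction Ls)
  case Nil
  then show ?case by simp
next
  case (Cons m Ls)
  have m: "wf_letter n m" using Cons by simp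
  have lq: "lmat l \<in> carrier_mat (n ! src l) (n ! q)" using l q by (simp add: wf_letter_def)
  have "step_mat u l q d e * lform m c e =
    monom (u * sg m * (blk (src m) (tgt m) (lmat m) c e * blk q (src l) (transpose_mat (lmat l)) e d)) (wt l + wt m)"
    if "e \<in> cells n" for e
    using blk_transpose[OF lq c(2) that] by (simp add: step_mat_def lform_def mult_monom mult_ac)
  then have "(\<Sum>e\<in>cells n. step_mat u l q d e * lform m c e) =
    monom (u * sg m * (\<Sum>e\<in>cells n. blk (src m) (tgt m) (lmat m) c e * blk q (src l) (transpose_mat (lmat l)) e d)) (wt l + wt m)"
    by (simp add: sum_monom sum_distrib_left)
  also have "(\<Sum>e\<in>cells n. blk (src m) (tgt m) (lmat m) c e * blk q (src l) (transpose_mat (lmat l)) e d) =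
    (if tgt m = q then blk (src m) (src l) (lmat m * transpose_mat (lmat l)) c d else 0)"
  proof (cases "tgt m = q")
    case True
    then show ?thesis
      using blk_mult[of "lmat m" n "src m" q "transpose_mat (lmat l)" "src l" c d] lq q m c by (auto simp: wf_letter_def)
  next
    case False
    then show ?thesis by (auto simp: blk_def intro!: sum.neutral)
  qed
  finally show ?case
    using Cons by (simp add: distrib_left sum.distrib lform_def)
qed

end

text \<open>The letters besides the link after the congruence, left factor first. l itself is
  dropped, since it cancels against the product of the step with the link. It is still an operand of
  \<open>pre\<close>, because it may start in q as well.\<close>

definition eliminate :: "'a::comm_ring_1 \<Rightarrow> nat \<Rightarrow> 'a letter \<Rightarrow> 'a letter list \<Rightarrow> 'a letter list" where
  "eliminate u q l Ls =
     (let Ls1 = Ls @ map (pre u l) (filter (\<lambda>m. src m = q) (l # Ls))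
      in Ls1 @ map (post u l) (filter (\<lambda>m. tgt m = q) Ls1))"

lemma wf_pre:
  assumes "wf_letter n l" "wf_letter n m" "n ! tgt l = n ! src m"
  shows "wf_letter n (pre u l m)"
  using assms by (auto simp: wf_letter_def)

lemma wf_post:
  assumes "wf_letter n l" "wf_letter n m" "n ! tgt l = n ! tgt m"
  shows "wf_letter n (post u l m)"
  using assms by (auto simp: wf_letter_def)

definition link :: "nat list \<Rightarrow> nat \<Rightarrow> nat \<Rightarrow> 'a::comm_ring_1 \<Rightarrow> 'a letter" where
  "link n q q' \<epsilon> = Letter q q' \<epsilon> 0 (1\<^sub>m (n ! q))"

lemma link_sel [simp]:
  "src (link n q q' \<epsilon>) = q" "tgt (link n q q' \<epsilon>) = q'" "sg (link n q q' \<epsilon>) = \<epsilon>"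
  "wt (link n q q' \<epsilon>) = 0" "lmat (link n q q' \<epsilon>) = 1\<^sub>m (n ! q)"
  by (simp_all add: link_def)

lemma wf_link: "q < length n \<Longrightarrow> q' < length n \<Longrightarrow> n ! q = n ! q' \<Longrightarrow> wf_letter n (link n q q' \<epsilon>)"
  by (auto simp: wf_letter_def)

text \<open>
  The congruence by \<open>1 + step_mat\<close> cancels \<open>l\<close> against the product of
  \<open>step_mat\<close> with the link, and each letter that it creates has \<open>l\<close> as a factor.
\<close>

lemma pf_sum_eliminate:
  fixes l :: "'a::{idom,ring_char_0} letter"
  assumes T: "tableau n T" and l: "wf_letter n l" "tgt l = q'"
    and q: "q < length n" "q' < length n" "n ! q = n ! q'" "q \<noteq> q'"
    and \<epsilon>: "\<epsilon> * \<epsilon> = 1" and Ls: "\<And>m. m \<in> set Ls \<Longrightarrow> wf_letter n m"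
  defines "u \<equiv> - (\<epsilon> * sg l)"
  shows "pf_sum (cells n) T (\<lambda>_. form (link n q q' \<epsilon> # eliminate u q l Ls)) =
    det_on (cells n) (\<lambda>c d. (if c = d then 1 else 0) + step_mat u l q c d) *
    pf_sum (cells n) T (\<lambda>_. form (link n q q' \<epsilon> # l # Ls))"
proof -
  let ?J = "link n q q' \<epsilon>"
  let ?P = "\<lambda>c d. (if c = d then 1 else 0) + step_mat u l q c d"
  let ?Ls0 = "?J # l # Ls"
  define Ls1 where "Ls1 = Ls @ map (pre u l) (filter (\<lambda>m. src m = q) (l # Ls))"
  have M: "matching (cells n) T" using T by (simp add: tableau_iff_matching)
  have wf0: "wf_letter n m" if "m \<in> set ?Ls0" for m
    using that wf_link[OF q(1-3)] l Ls by auto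
  have wf1: "wf_letter n m" if "m \<in> set (?J # Ls1)" for m
    using that wf_link[OF q(1-3)] l Ls wf_pre[OF l(1)] q by (auto simp: Ls1_def split: if_splits)
  \<comment> \<open>By the choice of u and since \<epsilon> squares to 1, u * \<epsilon> = - sg l:
    the step applied to the link gives exactly the negative of l.\<close>
  have cancel: "lform (pre u l ?J) c d = - lform l c d" for c d
  proof -
    have "lmat l * 1\<^sub>m (n ! q) = lmat l"
      using l q by (intro right_mult_one_mat) (auto simp: wf_letter_def)
    moreover have "u * \<epsilon> = - sg l" using \<epsilon> by (simp add: u_def mult_ac)
    ultimately show ?thesis using l by (simp add: lform_def minus_monom)
  qed
  have P: "(\<Sum>e\<in>cells n. ?P c e * X e) = X c + (\<Sum>e\<in>cells n. step_mat u l q c e * X e)"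
    if "c \<in> cells n" for c X
    using that by (simp add: distrib_right sum.distrib if_distrib[of "\<lambda>x. x * _"] cong: if_cong)
  have left: "(\<Sum>e\<in>cells n. ?P c e * form ?Ls0 e d) = form (?J # Ls1) c d"
    if c: "c \<in> cells n" "d \<in> cells n" for c d
  proof -
    have "(\<Sum>e\<in>cells n. ?P c e * form ?Ls0 e d) =
      form ?Ls0 c d + form (map (pre u l) (filter (\<lambda>m. src m = q) ?Ls0)) c d"
      unfolding P[OF c(1)] using step_mat_left[OF l q(1) q(3) wf0 c, of ?Ls0] by simp
    also have "\<dots> = form (?J # Ls1) c d" using cancel by (simp add: Ls1_def)
    finally show ?thesis .
  qed
  have "(\<Sum>c'\<in>cells n. \<Sum>d'\<in>cells n. ?P c c' * ?P d d' * form ?Ls0 c' d') = form (?J # eliminate u q l Ls) c d"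
    if c: "c \<in> cells n" "d \<in> cells n" for c d
  proof -
    have "(\<Sum>c'\<in>cells n. \<Sum>d'\<in>cells n. ?P c c' * ?P d d' * form ?Ls0 c' d') =
      (\<Sum>d'\<in>cells n. ?P d d' * (\<Sum>c'\<in>cells n. ?P c c' * form ?Ls0 c' d'))"
      by (subst sum.swap) (simp only: sum_distrib_left mult_ac)
    also have "\<dots> = (\<Sum>d'\<in>cells n. ?P d d' * form (?J # Ls1) c d')"
      using left[OF c(1)] by (intro sum.cong) auto
    also have "\<dots> = form (?J # Ls1) c d + form (map (post u l) (filter (\<lambda>m. tgt m = q) (?J # Ls1))) c d"
      unfolding P[OF c(2)] using step_mat_right[OF l q(1) q(3) wf1 c, of "?J # Ls1"] by simp
    \<comment> \<open>The link ends in q', which differs from q, so the right factor creates nothing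
      from it.\<close>
    also have "\<dots> = form (?J # eliminate u q l Ls) c d"
      using q(4) by (simp add: eliminate_def Let_def Ls1_def)
    finally show ?thesis .
  qed
  then have "pf_sum (cells n) T (\<lambda>_. form (?J # eliminate u q l Ls)) =
    pf_sum (cells n) T (\<lambda>a c d. \<Sum>c'\<in>cells n. \<Sum>d'\<in>cells n. ?P c c' * ?P d d' * form ?Ls0 c' d')"
    by (intro pf_sum_cong[OF M]) simp
  also have "\<dots> = det_on (cells n) ?P * pf_sum (cells n) T (\<lambda>_. form ?Ls0)"
    by (rule pf_sum_congruence[OF finite_cells M])
  finally show ?thesis .
qed

text \<open>If l starts in q, the step is a diagonal block with determinant det(E + u t^w Y), where
  Y is the matrix of l; this is how the values sigma_k(h) enter. Otherwise the step is a
  transvection.\<close>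

lemma det_on_step:
  fixes l :: "'a::idom letter"
  assumes l: "wf_letter n l" "tgt l = q'" and q: "q < length n" "n ! q = n ! q'"
    and \<sigma>: "\<And>k Y. k \<in> {1..n ! q} \<Longrightarrow> Y = lmat l \<Longrightarrow> Y \<in> carrier_mat (n ! q) (n ! q) \<Longrightarrow> sigma k Y \<in> gen_subring G"
    and u: "u = 1 \<or> u = - 1" and w: "wt l \<ge> 1"
  defines "f \<equiv> det_on (cells n) (\<lambda>c d. (if c = d then 1 else 0) + step_mat u l q c d)"
  shows "coeff f 0 = 1" "coeff f k \<in> gen_subring G"
proof -
  have f: "f = det_on (cells n) (\<lambda>c d. (if c = d then 1 else 0) + monom u (wt l) * [:blk (src l) q (lmat l) c d:])"
    by (simp add: f_def step_mat_def smult_monom mult_ac)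
  have "coeff f 0 = 1 \<and> (\<forall>k. coeff f k \<in> gen_subring G)"
  proof (cases "src l = q")
    case True
    then have Y: "lmat l \<in> carrier_mat (n ! q) (n ! q)" using l q by (auto simp: wf_letter_def)
    show ?thesis
      unfolding f True using det_on_block_coeffs[OF q(1) Y \<sigma>[OF _ refl Y] u w] by blast
  next
    case False
    then show ?thesis
      unfolding f det_on_transvection[OF False]
      by (auto simp: one_pCons coeff_pCons gen_subring_zero gen_subring.one split: nat.split)
  qed
  then show "coeff f 0 = 1" "coeff f k \<in> gen_subring G" by auto
qed

section \<open>Expansion of the Pfaffian sum of a list of letters\<close>

lemma prod_monom: "(\<Prod>i\<in>I. monom (f i) (w i)) = monom (\<Prod>i\<in>I. f i :: 'a::comm_ring_1) (\<Sum>i\<in>I. w i)"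
  by (induction I rule: infinite_finite_induct) (auto simp: mult_monom one_pCons monom_0)

lemma of_int_mult_monom: "of_int k * monom (c :: 'a::comm_ring_1) w = monom (of_int k * c) w"
  by (simp add: const_poly_of_int smult_monom)

definition placed_sum :: "nat list \<Rightarrow> arrow set \<Rightarrow> 'a::comm_ring_1 letter list \<Rightarrow> (arrow \<Rightarrow> nat) \<Rightarrow> 'a" where
  "placed_sum n T Ls f = pf_sum (cells n) T (\<lambda>a. blk (src (Ls ! f a)) (tgt (Ls ! f a)) (lmat (Ls ! f a)))"

text \<open>Multilinearity: every arrow selects one letter of the list, and f records the selected
  position.\<close>

lemma pf_sum_form_expand:
  assumes T: "tableau n T"
  shows "pf_sum (cells n) T (\<lambda>_. form Ls) = (\<Sum>f\<in>T \<rightarrow>\<^sub>E {..<length Ls}.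
    monom ((\<Prod>a\<in>T. sg (Ls ! f a)) * placed_sum n T Ls f) (\<Sum>a\<in>T. wt (Ls ! f a)))"
proof -
  have M: "matching (cells n) T" using T by (simp add: tableau_iff_matching)
  note finT = matching_finite[OF M finite_cells]
  let ?B = "\<lambda>f p a. blk (src (Ls ! f a)) (tgt (Ls ! f a)) (lmat (Ls ! f a)) (p (tail_cell a)) (p (head_cell a))"
  let ?s = "\<lambda>f. \<Prod>a\<in>T. sg (Ls ! f a)" and ?w = "\<lambda>f. \<Sum>a\<in>T. wt (Ls ! f a)"
  have "(\<Prod>a\<in>T. form Ls (p (tail_cell a)) (p (head_cell a))) =
    (\<Sum>f\<in>T \<rightarrow>\<^sub>E {..<length Ls}. monom (?s f * (\<Prod>a\<in>T. ?B f p a)) (?w f))" for p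
  proof -
    have "form Ls c d = (\<Sum>i<length Ls. lform (Ls ! i) c d)" for c d
      by (simp add: form_def sum_list_sum_nth lessThan_atLeast0)
    then have "(\<Prod>a\<in>T. form Ls (p (tail_cell a)) (p (head_cell a))) =
      (\<Sum>f\<in>T \<rightarrow>\<^sub>E {..<length Ls}. \<Prod>a\<in>T. lform (Ls ! f a) (p (tail_cell a)) (p (head_cell a)))"
      by (simp add: prod_sum_PiE[OF finT])
    then show ?thesis by (simp add: lform_def prod_monom prod.distrib)
  qed
  then have "pf_sum (cells n) T (\<lambda>_. form Ls) = (\<Sum>p | p permutes cells n. \<Sum>f\<in>T \<rightarrow>\<^sub>E {..<length Ls}.
      monom (?s f * (of_int (sign p) * (\<Prod>a\<in>T. ?B f p a))) (?w f))"
    by (simp add: pf_sum_def sum_distrib_left of_int_mult_monom mult_ac)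
  also have "\<dots> = (\<Sum>f\<in>T \<rightarrow>\<^sub>E {..<length Ls}. monom (?s f * placed_sum n T Ls f) (?w f))"
    by (subst sum.swap) (simp add: sum_monom placed_sum_def pf_sum_def sum_distrib_left)
  finally show ?thesis .
qed

text \<open>A single labelling brings only the order of its stabilizer as a factor; |T|! appears
  after summation over its orbit. The orbits are the classes of equal multisets of labels, and on
  each of them the product of signs and the total weight are constant.\<close>

lemma good_pf_sum_form:
  assumes T: "tableau n T"
    and orbit: "\<And>f. f \<in> T \<rightarrow>\<^sub>E {..<length Ls} \<Longrightarrow> good m D (gen_subring G)
      (monom ((\<Prod>a\<in>T. sg (Ls ! f a)) * (\<Sum>g\<in>orbit_of T {..<length Ls} f. placed_sum n T Ls g)) (\<Sum>a\<in>T. wt (Ls ! f a)))"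
  shows "good m D (gen_subring G) (pf_sum (cells n) T (\<lambda>_. form Ls))"
proof -
  have M: "matching (cells n) T" using T by (simp add: tableau_iff_matching)
  note finT = matching_finite[OF M finite_cells]
  let ?F = "T \<rightarrow>\<^sub>E {..<length Ls}"
  let ?\<mu> = "\<lambda>f. image_mset f (mset_set T)"
  let ?s = "\<lambda>f. \<Prod>a\<in>T. sg (Ls ! f a)" and ?w = "\<lambda>f. \<Sum>a\<in>T. wt (Ls ! f a)"
  let ?y = "\<lambda>f. monom (?s f * placed_sum n T Ls f) (?w f)"
  have finF: "finite ?F" using finT by (intro finite_PiE) auto
  have "pf_sum (cells n) T (\<lambda>_. form Ls) = (\<Sum>\<nu>\<in>?\<mu> ` ?F. \<Sum>f | f \<in> ?F \<and> ?\<mu> f = \<nu>. ?y f)"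
    unfolding pf_sum_form_expand[OF T] by (rule sum.group[symmetric]) (use finF in auto)
  moreover have "good m D (gen_subring G) (\<Sum>f | f \<in> ?F \<and> ?\<mu> f = \<nu>. ?y f)" if "\<nu> \<in> ?\<mu> ` ?F" for \<nu>
  proof -
    obtain f where f: "f \<in> ?F" "\<nu> = ?\<mu> f" using \<open>\<nu> \<in> ?\<mu> ` ?F\<close> by blast
    have "?s g = ?s f \<and> ?w g = ?w f" if g: "g \<in> orbit_of T {..<length Ls} f" for g
    proof -
      obtain \<tau> where \<tau>: "\<tau> permutes T" "\<And>a. a \<in> T \<Longrightarrow> g a = f (\<tau> a)"
        using orbit_of_permutes[OF finT g] by blast
      show ?thesis
        using prod.permute[OF \<tau>(1), of "\<lambda>a. sg (Ls ! f a)"] sum.permute[OF \<tau>(1), of "\<lambda>a. wt (Ls ! f a)"] \<tau>(2)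
        by (simp add: comp_def)
    qed
    then have "(\<Sum>g\<in>orbit_of T {..<length Ls} f. ?y g) =
      monom (?s f * (\<Sum>g\<in>orbit_of T {..<length Ls} f. placed_sum n T Ls g)) (?w f)"
      by (simp add: sum_monom sum_distrib_left)
    moreover have "{g. g \<in> ?F \<and> ?\<mu> g = \<nu>} = orbit_of T {..<length Ls} f"
      by (simp add: orbit_of_def f)
    ultimately show ?thesis using orbit[OF f(1)] by simp
  qed
  ultimately show ?thesis by (simp add: good_sum)
qed

lemma card_cells: "card (cells n) = sum_list n"
proof -
  have "cells n = (SIGMA i:{..<length n}. {..<n ! i})" by (auto simp: cells_def)
  then show ?thesis by (simp add: sum_list_sum_nth lessThan_atLeast0)
qed

text \<open>e compares the positions in a shortened list with the surviving positions; it will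
  renumber the columns of d.\<close>

lemma nths_conv_nth:
  obtains e where "bij_betw e {..<length (nths xs A)} {i. i < length xs \<and> i \<in> A}"
    "\<And>i. i < length (nths xs A) \<Longrightarrow> nths xs A ! i = xs ! e i"
proof -
  let ?is = "filter (\<lambda>i. i \<in> A) [0..<length xs]"
  have "nths xs A = map ((!) xs) ?is"
  proof (induction xs rule: rev_induct)
    case Nil
    then show ?case by simp
  next
    case (snoc x xs)
    have "map ((!) (xs @ [x])) (filter (\<lambda>i. i \<in> A) [0..<length xs]) = map ((!) xs) (filter (\<lambda>i. i \<in> A) [0..<length xs])"
      by (intro map_cong refl) (auto simp: nth_append)
    then show ?case using snoc by (simp add: nths_append nths_singleton)
  qed
  moreover have "bij_betw ((!) ?is) {..<length ?is} (set ?is)"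
    by (rule bij_betw_nth) auto
  ultimately show thesis
    by (intro that[of "(!) ?is"]) (auto simp: conj_commute)
qed

lemma permutes_strict_mono_imp_id:
  fixes p :: "nat \<Rightarrow> nat"
  assumes p: "p permutes {..<N}" and mono: "\<And>r s. r < s \<Longrightarrow> s < N \<Longrightarrow> p r < p s"
  shows "p = id"
proof (rule permutes_natset_ge[OF p], rule ballI)
  fix r assume "r \<in> {..<N}"
  then have "r < N" by simp
  then show "r \<le> p r"
  proof (induction r)
    case 0
    then show ?case by simp
  next
    case (Suc r)
    then show ?case using mono[of r "Suc r"] by simp
  qed
qed

text \<open>An arrow that meets q1 or q2 runs from q1 to q2, so these arrows pair the cells of the
  two columns; nu follows them from head to tail.\<close>

lemma link_columns_permutation:
  assumes T: "tableau n T" and q: "q1 < length n" "q2 < length n" "n ! q1 = n ! q2" "q1 \<noteq> q2"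
    and J: "\<And>a. a \<in> T \<Longrightarrow> (tail_col a = q1 \<and> head_col a = q2) \<or> (tail_col a \<notin> {q1, q2} \<and> head_col a \<notin> {q1, q2})"
  obtains \<nu> where "\<nu> permutes {..<n ! q1}"
    "\<And>a. a \<in> T \<Longrightarrow> tail_col a = q1 \<Longrightarrow> \<nu> (head_row a) = tail_row a"
    "\<And>r. r < n ! q1 \<Longrightarrow> \<exists>a\<in>T. tail_cell a = (q1, r) \<and> head_col a = q2"
    "\<And>r. r < n ! q1 \<Longrightarrow> \<exists>a\<in>T. head_cell a = (q2, r) \<and> tail_col a = q1"
proof -
  let ?N = "n ! q1"
  have M: "matching (cells n) T" using T by (simp add: tableau_iff_matching)
  have tails: "\<exists>a\<in>T. tail_cell a = (q1, r) \<and> head_col a = q2" if "r < ?N" for r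
  proof -
    have "(q1, r) \<in> cells n" using that q by (simp add: cells_def)
    then obtain a where a: "a \<in> T" "tail_cell a = (q1, r) \<or> head_cell a = (q1, r)"
      using matching_cover[OF M] by (metis (no_types, lifting) Un_iff imageE)
    then show ?thesis using J[OF a(1)] q(4) by auto
  qed
  have heads: "\<exists>a\<in>T. head_cell a = (q2, r) \<and> tail_col a = q1" if "r < ?N" for r
  proof -
    have "(q2, r) \<in> cells n" using that q by (simp add: cells_def)
    then obtain a where a: "a \<in> T" "tail_cell a = (q2, r) \<or> head_cell a = (q2, r)"
      using matching_cover[OF M] by (metis (no_types, lifting) Un_iff imageE)
    then show ?thesis using J[OF a(1)] q(4) by auto
  qed
  define arr where "arr r = (SOME a. a \<in> T \<and> head_cell a = (q2, r) \<and> tail_col a = q1)" for r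
  have "arr r \<in> T \<and> head_cell (arr r) = (q2, r) \<and> tail_col (arr r) = q1" if "r < ?N" for r
    unfolding arr_def by (rule someI_ex) (use heads[OF that] in blast)
  then have arr: "arr r \<in> T" "head_cell (arr r) = (q2, r)" "tail_col (arr r) = q1" if "r < ?N" for r
    using that by blast+
  define \<nu> where "\<nu> r = (if r < ?N then tail_row (arr r) else r)" for r
  have row: "tail_row a < ?N" "head_row a < ?N" if "a \<in> T" "tail_col a = q1" for a
  proof -
    have "head_col a = q2" using J[OF that(1)] that(2) by auto
    then show "tail_row a < ?N" "head_row a < ?N"
      using snd_cell_mem[OF matching_cell(1)[OF M that(1)]] snd_cell_mem[OF matching_cell(2)[OF M that(1)]] that(2) q(3)
      by simp_all
  qed
  have inj: "inj_on \<nu> {..<?N}"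
  proof (rule inj_onI)
    fix r s assume rs: "r \<in> {..<?N}" "s \<in> {..<?N}" "\<nu> r = \<nu> s"
    then have "tail_cell (arr r) = tail_cell (arr s)"
      using arr[of r] arr[of s] by (simp add: \<nu>_def prod_eq_iff)
    then have "arr r = arr s"
      by (rule inj_onD[OF inj_on_tail_cell[OF M]]) (use arr(1) rs in simp_all)
    then have "head_cell (arr r) = head_cell (arr s)" by simp
    then show "r = s" using rs(1,2) by (simp add: arr(2))
  qed
  have "\<nu> ` {..<?N} \<subseteq> {..<?N}" using row(1)[OF arr(1) arr(3)] by (auto simp: \<nu>_def)
  then have "\<nu> permutes {..<?N}"
    using inj endo_inj_surj[of "{..<?N}" \<nu>] by (intro bij_imp_permutes) (auto simp: bij_betw_def \<nu>_def)
  moreover have "\<nu> (head_row a) = tail_row a" if a: "a \<in> T" "tail_col a = q1" for a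
  proof -
    have "head_col a = q2" using J[OF a(1)] a(2) by auto
    then have "head_cell a = head_cell (arr (head_row a))"
      using arr(2)[OF row(2)[OF a]] by (simp add: prod_eq_iff)
    then have "a = arr (head_row a)"
      by (rule inj_onD[OF inj_on_head_cell[OF M] _ a(1) arr(1)[OF row(2)[OF a]]])
    then show ?thesis using row(2)[OF a] by (simp add: \<nu>_def)
  qed
  ultimately show thesis using that tails heads by blast
qed

section \<open>Removal of linked columns\<close>

text \<open>
  The ordering condition in \<open>admissible_perms\<close> forces the identity on the first column of a link,
  so the two linked columns contribute a sign only.
\<close>

lemma bpf_fam_remove_link:
  fixes M :: "nat \<Rightarrow> 'a::comm_ring_1 mat" and cs ct :: "nat \<Rightarrow> nat"
  assumes T: "tableau n T" and q: "q1 < q2" "q2 < length n" "n ! q1 = n ! q2"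
    and sc: "\<And>a. a \<in> T \<Longrightarrow> tail_col a = cs (\<phi> a) \<and> head_col a = ct (\<phi> a)"
    and link: "M i0 = 1\<^sub>m (n ! q1)" "cs i0 = q1" "ct i0 = q2"
    and other: "\<And>a. a \<in> T \<Longrightarrow> \<phi> a \<noteq> i0 \<Longrightarrow> tail_col a \<notin> {q1, q2} \<and> head_col a \<notin> {q1, q2} \<and>
      M (\<phi> a) \<in> carrier_mat (n ! tail_col a) (n ! head_col a) \<and> M (\<phi> a) \<in> W"
  defines "d \<equiv> nths n (- {q1, q2})"
  obtains D \<psi> Y s where "tableau_with_substitution d D \<psi> Y" "set Y \<subseteq> W" "s = 1 \<or> s = - 1"
    "bpf_fam n T \<phi> M = s * bpf d D \<psi> Y"
proof -
  have mt: "matching (cells n) T" using T by (simp add: tableau_iff_matching)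
  note finT = matching_finite[OF mt finite_cells]
  let ?N = "n ! q1"
  have q1: "q1 < length n" using q by simp
  have lk: "tail_col a = q1 \<and> head_col a = q2" if "a \<in> T" "\<phi> a = i0" for a
    using sc[OF that(1)] that(2) link by simp
  have ne: "q1 \<noteq> q2" using q by simp
  have cols: "(tail_col a = q1 \<and> head_col a = q2) \<or> (tail_col a \<notin> {q1, q2} \<and> head_col a \<notin> {q1, q2})"
    if "a \<in> T" for a
    using lk[OF that] other[OF that] by blast
  obtain \<nu> where \<nu>: "\<nu> permutes {..<?N}"
    and \<nu>_arrow: "\<And>a. a \<in> T \<Longrightarrow> tail_col a = q1 \<Longrightarrow> \<nu> (head_row a) = tail_row a"
    and tails: "\<And>r. r < ?N \<Longrightarrow> \<exists>a\<in>T. tail_cell a = (q1, r) \<and> head_col a = q2"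
    and heads: "\<And>r. r < ?N \<Longrightarrow> \<exists>a\<in>T. head_cell a = (q2, r) \<and> tail_col a = q1"
    by (rule link_columns_permutation[OF T q1 q(2,3) ne cols]) (assumption | rule that; assumption)+
  define K where "K = {..<length n} - {q1, q2}"
  obtain e where e: "bij_betw e {..<length d} K" and de: "\<And>i. i < length d \<Longrightarrow> d ! i = n ! e i"
  proof (rule nths_conv_nth[of n "- {q1, q2}"])
    fix e assume "bij_betw e {..<length (nths n (- {q1, q2}))} {i. i < length n \<and> i \<in> - {q1, q2}}"
      "\<And>i. i < length (nths n (- {q1, q2})) \<Longrightarrow> nths n (- {q1, q2}) ! i = n ! e i"
    moreover have "{i. i < length n \<and> i \<in> - {q1, q2}} = K" by (auto simp: K_def)
    ultimately show thesis using that[of e] by (simp add: d_def)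
  qed
  define e' where "e' = inv_into {..<length d} e"
  have ee': "e (e' j) = j" "e' j < length d" if "j \<in> K" for j
    using bij_betw_inv_into_right[OF e that] bij_betw_apply[OF bij_betw_inv_into[OF e] that] by (auto simp: e'_def)
  have e'e: "e' (e i) = i" "e i \<in> K" if "i < length d" for i
    using bij_betw_inv_into_left[OF e] bij_betw_apply[OF e] that by (auto simp: e'_def)
  define TO where "TO = {a \<in> T. \<phi> a \<noteq> i0}"
  have TO: "a \<in> T" "\<phi> a \<noteq> i0" "tail_col a \<in> K" "head_col a \<in> K" "tail_row a < n ! tail_col a" "head_row a < n ! head_col a"
    "M (\<phi> a) \<in> carrier_mat (n ! tail_col a) (n ! head_col a)" "M (\<phi> a) \<in> W" if "a \<in> TO" for a
    using that other[of a] matching_cell[OF mt, of a] fst_cell_mem[of "tail_cell a" n] fst_cell_mem[of "head_cell a" n]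
      snd_cell_mem[of "tail_cell a" n] snd_cell_mem[of "head_cell a" n]
    by (simp_all add: TO_def K_def)
  have finTO: "finite TO" using finT by (simp add: TO_def)
  define \<rho> where "\<rho> a = Arrow (e' (tail_col a), tail_row a) (e' (head_col a), head_row a)" for a
  have \<rho>_sel: "tail_cell (\<rho> a) = (e' (tail_col a), tail_row a)" "head_cell (\<rho> a) = (e' (head_col a), head_row a)" for a
    by (simp_all add: \<rho>_def)
  have inj\<rho>: "inj_on \<rho> TO"
  proof (rule inj_onI)
    fix a b assume ab: "a \<in> TO" "b \<in> TO" "\<rho> a = \<rho> b"
    then have "e' (tail_col a) = e' (tail_col b)" "tail_row a = tail_row b" by (simp_all add: \<rho>_def)
    then have "tail_cell a = tail_cell b" using ee'(1)[OF TO(3)[OF ab(1)]] ee'(1)[OF TO(3)[OF ab(2)]] by (metis prod.collapse)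
    then show "a = b" by (rule inj_onD[OF inj_on_tail_cell[OF mt] _ TO(1)[OF ab(1)] TO(1)[OF ab(2)]])
  qed
  define D where "D = \<rho> ` TO"
  have finI: "finite (\<phi> ` TO)" using finTO by simp
  \<comment> \<open>The labels on the remaining arrows are renumbered 0, ..., m - 1, since a tableau
    with substitution must use every index of its list.\<close>
  define m where "m = card (\<phi> ` TO)"
  obtain h where h: "bij_betw h {..<m} (\<phi> ` TO)"
    using ex_bij_betw_nat_finite[OF finI] by (auto simp: m_def lessThan_atLeast0)
  define h' where "h' = inv_into {..<m} h"
  have hh': "h (h' i) = i" "h' i < m" if "i \<in> \<phi> ` TO" for i
    using bij_betw_inv_into_right[OF h that] bij_betw_apply[OF bij_betw_inv_into[OF h] that] by (auto simp: h'_def)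
  define \<psi> where "\<psi> b = h' (\<phi> (inv_into TO \<rho> b))" for b
  define Y where "Y = map (\<lambda>k. M (h k)) [0..<m]"
  have \<psi>\<rho>: "\<psi> (\<rho> a) = h' (\<phi> a)" if "a \<in> TO" for a
    using inv_into_f_f[OF inj\<rho> that] by (simp add: \<psi>_def)
  have Y\<psi>: "Y ! \<psi> (\<rho> a) = M (\<phi> a)" if "a \<in> TO" for a
    using that hh'[of "\<phi> a"] by (simp add: Y_def \<psi>\<rho>)
  have \<psi>_eq: "\<phi> a = \<phi> b" if "a \<in> TO" "b \<in> TO" "\<psi> (\<rho> a) = \<psi> (\<rho> b)" for a b
  proof -
    have "h (h' (\<phi> a)) = h (h' (\<phi> b))" using that(3) by (simp only: \<psi>\<rho>[OF that(1)] \<psi>\<rho>[OF that(2)])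
    then show ?thesis by (simp only: hh'(1)[OF imageI[OF that(1)]] hh'(1)[OF imageI[OF that(2)]])
  qed
  have mD: "matching (cells d) D"
    unfolding matching_def
  proof (intro conjI ballI)
    fix b assume "b \<in> D"
    then obtain a where a: "a \<in> TO" "b = \<rho> a" by (auto simp: D_def)
    show "tail_cell b \<in> cells d" "head_cell b \<in> cells d"
      using TO(5,6)[OF a(1)] ee'[OF TO(3)[OF a(1)]] ee'[OF TO(4)[OF a(1)]] de
      by (simp_all add: a(2) \<rho>_sel cells_def)
    show "tail_cell b \<noteq> head_cell b"
    proof
      assume "tail_cell b = head_cell b"
      then have "e' (tail_col a) = e' (head_col a)" "tail_row a = head_row a" by (simp_all add: a(2) \<rho>_sel)
      then have "tail_cell a = head_cell a"
        using ee'(1)[OF TO(3)[OF a(1)]] ee'(1)[OF TO(4)[OF a(1)]] by (metis prod.collapse)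
      then show False using matching_tail_neq_head[OF mt TO(1)[OF a(1)] TO(1)[OF a(1)]] by simp
    qed
  next
    fix c assume c: "c \<in> cells d"
    obtain i r where ir: "c = (i, r)" by (cases c)
    then have i: "i < length d" "r < d ! i" using c by (simp_all add: cells_def)
    have "(e i, r) \<in> cells n" using e'e(2)[OF i(1)] i de by (simp add: cells_def K_def)
    then obtain a where a: "a \<in> T" "(e i, r) = tail_cell a \<or> (e i, r) = head_cell a"
      using matching_cover[OF mt] by blast
    have "\<phi> a \<noteq> i0"
    proof
      assume "\<phi> a = i0"
      then have "e i = q1 \<or> e i = q2" using lk[OF a(1)] a(2) by (metis fst_conv)
      then show False using e'e(2)[OF i(1)] by (simp add: K_def)
    qed
    then have aTO: "a \<in> TO" using a(1) by (simp add: TO_def)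
    show "\<exists>!b. b \<in> D \<and> (c = head_cell b \<or> c = tail_cell b)"
    proof (rule ex1I[of _ "\<rho> a"])
      have "c = tail_cell (\<rho> a) \<or> c = head_cell (\<rho> a)"
        using a(2) e'e(1)[OF i(1)] unfolding \<rho>_sel ir by (metis fst_conv snd_conv)
      then show "\<rho> a \<in> D \<and> (c = head_cell (\<rho> a) \<or> c = tail_cell (\<rho> a))"
        using aTO by (auto simp: D_def)
      fix b assume b: "b \<in> D \<and> (c = head_cell b \<or> c = tail_cell b)"
      then obtain a' where a': "a' \<in> TO" "b = \<rho> a'" by (auto simp: D_def)
      have "(e i, r) = tail_cell a' \<or> (e i, r) = head_cell a'"
        using b ee'(1)[OF TO(3)[OF a'(1)]] ee'(1)[OF TO(4)[OF a'(1)]]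
        unfolding a'(2) \<rho>_sel ir by (metis Pair_inject prod.collapse)
      then have "a' = a"
        using matching_unique[OF mt TO(1)[OF a'(1)] a(1)] a(2) by auto
      then show "b = \<rho> a" using a' by simp
    qed
  qed
  have tws: "tableau_with_substitution d D \<psi> Y"
    unfolding tableau_with_substitution_def
  proof (intro conjI ballI impI)
    show "even (sum_list d)" using card_matching[OF mD finite_cells] by (simp add: card_cells)
    show "tableau d D" using mD by (simp add: tableau_iff_matching)
    have "\<psi> ` D = h' ` (\<phi> ` TO)" using \<psi>\<rho> by (auto simp: D_def image_image)
    also have "\<dots> = {..<m}" using bij_betw_imp_surj_on[OF bij_betw_inv_into[OF h]] by (simp add: h'_def)
    finally show "\<psi> ` D = {..<length Y}" by (simp add: Y_def)
  next
    fix b assume "b \<in> D"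
    then obtain a where a: "a \<in> TO" "b = \<rho> a" by (auto simp: D_def)
    show "Y ! \<psi> b \<in> carrier_mat (d ! tail_col b) (d ! head_col b)"
      using TO(7)[OF a(1)] ee'[OF TO(3)[OF a(1)]] ee'[OF TO(4)[OF a(1)]] de
      by (simp add: a(2) Y\<psi>[OF a(1)] \<rho>_sel)
  next
    fix b b' assume "b \<in> D" "b' \<in> D" and eq: "\<psi> b = \<psi> b'"
    then obtain a a' where a: "a \<in> TO" "b = \<rho> a" "a' \<in> TO" "b' = \<rho> a'" by (auto simp: D_def)
    have "\<phi> a = \<phi> a'" using \<psi>_eq[OF a(1,3)] eq a by simp
    then have "tail_col a = tail_col a'" "head_col a = head_col a'"
      using sc[OF TO(1)[OF a(1)]] sc[OF TO(1)[OF a(3)]] by simp_all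
    then show "head_col b = head_col b'" "tail_col b = tail_col b'" by (simp_all add: a \<rho>_sel)
  qed
  have YW: "set Y \<subseteq> W"
  proof
    fix y assume "y \<in> set Y"
    then obtain k where "k < m" "y = M (h k)" by (auto simp: Y_def)
    moreover from this have "h k \<in> \<phi> ` TO" using bij_betw_apply[OF h, of k] by simp
    ultimately show "y \<in> W" using TO(8) by auto
  qed
  let ?F = "\<lambda>\<pi>. (\<Prod>i<length n. of_int (sign (\<pi> i))) *
        (\<Prod>a\<in>T. M (\<phi> a) $$ (\<pi> (tail_col a) (tail_row a), \<pi> (head_col a) (head_row a)))"
  let ?F' = "\<lambda>\<pi>. (\<Prod>i<length d. of_int (sign (\<pi> i))) *
        (\<Prod>b\<in>D. Y ! \<psi> b $$ (\<pi> (tail_col b) (tail_row b), \<pi> (head_col b) (head_row b)))"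
  \<comment> \<open>The only permutations that survive: on q1 the ordering condition leaves the
    identity, after which the unit matrix of the link forces nu on q2.\<close>
  define A0 where "A0 = {\<pi> \<in> admissible_perms n T \<phi>. \<pi> q1 = id \<and> \<pi> q2 = \<nu>}"
  have perm: "\<pi> i permutes {..<n ! i}" if "\<pi> \<in> admissible_perms n T \<phi>" "i < length n" for \<pi> i
    using that by (auto simp: admissible_perms_def PiE_iff)
  have adm_less: "\<pi> (tail_col a) (tail_row a) < \<pi> (tail_col a) (tail_row b)"
    if "\<pi> \<in> admissible_perms n T \<phi>" "a \<in> T" "b \<in> T" "\<phi> a = \<phi> b" "tail_row a < tail_row b" for \<pi> a b
    using that unfolding admissible_perms_def by blast
  have finA: "finite (admissible_perms n T \<phi>)"
  proof (rule finite_subset)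
    show "admissible_perms n T \<phi> \<subseteq> (\<Pi>\<^sub>E i\<in>{..<length n}. {p. p permutes {..<n ! i}})"
      by (auto simp: admissible_perms_def)
    show "finite (\<Pi>\<^sub>E i\<in>{..<length n}. {p. p permutes {..<n ! i}})"
      by (intro finite_PiE finite_permutations) simp_all
  qed
  have zero: "?F \<pi> = 0" if \<pi>: "\<pi> \<in> admissible_perms n T \<phi> - A0" for \<pi>
  proof (rule ccontr)
    assume nz: "?F \<pi> \<noteq> 0"
    have adm: "\<pi> \<in> admissible_perms n T \<phi>" using \<pi> by simp
    have id1: "\<pi> q1 = id"
    proof (rule permutes_strict_mono_imp_id[OF perm[OF adm q1]])
      fix r s assume rs: "r < s" "s < ?N"
      then obtain a b where ab: "a \<in> T" "tail_cell a = (q1, r)" "b \<in> T" "tail_cell b = (q1, s)"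
        using tails[of r] tails[of s] by auto
      \<comment> \<open>All arrows that start in q1 carry the label i0, so the ordering condition
        compares every pair of cells of this column.\<close>
      have "\<phi> a = i0" "\<phi> b = i0" using other[OF ab(1)] other[OF ab(3)] ab by auto
      then show "\<pi> q1 r < \<pi> q1 s"
        using adm_less[OF adm ab(1,3)] ab rs by simp
    qed
    have "\<pi> q2 r = \<nu> r" for r
    proof (cases "r < ?N")
      case True
      then obtain a where a: "a \<in> T" "head_cell a = (q2, r)" "tail_col a = q1" using heads by blast
      have \<phi>a: "\<phi> a = i0" using other[OF a(1)] a by auto
      have entry: "M (\<phi> a) $$ (\<pi> (tail_col a) (tail_row a), \<pi> (head_col a) (head_row a)) \<noteq> 0"
      proof
        assume "M (\<phi> a) $$ (\<pi> (tail_col a) (tail_row a), \<pi> (head_col a) (head_row a)) = 0"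
        then have "(\<Prod>a\<in>T. M (\<phi> a) $$ (\<pi> (tail_col a) (tail_row a), \<pi> (head_col a) (head_row a))) = 0"
          by (intro prod_zero[OF finT] bexI[OF _ a(1)])
        then show False using nz by simp
      qed
      have "tail_row a < ?N" using snd_cell_mem[OF matching_cell(1)[OF mt a(1)]] a(3) by simp
      moreover have "\<pi> q2 r < ?N"
        using permutes_in_image[OF perm[OF adm q(2)], of r] True q(3) by simp
      ultimately have "tail_row a = \<pi> q2 r"
        using entry by (auto simp: \<phi>a link a id1 split: if_splits)
      then show ?thesis using \<nu>_arrow[OF a(1,3)] a(2) by simp
    next
      case False
      then have "r \<notin> {..<n ! q1}" "r \<notin> {..<n ! q2}" using q(3) by simp_all
      then show ?thesis using permutes_not_in[OF \<nu>, of r] permutes_not_in[OF perm[OF adm q(2)], of r] by simp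
    qed
    then have "\<pi> q2 = \<nu>" by (simp add: fun_eq_iff)
    then show False using \<pi> id1 by (simp add: A0_def)
  qed
  \<comment> \<open>On these permutations the entries at the link are all 1, and the linked columns
    contribute the sign of nu.\<close>
  have sumA0: "(\<Sum>\<pi>\<in>A0. ?F \<pi>) = (\<Sum>\<pi>\<in>admissible_perms d D \<psi>. of_int (sign \<nu>) * ?F' \<pi>)"
  proof (rule sum.reindex_bij_witness[of _
        "\<lambda>\<pi>. restrict (\<lambda>j. if j = q1 then id else if j = q2 then \<nu> else \<pi> (e' j)) {..<length n}"
        "\<lambda>\<pi>. restrict (\<lambda>i. \<pi> (e i)) {..<length d}"])
    fix \<pi> assume \<pi>: "\<pi> \<in> A0"
    let ?j = "restrict (\<lambda>i. \<pi> (e i)) {..<length d}"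
    have adm: "\<pi> \<in> admissible_perms n T \<phi>" and \<pi>q: "\<pi> q1 = id" "\<pi> q2 = \<nu>" using \<pi> by (auto simp: A0_def)
    have ext: "\<pi> j = undefined" if "\<not> j < length n" for j
      using adm that by (auto simp: admissible_perms_def PiE_iff extensional_def)
    show "restrict (\<lambda>j. if j = q1 then id else if j = q2 then \<nu> else ?j (e' j)) {..<length n} = \<pi>"
    proof
      fix j
      show "restrict (\<lambda>j. if j = q1 then id else if j = q2 then \<nu> else ?j (e' j)) {..<length n} j = \<pi> j"
        using ee'[of j] \<pi>q ext[of j] by (auto simp: K_def)
    qed
    have jv: "?j (e' j) = \<pi> j" if "j \<in> K" for j
      using ee'[OF that] by simp
    show "?j \<in> admissible_perms d D \<psi>"
      unfolding admissible_perms_def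
    proof (intro CollectI conjI ballI impI)
      show "?j \<in> (\<Pi>\<^sub>E i\<in>{..<length d}. {p. p permutes {..<d ! i}})"
        using perm[OF adm] e'e(2) de by (auto simp: K_def)
      fix b b' assume "b \<in> D" "b' \<in> D" and eq: "\<psi> b = \<psi> b' \<and> tail_row b < tail_row b'"
      then obtain a a' where a: "a \<in> TO" "b = \<rho> a" "a' \<in> TO" "b' = \<rho> a'" by (auto simp: D_def)
      have "\<phi> a = \<phi> a'" using \<psi>_eq[OF a(1,3)] eq a by simp
      moreover have "tail_row a < tail_row a'" using eq by (simp add: a \<rho>_sel)
      ultimately have "\<pi> (tail_col a) (tail_row a) < \<pi> (tail_col a) (tail_row a')"
        by (rule adm_less[OF adm TO(1)[OF a(1)] TO(1)[OF a(3)]])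
      then show "?j (tail_col b) (tail_row b) < ?j (tail_col b) (tail_row b')"
        using jv[OF TO(3)[OF a(1)]] by (simp add: a \<rho>_sel)
    qed
    have "(\<Prod>i<length n. of_int (sign (\<pi> i))) = (of_int (sign \<nu>) * (\<Prod>i<length d. of_int (sign (?j i))) :: 'a)"
    proof -
      have "{..<length n} = insert q1 (insert q2 K)" using q by (auto simp: K_def)
      moreover have "finite K" "q1 \<notin> insert q2 K" "q2 \<notin> K" using q by (auto simp: K_def)
      ultimately have "(\<Prod>i<length n. of_int (sign (\<pi> i))) = (of_int (sign \<nu>) * (\<Prod>i\<in>K. of_int (sign (\<pi> i))) :: 'a)"
        by (simp add: \<pi>q)
      also have "(\<Prod>i\<in>K. of_int (sign (\<pi> i))) = (\<Prod>i<length d. of_int (sign (\<pi> (e i))) :: 'a)"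
        by (rule prod.reindex_bij_betw[OF e, symmetric])
      finally show ?thesis by simp
    qed
    moreover have "(\<Prod>a\<in>T. M (\<phi> a) $$ (\<pi> (tail_col a) (tail_row a), \<pi> (head_col a) (head_row a))) =
      (\<Prod>b\<in>D. Y ! \<psi> b $$ (?j (tail_col b) (tail_row b), ?j (head_col b) (head_row b)))"
    proof -
      have "(\<Prod>a\<in>T. M (\<phi> a) $$ (\<pi> (tail_col a) (tail_row a), \<pi> (head_col a) (head_row a))) =
        (\<Prod>a\<in>TO. M (\<phi> a) $$ (\<pi> (tail_col a) (tail_row a), \<pi> (head_col a) (head_row a)))"
      proof (rule prod.mono_neutral_right[OF finT])
        show "TO \<subseteq> T" by (auto simp: TO_def)
        show "\<forall>a\<in>T - TO. M (\<phi> a) $$ (\<pi> (tail_col a) (tail_row a), \<pi> (head_col a) (head_row a)) = 1"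
        proof
          fix a assume "a \<in> T - TO"
          then have a: "a \<in> T" "\<phi> a = i0" by (auto simp: TO_def)
          have "tail_row a < ?N" using snd_cell_mem[OF matching_cell(1)[OF mt a(1)]] lk[OF a] by simp
          moreover have "\<nu> (head_row a) = tail_row a" using \<nu>_arrow[OF a(1)] lk[OF a] by simp
          ultimately show "M (\<phi> a) $$ (\<pi> (tail_col a) (tail_row a), \<pi> (head_col a) (head_row a)) = 1"
            using lk[OF a] by (simp add: a link \<pi>q)
        qed
      qed
      also have "\<dots> = (\<Prod>a\<in>TO. Y ! \<psi> (\<rho> a) $$ (?j (tail_col (\<rho> a)) (tail_row (\<rho> a)), ?j (head_col (\<rho> a)) (head_row (\<rho> a))))"
      proof (rule prod.cong[OF refl])
        fix a assume a: "a \<in> TO"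
        show "M (\<phi> a) $$ (\<pi> (tail_col a) (tail_row a), \<pi> (head_col a) (head_row a)) =
          Y ! \<psi> (\<rho> a) $$ (?j (tail_col (\<rho> a)) (tail_row (\<rho> a)), ?j (head_col (\<rho> a)) (head_row (\<rho> a)))"
          using jv[OF TO(3)[OF a]] jv[OF TO(4)[OF a]] by (simp add: Y\<psi>[OF a] \<rho>_sel)
      qed
      also have "\<dots> = (\<Prod>b\<in>D. Y ! \<psi> b $$ (?j (tail_col b) (tail_row b), ?j (head_col b) (head_row b)))"
        unfolding D_def by (subst prod.reindex[OF inj\<rho>]) simp
      finally show ?thesis .
    qed
    ultimately show "of_int (sign \<nu>) * ?F' ?j = ?F \<pi>" by (simp only: mult.assoc)
  next
    fix \<pi> assume \<pi>: "\<pi> \<in> admissible_perms d D \<psi>"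
    let ?i = "restrict (\<lambda>j. if j = q1 then id else if j = q2 then \<nu> else \<pi> (e' j)) {..<length n}"
    have iv: "?i j = \<pi> (e' j)" if "j \<in> K" for j using that by (simp add: K_def)
    have iq: "?i q1 = id" "?i q2 = \<nu>" using q by simp_all
    have permd: "\<pi> i permutes {..<d ! i}" if "i < length d" for i
      using \<pi> that by (auto simp: admissible_perms_def PiE_iff)
    show "restrict (\<lambda>i. ?i (e i)) {..<length d} = \<pi>"
    proof
      fix i
      have "\<pi> i = undefined" if "\<not> i < length d"
        using \<pi> that by (auto simp: admissible_perms_def PiE_iff extensional_def)
      then show "restrict (\<lambda>i. ?i (e i)) {..<length d} i = \<pi> i"
        using iv[OF e'e(2)] e'e(1) by (cases "i < length d") simp_all
    qed
    have "?i \<in> admissible_perms n T \<phi>"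
      unfolding admissible_perms_def
    proof (intro CollectI conjI ballI impI)
      show "?i \<in> (\<Pi>\<^sub>E i\<in>{..<length n}. {p. p permutes {..<n ! i}})"
      proof (rule PiE_I)
        fix j assume "j \<in> {..<length n}"
        then consider "j = q1" | "j = q2" | "j \<in> K" by (auto simp: K_def)
        then show "?i j \<in> {p. p permutes {..<n ! j}}"
        proof cases
          case 1
          then show ?thesis using iq permutes_id by simp
        next
          case 2
          then show ?thesis using iq \<nu> q(3) by simp
        next
          case 3
          then show ?thesis using iv[OF 3] permd[OF ee'(2)[OF 3]] ee'[OF 3] de by simp
        qed
      qed simp
      fix a b assume ab: "a \<in> T" "b \<in> T" and eq: "\<phi> a = \<phi> b \<and> tail_row a < tail_row b"
      show "?i (tail_col a) (tail_row a) < ?i (tail_col a) (tail_row b)"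
      proof (cases "\<phi> a = i0")
        case True
        then show ?thesis using lk[OF ab(1)] eq iq by simp
      next
        case False
        then have TOab: "a \<in> TO" "b \<in> TO" using ab eq by (simp_all add: TO_def)
        have "\<psi> (\<rho> a) = \<psi> (\<rho> b)" "tail_row (\<rho> a) < tail_row (\<rho> b)" "\<rho> a \<in> D" "\<rho> b \<in> D"
          using eq TOab by (simp_all add: \<psi>\<rho> \<rho>_sel D_def)
        then have "\<pi> (tail_col (\<rho> a)) (tail_row (\<rho> a)) < \<pi> (tail_col (\<rho> a)) (tail_row (\<rho> b))"
          using \<pi> unfolding admissible_perms_def by blast
        then show ?thesis using iv[OF TO(3)[OF TOab(1)]] by (simp add: \<rho>_sel)
      qed
    qed
    then show "?i \<in> A0" using iq by (simp add: A0_def)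
  qed
  have "bpf_fam n T \<phi> M = (\<Sum>\<pi>\<in>A0. ?F \<pi>)"
    unfolding bpf_fam_def
    by (rule sum.mono_neutral_right[OF finA]) (use zero in \<open>auto simp: A0_def\<close>)
  also have "\<dots> = of_int (sign \<nu>) * bpf d D \<psi> Y"
    unfolding sumA0 bpf_def by (rule sum_distrib_left[symmetric])
  finally show thesis
    using that[OF tws YW, of "of_int (sign \<nu>)"] by (simp add: sign_def)
qed

section \<open>Induction on the weights of the letters at the linked columns\<close>

lemma eliminate_append:
  obtains N where "eliminate u q l Ls = Ls @ N"
    "\<And>m. m \<in> set N \<Longrightarrow> (\<exists>m'\<in>set (l # Ls). src m' = q \<and> m = pre u l m') \<or>
      (\<exists>m'\<in>set Ls. tgt m' = q \<and> m = post u l m') \<or>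
      (\<exists>m'\<in>set (l # Ls). src m' = q \<and> tgt m' = q \<and> m = post u l (pre u l m'))"
proof -
  let ?N = "map (pre u l) (filter (\<lambda>m. src m = q) (l # Ls))"
  let ?N' = "map (post u l) (filter (\<lambda>m. tgt m = q) (Ls @ ?N))"
  show thesis
  proof (rule that[of "?N @ ?N'"])
    show "eliminate u q l Ls = Ls @ ?N @ ?N'" by (simp only: eliminate_def Let_def append_assoc)
    fix m assume "m \<in> set (?N @ ?N')"
    then have "m \<in> pre u l ` {m \<in> set (l # Ls). src m = q} \<union>
      post u l ` {m \<in> set Ls \<union> pre u l ` {m \<in> set (l # Ls). src m = q}. tgt m = q}"
      by (simp only: set_append set_map set_filter)
    then show "(\<exists>m'\<in>set (l # Ls). src m' = q \<and> m = pre u l m') \<or>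
      (\<exists>m'\<in>set Ls. tgt m' = q \<and> m = post u l m') \<or>
      (\<exists>m'\<in>set (l # Ls). src m' = q \<and> tgt m' = q \<and> m = post u l (pre u l m'))"
      by (auto simp del: list.set)
  qed
qed

lemma gen_subring_prod: "(\<And>i. i \<in> I \<Longrightarrow> f i \<in> gen_subring G) \<Longrightarrow> prod f I \<in> gen_subring G"
  by (induction I rule: infinite_finite_induct) (auto intro: gen_subring.one gen_subring.mult)

lemma flip_link: "n ! q = n ! q' \<Longrightarrow> flip (link n q q' \<epsilon>) = link n q' q (- \<epsilon>)"
  by (simp add: flip_def link_def)

text \<open>The invariant of the elimination. Weight at least 1 makes a product strictly heavier
  than each of its factors.\<close>

definition valid_letter :: "nat list \<Rightarrow> 'a mat set \<Rightarrow> 'a::comm_ring_1 letter \<Rightarrow> bool" where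
  "valid_letter n W l \<longleftrightarrow> wf_letter n l \<and> lmat l \<in> W \<and> (sg l = 1 \<or> sg l = - 1) \<and> wt l \<ge> 1"

lemma pm_one_mult: "s = 1 \<or> s = - 1 \<Longrightarrow> t = 1 \<or> t = - 1 \<Longrightarrow> s * t = 1 \<or> s * t = (- 1 :: 'a::comm_ring_1)"
  by auto

context
  fixes n :: "nat list" and T :: "arrow set" and q1 q2 :: nat
    and W :: "'a::{idom,ring_char_0} mat set" and G :: "'a set" and D :: nat
  assumes T: "tableau n T" and q: "q1 < q2" "q2 < length n" "n ! q1 = n ! q2"
    and W_mult: "\<And>A B. A \<in> W \<Longrightarrow> B \<in> W \<Longrightarrow> dim_col A = dim_row B \<Longrightarrow> A * B \<in> W"
    and W_transpose: "\<And>A. A \<in> W \<Longrightarrow> transpose_mat A \<in> W"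
    and G_bpf: "\<And>D \<psi> Y. tableau_with_substitution (nths n (- {q1, q2})) D \<psi> Y \<Longrightarrow> set Y \<subseteq> W \<Longrightarrow>
      bpf (nths n (- {q1, q2})) D \<psi> Y \<in> G"
    and G_sigma: "\<And>k h. k \<in> {1..n ! q1} \<Longrightarrow> h \<in> W \<Longrightarrow> square_mat h \<Longrightarrow> sigma k h \<in> G"
begin

abbreviation touches :: "'a letter \<Rightarrow> bool" where
  "touches l \<equiv> src l \<in> {q1, q2} \<or> tgt l \<in> {q1, q2}"

text \<open>A labelling that uses a touching letter of Ls has weight above D. In every other
  labelling the columns q1 and q2 are met by the link alone, so the orbit sum is zero or, up to
  sign, |T|! times a bpf from which these two columns can be removed.\<close>

lemma good_without_touching_letters:
  assumes Ls: "\<And>l. l \<in> set Ls \<Longrightarrow> valid_letter n W l"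
    and high: "\<And>l. l \<in> set Ls \<Longrightarrow> touches l \<Longrightarrow> wt l > D"
  shows "good (fact (card T)) D (gen_subring G) (pf_sum (cells n) T (\<lambda>_. form (link n q1 q2 1 # Ls)))"
proof (rule good_pf_sum_form[OF T])
  let ?Lt = "link n q1 q2 (1::'a) # Ls"
  fix f assume f: "f \<in> T \<rightarrow>\<^sub>E {..<length ?Lt}"
  have mt: "matching (cells n) T" using T by (simp add: tableau_iff_matching)
  note finT = matching_finite[OF mt finite_cells]
  let ?s = "\<Prod>a\<in>T. sg (?Lt ! f a)" and ?w = "\<Sum>a\<in>T. wt (?Lt ! f a)"
  let ?S = "\<Sum>g\<in>orbit_of T {..<length ?Lt} f. placed_sum n T ?Lt g"
  have mem: "?Lt ! f a \<in> set Ls" if "a \<in> T" "f a \<noteq> 0" for a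
    using PiE_mem[OF f that(1)] that(2) by (cases "f a") auto
  have s: "?s \<in> gen_subring G"
  proof (rule gen_subring_prod)
    fix a assume a: "a \<in> T"
    show "sg (?Lt ! f a) \<in> gen_subring G"
    proof (cases "f a = 0")
      case True
      then show ?thesis by (simp add: gen_subring.one)
    next
      case False
      then show ?thesis using Ls[OF mem[OF a False]] gen_subring_pm_one by (auto simp: valid_letter_def)
    qed
  qed
  show "good (fact (card T)) D (gen_subring G) (monom (?s * ?S) ?w)"
  proof (cases "\<exists>a\<in>T. f a \<noteq> 0 \<and> touches (?Lt ! f a)")
    case True
    then obtain a where a: "a \<in> T" "f a \<noteq> 0" "touches (?Lt ! f a)" by blast
    have "D < wt (?Lt ! f a)" by (rule high[OF mem[OF a(1,2)] a(3)])
    also have "\<dots> \<le> ?w" by (rule member_le_sum[OF a(1) _ finT]) simp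
    finally have "D < ?w" .
    then show ?thesis by (auto simp: good_def gen_subring_zero intro!: bexI[of _ 0])
  next
    case False
    then have away: "\<not> touches (?Lt ! f a)" if "a \<in> T" "f a \<noteq> 0" for a using that by blast
    show ?thesis
    proof (rule orbit_sum_cases[OF T finite_lessThan f, of "\<lambda>i. src (?Lt ! i)" "\<lambda>i. tgt (?Lt ! i)" "\<lambda>i. lmat (?Lt ! i)"])
      assume "(\<Sum>g\<in>orbit_of T {..<length ?Lt} f. pf_sum (cells n) T
        (\<lambda>a. blk (src (?Lt ! g a)) (tgt (?Lt ! g a)) (lmat (?Lt ! g a)))) = 0"
      then have "?S = 0" by (simp only: placed_sum_def)
      then show ?thesis by (simp only: mult_zero_right monom_0[symmetric] monom_eq_0 good_zero)
    next
      fix T' \<phi>' and s :: 'a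
      assume T': "tableau n T'" and s': "s = 1 \<or> s = - 1" and im: "\<phi>' ` T' = f ` T"
        and cols: "\<And>b. b \<in> T' \<Longrightarrow> tail_col b = src (?Lt ! \<phi>' b) \<and> head_col b = tgt (?Lt ! \<phi>' b)"
        and S: "(\<Sum>g\<in>orbit_of T {..<length ?Lt} f. pf_sum (cells n) T
            (\<lambda>a. blk (src (?Lt ! g a)) (tgt (?Lt ! g a)) (lmat (?Lt ! g a)))) =
          s * (of_nat (fact (card T)) * bpf_fam n T' \<phi>' (\<lambda>i. lmat (?Lt ! i)))"
      have other: "tail_col b \<notin> {q1, q2} \<and> head_col b \<notin> {q1, q2} \<and>
          lmat (?Lt ! \<phi>' b) \<in> carrier_mat (n ! tail_col b) (n ! head_col b) \<and> lmat (?Lt ! \<phi>' b) \<in> W"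
        if b: "b \<in> T'" "\<phi>' b \<noteq> 0" for b
      proof -
        have "\<phi>' b \<in> f ` T" using im b(1) by blast
        then obtain a where a: "a \<in> T" "\<phi>' b = f a" by blast
        have "valid_letter n W (?Lt ! \<phi>' b)" using Ls[OF mem[OF a(1)]] a(2) b(2) by simp
        moreover have "\<not> touches (?Lt ! \<phi>' b)" using away[OF a(1)] a(2) b(2) by simp
        ultimately show ?thesis unfolding cols[OF b(1), THEN conjunct1] cols[OF b(1), THEN conjunct2]
          by (simp add: valid_letter_def wf_letter_def)
      qed
      obtain D' \<psi> Y s2 where D': "tableau_with_substitution (nths n (- {q1, q2})) D' \<psi> Y" "set Y \<subseteq> W"
          "s2 = 1 \<or> s2 = - 1" "bpf_fam n T' \<phi>' (\<lambda>i. lmat (?Lt ! i)) = s2 * bpf (nths n (- {q1, q2})) D' \<psi> Y"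
        by (rule bpf_fam_remove_link[where cs = "\<lambda>i. src (?Lt ! i)" and ct = "\<lambda>i. tgt (?Lt ! i)"
              and M = "\<lambda>i. lmat (?Lt ! i)" and \<phi> = \<phi>' and ?i0.0 = 0 and W = W, OF T' q cols _ _ _ other])
           simp_all
      let ?b = "bpf (nths n (- {q1, q2})) D' \<psi> Y"
      have "?s * (s * (s2 * ?b)) \<in> gen_subring G"
        using s gen_subring_pm_one[OF s'] gen_subring_pm_one[OF D'(3)] gen_subring.gen[OF G_bpf[OF D'(1,2)]]
        by (intro gen_subring.mult)
      moreover have "?S = s * (of_nat (fact (card T)) * (s2 * ?b))"
        unfolding placed_sum_def using S D'(4) by simp
      then have "?s * ?S = of_nat (fact (card T)) * (?s * (s * (s2 * ?b)))" by (simp only: mult_ac)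
      ultimately show ?thesis
        unfolding good_def coeff_monom by (metis gen_subring_zero mult_zero_right)
    qed
  qed
qed

text \<open>The determinant of the congruence is a unit for \<open>good_cancel_unit\<close>, so it
  suffices to treat the list after the elimination. The hypothesis \<open>elim\<close> speaks of
  arbitrary heavier valid letters N, which spares the induction from knowing the letters that are
  created.\<close>

lemma good_by_elimination:
  assumes Ls: "\<And>m. m \<in> set (l # Ls) \<Longrightarrow> valid_letter n W m"
    and q: "p < length n" "p' < length n" "n ! p = n ! q1" "n ! p' = n ! q1" "p \<noteq> p'"
    and l: "tgt l = p'" and \<epsilon>: "\<epsilon> = 1 \<or> \<epsilon> = - 1"
    and elim: "\<And>N. (\<And>m. m \<in> set N \<Longrightarrow> valid_letter n W m \<and> wt m > wt l) \<Longrightarrow>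
      good M D (gen_subring G) (pf_sum (cells n) T (\<lambda>_. form (link n p p' \<epsilon> # Ls @ N)))"
  shows "good M D (gen_subring G) (pf_sum (cells n) T (\<lambda>_. form (link n p p' \<epsilon> # l # Ls)))"
proof -
  define u where "u = - (\<epsilon> * sg l)"
  have lv: "valid_letter n W l" and wfl: "wf_letter n l" using Ls by (auto simp: valid_letter_def)
  have pp': "n ! p = n ! p'" using q by simp
  have u: "u = 1 \<or> u = - 1" using \<epsilon> lv by (auto simp: u_def valid_letter_def)
  have pre: "valid_letter n W (pre u l m) \<and> wt (pre u l m) > wt l" if "valid_letter n W m" "src m = p" for m
  proof -
    have "n ! tgt l = n ! src m" using that l pp' by simp
    moreover have "dim_col (lmat l) = dim_row (lmat m)"
      using wfl that l pp' by (auto simp: valid_letter_def wf_letter_def)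
    ultimately show ?thesis
      using wf_pre[OF wfl, of m] W_mult[of "lmat l" "lmat m"] pm_one_mult[OF u, of "sg m"] lv that
      by (auto simp: valid_letter_def)
  qed
  have post: "valid_letter n W (post u l m) \<and> wt (post u l m) > wt l" if "valid_letter n W m" "tgt m = p" for m
  proof -
    have "n ! tgt l = n ! tgt m" using that l pp' by simp
    moreover have "dim_col (lmat m) = dim_row (transpose_mat (lmat l))"
      using wfl that l pp' by (auto simp: valid_letter_def wf_letter_def)
    ultimately show ?thesis
      using wf_post[OF wfl, of m] W_mult[of "lmat m" "transpose_mat (lmat l)"] W_transpose[of "lmat l"]
        pm_one_mult[OF u, of "sg m"] lv that
      by (auto simp: valid_letter_def)
  qed
  obtain N where N: "eliminate u p l Ls = Ls @ N"
    and N_cases: "\<And>m. m \<in> set N \<Longrightarrow> (\<exists>m'\<in>set (l # Ls). src m' = p \<and> m = pre u l m') \<or>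
      (\<exists>m'\<in>set Ls. tgt m' = p \<and> m = post u l m') \<or>
      (\<exists>m'\<in>set (l # Ls). src m' = p \<and> tgt m' = p \<and> m = post u l (pre u l m'))"
    using eliminate_append[of u p l Ls] by blast
  have "valid_letter n W m \<and> wt m > wt l" if "m \<in> set N" for m
    using N_cases[OF that]
  proof (elim disjE bexE conjE)
    fix m' assume "m' \<in> set (l # Ls)" "src m' = p" "m = pre u l m'"
    then show ?thesis using pre[OF Ls] by simp
  next
    fix m' assume "m' \<in> set Ls" "tgt m' = p" "m = post u l m'"
    then show ?thesis using post[OF Ls] by simp
  next
    fix m' assume m': "m' \<in> set (l # Ls)" "src m' = p" "tgt m' = p" "m = post u l (pre u l m')"
    then have "valid_letter n W (pre u l m')" "tgt (pre u l m') = p" using pre[OF Ls] by auto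
    then show ?thesis unfolding m'(4) by (rule post)
  qed
  then have "good M D (gen_subring G) (pf_sum (cells n) T (\<lambda>_. form (link n p p' \<epsilon> # eliminate u p l Ls)))"
    unfolding N by (rule elim)
  moreover have "\<epsilon> * \<epsilon> = 1" using \<epsilon> by auto
  moreover have "wf_letter n m" if "m \<in> set Ls" for m using Ls that by (simp add: valid_letter_def)
  ultimately have "good M D (gen_subring G) (det_on (cells n) (\<lambda>c d. (if c = d then 1 else 0) + step_mat u l p c d) *
    pf_sum (cells n) T (\<lambda>_. form (link n p p' \<epsilon> # l # Ls)))"
    using pf_sum_eliminate[OF T wfl l q(1,2) pp' q(5)] by (simp only: u_def)
  moreover have \<sigma>: "sigma k Y \<in> gen_subring G"
    if "k \<in> {1..n ! p}" "Y = lmat l" "Y \<in> carrier_mat (n ! p) (n ! p)" for k Y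
    using that lv q by (intro gen_subring.gen G_sigma) (auto simp: valid_letter_def)
  moreover have "wt l \<ge> 1" using lv by (simp add: valid_letter_def)
  ultimately show ?thesis
    using good_cancel_unit det_on_step[OF wfl l q(1) pp' \<sigma> u] by blast
qed

text \<open>Two inductions. The inner one removes the touching letters of weight e one by one; an
  elimination adds only heavier letters, so their number drops. The outer one then raises the lower
  bound e. Its variable k limits the number of rounds: at k = 0 all touching letters are heavier
  than D.\<close>

lemma good_by_weight:
  assumes "\<And>l. l \<in> set Ls \<Longrightarrow> valid_letter n W l"
    and "\<And>l. l \<in> set Ls \<Longrightarrow> touches l \<Longrightarrow> wt l \<ge> e" and "D < e + k"
  shows "good (fact (card T)) D (gen_subring G) (pf_sum (cells n) T (\<lambda>_. form (link n q1 q2 1 # Ls)))"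
  using assms
proof (induction k arbitrary: e Ls)
  case 0
  then show ?case by (intro good_without_touching_letters) fastforce+
next
  case (Suc k)
  let ?P = "\<lambda>l. touches l \<and> wt l = e"
  let ?good = "\<lambda>Ls. good (fact (card T)) D (gen_subring G) (pf_sum (cells n) T (\<lambda>_. form Ls))"
  have "(\<And>l. l \<in> set Ls \<Longrightarrow> valid_letter n W l \<and> (touches l \<longrightarrow> wt l \<ge> e)) \<Longrightarrow>
    length (filter ?P Ls) = c \<Longrightarrow> ?good (link n q1 q2 1 # Ls)" for c Ls
  proof (induction c arbitrary: Ls)
    case 0
    then have none: "\<not> ?P l" if "l \<in> set Ls" for l
      using that by (simp add: filter_empty_conv)
    show ?case
    proof (rule Suc.IH[of _ "Suc e"])
      show "valid_letter n W l" if "l \<in> set Ls" for l using 0 that by blast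
      show "Suc e \<le> wt l" if "l \<in> set Ls" "touches l" for l
        using 0(1)[OF that(1)] none[OF that(1)] that(2) by (metis Suc_leI le_neq_implies_less)
      show "D < Suc e + k" using Suc.prems by simp
    qed
  next
    case (Suc c)
    have "filter ?P Ls \<noteq> []" using Suc.prems(2) by auto
    then obtain l where l: "l \<in> set Ls" "?P l" unfolding filter_empty_conv by blast
    then obtain xs ys where Ls: "Ls = xs @ l # ys" using split_list[OF l(1)] by blast
    define R where "R = xs @ ys"
    have R: "valid_letter n W m \<and> (touches m \<longrightarrow> wt m \<ge> e)" if "m \<in> set R" for m
      using Suc.prems(1)[of m] that by (auto simp: R_def Ls)
    have lv: "valid_letter n W l" using Suc.prems(1) l(1) by blast
    have lenR: "length (filter ?P R) = c"
      using Suc.prems(2) l(2) by (simp add: R_def Ls)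
    have new: "?good (link n q1 q2 1 # R @ N)"
      if N: "\<And>m. m \<in> set N \<Longrightarrow> valid_letter n W m \<and> wt m > e" for N
    proof (rule Suc.IH)
      show "valid_letter n W m \<and> (touches m \<longrightarrow> wt m \<ge> e)" if "m \<in> set (R @ N)" for m
        using that R[of m] N[of m] by (auto simp del: insert_iff)
      have "filter ?P N = []" using N by (auto simp: filter_empty_conv)
      then show "length (filter ?P (R @ N)) = c" using lenR by simp
    qed
    have flipl: "valid_letter n W (flip l)"
      using lv wf_flip[of n l] W_transpose by (auto simp: valid_letter_def)
    have q': "q1 < length n" "n ! q2 = n ! q1" "q1 \<noteq> q2" using q by simp_all
    have wfJ: "wf_letter n (link n q1 q2 1)" by (rule wf_link[OF q'(1) q(2,3)])
    \<comment> \<open>Flipping the link exchanges q1 and q2 and negates its sign; for this reason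
      the elimination admits both values of \<epsilon>.\<close>
    have flipJ: "pf_sum (cells n) T (\<lambda>_. form (link n q2 q1 (- 1) # L)) = pf_sum (cells n) T (\<lambda>_. form (link n q1 q2 1 # L))" for L :: "'a letter list"
      using pf_sum_flip[OF T wfJ, of L] by (simp only: flip_link[OF q(3)])
    have swap: "pf_sum (cells n) T (\<lambda>_. form (m # flip l # R)) = pf_sum (cells n) T (\<lambda>_. form (m # l # R))" for m
    proof -
      have sw: "form (m # x # R) = form (x # m # R)" for x by (rule form_mset) simp
      show ?thesis unfolding sw using pf_sum_flip[OF T, of l "m # R"] lv by (simp add: valid_letter_def)
    qed
    have wtl: "wt l = e" "wt (flip l) = e" using l(2) by simp_all
    have "?good (link n q1 q2 1 # l # R)"
    proof -
      \<comment> \<open>Elimination needs a letter that ends in the second column of the link.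
        Flipping l, or the link, or both, achieves this for each of the four positions of the
        touching end.\<close>
      consider "tgt l = q2" | "tgt (flip l) = q2" | "tgt l = q1" | "tgt (flip l) = q1" using l(2) by auto
      then show ?thesis
      proof cases
        case 1
        show ?thesis
          by (rule good_by_elimination[OF _ q'(1) q(2) refl q'(2,3) 1])
             (use R lv new wtl in \<open>auto simp del: insert_iff\<close>)
      next
        case 2
        have "?good (link n q1 q2 1 # flip l # R)"
          by (rule good_by_elimination[OF _ q'(1) q(2) refl q'(2,3) 2])
             (use R flipl new wtl in \<open>auto simp del: insert_iff\<close>)
        then show ?thesis by (simp only: swap)
      next
        case 3
        have "?good (link n q2 q1 (- 1) # l # R)"
          by (rule good_by_elimination[OF _ q(2) q'(1,2) refl q'(3)[symmetric] 3])
             (use R lv new[unfolded flipJ[symmetric]] wtl in \<open>auto simp del: insert_iff\<close>)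
        then show ?thesis by (simp only: flipJ)
      next
        case 4
        have "?good (link n q2 q1 (- 1) # flip l # R)"
          by (rule good_by_elimination[OF _ q(2) q'(1,2) refl q'(3)[symmetric] 4])
             (use R flipl new[unfolded flipJ[symmetric]] wtl in \<open>auto simp del: insert_iff\<close>)
        then show ?thesis by (simp only: swap flipJ)
      qed
    qed
    moreover have "form (link n q1 q2 1 # Ls) = form (link n q1 q2 1 # l # R)"
      by (rule form_mset) (simp add: Ls R_def)
    ultimately show ?case by (simp only:)
  qed
  then show ?case using Suc.prems by blast
qed

end

section \<open>The generic case and specialization\<close>

text \<open>Digits in base B are unique. This recovers the multiplicity of each matrix from a total
  weight.\<close>

lemma positional_unique:
  fixes \<alpha> \<beta> :: "nat \<Rightarrow> nat"
  assumes "(\<Sum>j<s. \<alpha> j * B ^ j) = (\<Sum>j<s. \<beta> j * B ^ j)"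
    and "\<And>j. j < s \<Longrightarrow> \<alpha> j < B" "\<And>j. j < s \<Longrightarrow> \<beta> j < B" and "j < s"
  shows "\<alpha> j = \<beta> j"
  using assms
proof (induction s arbitrary: \<alpha> \<beta> j)
  case 0
  then show ?case by simp
next
  case (Suc s)
  have shift: "(\<Sum>j<Suc s. \<gamma> j * B ^ j) = \<gamma> 0 + B * (\<Sum>j<s. \<gamma> (Suc j) * B ^ j)" for \<gamma>
    by (simp add: sum.lessThan_Suc_shift sum_distrib_left mult_ac del: sum.lessThan_Suc)
  have eq: "\<alpha> 0 + B * (\<Sum>j<s. \<alpha> (Suc j) * B ^ j) = \<beta> 0 + B * (\<Sum>j<s. \<beta> (Suc j) * B ^ j)"
    using Suc.prems(1) unfolding shift .
  have lt: "\<alpha> 0 < B" "\<beta> 0 < B" using Suc.prems(2,3) by simp_all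
  have 0: "\<alpha> 0 = \<beta> 0"
    using arg_cong[OF eq, of "\<lambda>x. x mod B"] lt by simp
  then have "(\<Sum>j<s. \<alpha> (Suc j) * B ^ j) = (\<Sum>j<s. \<beta> (Suc j) * B ^ j)"
    using eq lt by simp
  then have "\<alpha> (Suc i) = \<beta> (Suc i)" if "i < s" for i
    using Suc.IH[of "\<lambda>j. \<alpha> (Suc j)" "\<lambda>j. \<beta> (Suc j)" i] Suc.prems(2,3) that by simp
  then show ?case using 0 Suc.prems(4) by (cases j) auto
qed

lemma count_image_mset_set:
  assumes "finite T"
  shows "count (image_mset f (mset_set T)) i = card {a \<in> T. f a = i}"
proof -
  have "f -` {i} \<inter> T = {a \<in> T. f a = i}" by auto
  then show ?thesis using assms by (simp add: count_image_mset)
qed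

lemma mat_products_transpose:
  assumes "A \<in> mat_products (S \<union> transpose_mat ` S)"
  shows "transpose_mat A \<in> mat_products (S \<union> transpose_mat ` S)"
  using assms
proof induction
  case (base A)
  then show ?case by (auto intro!: mat_products.base)
next
  case (mult A B)
  have "transpose_mat (A * B) = transpose_mat B * transpose_mat A"
    using mult.hyps by (intro transpose_mult[of _ "dim_row A" "dim_col A" _ "dim_col B"]) auto
  then show ?case using mult by (auto intro: mat_products.mult)
qed

text \<open>Over a domain of characteristic zero |T|! can be cancelled, so the coefficient of the
  right degree gives the bpf itself.\<close>

lemma bpf_in_gen_subring:
  fixes X :: "'a::{idom,ring_char_0} mat list"
  assumes tws: "tableau_with_substitution n T \<phi> X"
    and q: "q1 < q2" "q2 < length n" "n ! q1 = n ! q2"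
  defines "d \<equiv> nths n (- {q1, q2})" and "W \<equiv> mat_products (set X \<union> transpose_mat ` set X)"
  shows "bpf n T \<phi> X \<in> gen_subring
    ({bpf d D \<psi> Y | D \<psi> Y. tableau_with_substitution d D \<psi> Y \<and> set Y \<subseteq> W} \<union>
     {sigma k h | k h. k \<in> {1..n ! q1} \<and> h \<in> W \<and> square_mat h})" (is "_ \<in> gen_subring ?G")
proof -
  have T: "tableau n T" and \<phi>T: "\<phi> ` T = {..<length X}"
    and dims: "\<And>a. a \<in> T \<Longrightarrow> X ! \<phi> a \<in> carrier_mat (n ! tail_col a) (n ! head_col a)"
    and cols: "\<And>a b. a \<in> T \<Longrightarrow> b \<in> T \<Longrightarrow> \<phi> a = \<phi> b \<Longrightarrow> head_col a = head_col b \<and> tail_col a = tail_col b"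
    using tws unfolding tableau_with_substitution_def by blast+
  have mt: "matching (cells n) T" using T by (simp add: tableau_iff_matching)
  note finT = matching_finite[OF mt finite_cells]
  define N where "N = card T"
  \<comment> \<open>A matrix is used by at most N arrows, so in base N + 1 the multiplicities are
    digits and no carry occurs.\<close>
  define B where "B = Suc N"
  define s where "s = length X"
  define arr where "arr j = (SOME a. a \<in> T \<and> \<phi> a = j)" for j
  have arr: "arr j \<in> T" "\<phi> (arr j) = j" if "j < s" for j
  proof -
    have "j \<in> \<phi> ` T" using \<phi>T that by (simp add: s_def)
    then have "\<exists>a. a \<in> T \<and> \<phi> a = j" by blast
    then have "arr j \<in> T \<and> \<phi> (arr j) = j" unfolding arr_def by (rule someI_ex)
    then show "arr j \<in> T" "\<phi> (arr j) = j" by simp_all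
  qed
  define letter where "letter j = Letter (tail_col (arr j)) (head_col (arr j)) 1 (B ^ j) (X ! j)" for j
  define Ls where "Ls = map letter [0..<s]"
  let ?Lt = "link n q1 q2 (1::'a) # Ls"
  have len: "length ?Lt = Suc s" by (simp add: Ls_def)
  have Lt_Suc: "?Lt ! Suc j = letter j" if "j < s" for j using that by (simp add: Ls_def)
  \<comment> \<open>Position 0 of the list belongs to the link, hence the shift by one. This
    labelling gives every arrow its own matrix.\<close>
  define f0 where "f0 = restrict (\<lambda>a. Suc (\<phi> a)) T"
  have \<phi>s: "\<phi> a < s" if "a \<in> T" for a using \<phi>T that by (auto simp: s_def)
  have f0: "f0 \<in> T \<rightarrow>\<^sub>E {..<length ?Lt}" using \<phi>s len by (auto simp: f0_def)
  have Lt_f0: "?Lt ! f0 a = letter (\<phi> a)" if "a \<in> T" for a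
    using that Lt_Suc[OF \<phi>s[OF that]] by (simp add: f0_def)
  let ?w = "\<lambda>f. \<Sum>a\<in>T. wt (?Lt ! f a)"
  define D where "D = ?w f0"
  have mat_W: "X ! j \<in> W" if "j < s" for j
    unfolding W_def using that by (intro mat_products.base) (simp add: s_def)
  have valid: "valid_letter n W l" if l: "l \<in> set Ls" for l
  proof -
    obtain j where j: "j < s" "l = letter j" using l by (auto simp: Ls_def)
    have "X ! j \<in> carrier_mat (n ! tail_col (arr j)) (n ! head_col (arr j))"
      using dims[OF arr(1)[OF j(1)]] arr(2)[OF j(1)] by simp
    moreover have "tail_col (arr j) < length n" "head_col (arr j) < length n"
      using matching_cell[OF mt arr(1)[OF j(1)]] fst_cell_mem by blast+
    ultimately show ?thesis
      using mat_W[OF j(1)] by (simp add: valid_letter_def wf_letter_def j(2) letter_def B_def)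
  qed
  \<comment> \<open>All weights B^j are at least 1, so the induction may start at e = 1, where k = D
    satisfies D < e + k.\<close>
  have good: "good (fact N) D (gen_subring ?G) (pf_sum (cells n) T (\<lambda>_. form ?Lt))"
    unfolding N_def
  proof (rule good_by_weight[OF T q, where W = W and e = 1 and k = D])
    show "A * B \<in> W" if "A \<in> W" "B \<in> W" "dim_col A = dim_row B" for A B
      using that unfolding W_def by (rule mat_products.mult)
    show "transpose_mat A \<in> W" if "A \<in> W" for A
      using that unfolding W_def by (rule mat_products_transpose)
    show "bpf (nths n (- {q1, q2})) D \<psi> Y \<in> ?G"
      if "tableau_with_substitution (nths n (- {q1, q2})) D \<psi> Y" "set Y \<subseteq> W" for D \<psi> Y
      using that unfolding d_def by blast
    show "sigma k h \<in> ?G" if "k \<in> {1..n ! q1}" "h \<in> W" "square_mat h" for k h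
      using that by blast
    show "valid_letter n W l" if "l \<in> set Ls" for l by (rule valid[OF that])
    show "1 \<le> wt l" if "l \<in> set Ls" for l using valid[OF that] by (simp add: valid_letter_def)
  qed simp
  have weight: "?w f = (\<Sum>j<s. card {a \<in> T. f a = Suc j} * B ^ j)" if f: "f \<in> T \<rightarrow>\<^sub>E {..<length ?Lt}" for f
  proof -
    have "?w f = (\<Sum>i<Suc s. \<Sum>a | a \<in> T \<and> f a = i. wt (?Lt ! f a))"
      by (rule sum.group[symmetric]) (use f finT len in auto)
    also have "\<dots> = (\<Sum>i<Suc s. card {a \<in> T. f a = i} * wt (?Lt ! i))"
      by (intro sum.cong refl) simp
    also have "\<dots> = (\<Sum>j<s. card {a \<in> T. f a = Suc j} * wt (?Lt ! Suc j))"
      by (simp add: sum.lessThan_Suc_shift del: sum.lessThan_Suc)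
    also have "\<dots> = (\<Sum>j<s. card {a \<in> T. f a = Suc j} * B ^ j)"
      by (intro sum.cong refl) (simp only: Lt_Suc lessThan_iff letter_def letter.sel)
    finally show ?thesis .
  qed
  \<comment> \<open>The weight does not see the link, which has weight 0; the multiplicity of the
    link follows from the number of all arrows. In the degree of f0 it is therefore zero.\<close>
  have total: "N = card {a \<in> T. f a = 0} + (\<Sum>j<s. card {a \<in> T. f a = Suc j})"
    if f: "f \<in> T \<rightarrow>\<^sub>E {..<length ?Lt}" for f
  proof -
    have "(\<Sum>a\<in>T. 1) = (\<Sum>i<Suc s. \<Sum>a | a \<in> T \<and> f a = i. 1::nat)"
      by (rule sum.group[symmetric]) (use f finT len in auto)
    then show ?thesis by (simp add: N_def sum.lessThan_Suc_shift del: sum.lessThan_Suc)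
  qed
  have orbit: "{f \<in> T \<rightarrow>\<^sub>E {..<length ?Lt}. ?w f = D} = orbit_of T {..<length ?Lt} f0"
  proof (intro subset_antisym subsetI)
    fix f assume "f \<in> {f \<in> T \<rightarrow>\<^sub>E {..<length ?Lt}. ?w f = D}"
    then have f: "f \<in> T \<rightarrow>\<^sub>E {..<length ?Lt}" and w: "?w f = ?w f0" by (simp_all add: D_def)
    have small: "card {a \<in> T. g a = i} < B" for g :: "arrow \<Rightarrow> nat" and i
      using card_mono[OF finT, of "{a \<in> T. g a = i}"] by (simp add: B_def N_def less_Suc_eq_le)
    have Suc_eq: "card {a \<in> T. f a = Suc j} = card {a \<in> T. f0 a = Suc j}" if "j < s" for j
      using w unfolding weight[OF f] weight[OF f0] by (rule positional_unique) (use small that in simp_all)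
    have zero_eq: "card {a \<in> T. f a = 0} = card {a \<in> T. f0 a = 0}"
      using total[OF f] total[OF f0] Suc_eq by simp
    have big: "{a \<in> T. g a = Suc j} = {}" if "\<not> j < s" "g \<in> T \<rightarrow>\<^sub>E {..<length ?Lt}" for j and g :: "arrow \<Rightarrow> nat"
      using that(1) PiE_mem[OF that(2)] unfolding len by fastforce
    have "image_mset f (mset_set T) = image_mset f0 (mset_set T)"
    proof (rule multiset_eqI)
      fix i
      show "count (image_mset f (mset_set T)) i = count (image_mset f0 (mset_set T)) i"
        unfolding count_image_mset_set[OF finT]
      proof (cases i)
        case 0
        then show "card {a \<in> T. f a = i} = card {a \<in> T. f0 a = i}" using zero_eq by simp
      next
        case (Suc j)
        show "card {a \<in> T. f a = i} = card {a \<in> T. f0 a = i}"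
        proof (cases "j < s")
          case True
          then show ?thesis unfolding Suc by (rule Suc_eq)
        next
          case False
          then show ?thesis unfolding Suc big[OF False f] big[OF False f0] by simp
        qed
      qed
    qed
    then show "f \<in> orbit_of T {..<length ?Lt} f0" using f by (simp add: orbit_of_def)
  next
    fix f assume f: "f \<in> orbit_of T {..<length ?Lt} f0"
    obtain \<tau> where \<tau>: "\<tau> permutes T" "\<And>a. a \<in> T \<Longrightarrow> f a = f0 (\<tau> a)"
      using orbit_of_permutes[OF finT f] by blast
    have "?w f = D"
      using sum.permute[OF \<tau>(1), of "\<lambda>a. wt (?Lt ! f0 a)"] \<tau>(2) by (simp add: D_def comp_def)
    then show "f \<in> {f \<in> T \<rightarrow>\<^sub>E {..<length ?Lt}. ?w f = D}" using f by (simp add: orbit_of_def)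
  qed
  have "coeff (pf_sum (cells n) T (\<lambda>_. form ?Lt)) D =
    (\<Sum>f\<in>T \<rightarrow>\<^sub>E {..<length ?Lt}. if ?w f = D then (\<Prod>a\<in>T. sg (?Lt ! f a)) * placed_sum n T ?Lt f else 0)"
    unfolding pf_sum_form_expand[OF T] coeff_sum coeff_monom ..
  also have "\<dots> = (\<Sum>f | f \<in> T \<rightarrow>\<^sub>E {..<length ?Lt} \<and> ?w f = D. (\<Prod>a\<in>T. sg (?Lt ! f a)) * placed_sum n T ?Lt f)"
    by (rule sum.inter_filter[symmetric]) (intro finite_PiE finT finite_lessThan)
  also have "\<dots> = (\<Sum>f\<in>orbit_of T {..<length ?Lt} f0. placed_sum n T ?Lt f)"
  proof (rule sum.cong)
    show "{f. f \<in> T \<rightarrow>\<^sub>E {..<length ?Lt} \<and> ?w f = D} = orbit_of T {..<length ?Lt} f0" using orbit by simp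
    fix f assume f: "f \<in> orbit_of T {..<length ?Lt} f0"
    have "sg (?Lt ! f a) = 1" if a: "a \<in> T" for a
    proof -
      have "f a < Suc s" using f a len by (auto simp: orbit_of_def)
      then show ?thesis using Lt_Suc[of "f a - 1"] by (cases "f a") (auto simp: letter_def)
    qed
    then show "(\<Prod>a\<in>T. sg (?Lt ! f a)) * placed_sum n T ?Lt f = placed_sum n T ?Lt f" by simp
  qed
  also have "\<dots> = of_nat (fact (card T)) * bpf_fam n T f0 (\<lambda>i. lmat (?Lt ! i))"
    unfolding placed_sum_def
  proof (rule orbit_sum_eq_bpf[OF T finite_lessThan f0])
    fix a assume a: "a \<in> T"
    show "src (?Lt ! f0 a) = tail_col a \<and> tgt (?Lt ! f0 a) = head_col a"
      using cols[OF a arr(1)[OF \<phi>s[OF a]]] arr(2)[OF \<phi>s[OF a]] unfolding Lt_f0[OF a] letter_def by simp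
  qed
  also have "bpf_fam n T f0 (\<lambda>i. lmat (?Lt ! i)) = bpf n T \<phi> X"
  proof -
    have "admissible_perms n T f0 = admissible_perms n T \<phi>"
      unfolding admissible_perms_def f0_def by (intro Collect_cong conj_cong ball_cong refl) auto
    moreover have "lmat (?Lt ! f0 a) = X ! \<phi> a" if "a \<in> T" for a
      unfolding Lt_f0[OF that] letter_def by simp
    ultimately show ?thesis unfolding bpf_fam_def bpf_def
      by (intro sum.cong arg_cong2[where f = "(*)"] prod.cong refl) simp_all
  qed
  finally have coeff: "coeff (pf_sum (cells n) T (\<lambda>_. form ?Lt)) D = of_nat (fact N) * bpf n T \<phi> X"
    unfolding N_def .
  obtain x where "x \<in> gen_subring ?G" "of_nat (fact N) * bpf n T \<phi> X = of_nat (fact N) * x"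
    using good unfolding good_def coeff[symmetric] by blast
  then show ?thesis by simp
qed

section \<open>Tableaux under ring homomorphisms, and specialization\<close>

lemma tableau_with_substitution_arrow:
  assumes "tableau_with_substitution n T \<phi> X" "a \<in> T"
  shows "\<phi> a < length X" "X ! \<phi> a \<in> carrier_mat (n ! tail_col a) (n ! head_col a)"
    "tail_cell a \<in> cells n" "head_cell a \<in> cells n"
proof -
  have "\<phi> a \<in> \<phi> ` T" using assms(2) by blast
  also have "\<dots> = {..<length X}" using assms(1) unfolding tableau_with_substitution_def by blast
  finally show "\<phi> a < length X" by simp
  show "X ! \<phi> a \<in> carrier_mat (n ! tail_col a) (n ! head_col a)" "tail_cell a \<in> cells n" "head_cell a \<in> cells n"
    using assms unfolding tableau_with_substitution_def tableau_def by blast+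
qed

lemma tableau_with_substitution_replace:
  assumes "tableau_with_substitution n T \<phi> X" "length Z = length X"
    and "\<And>a. a \<in> T \<Longrightarrow> Z ! \<phi> a \<in> carrier_mat (n ! tail_col a) (n ! head_col a)"
  shows "tableau_with_substitution n T \<phi> Z"
  using assms(1) unfolding tableau_with_substitution_def assms(2) using assms(3) by blast

context
  fixes h :: "'b::comm_ring_1 \<Rightarrow> 'a::comm_ring_1"
  assumes hom: "comm_ring_hom h"
begin

interpretation comm_ring_hom h by (rule hom)

lemma mat_products_map:
  assumes "A \<in> mat_products S"
  shows "map_mat h A \<in> mat_products (map_mat h ` S)"
  using assms
proof induction
  case (base A)
  then show ?case by (intro mat_products.base) simp
next
  case (mult A B)
  have "map_mat h (A * B) = map_mat h A * map_mat h B"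
    using mult.hyps by (intro mat_hom_mult[of _ "dim_row A" "dim_col A" _ "dim_col B"]) auto
  then show ?case using mult by (auto intro: mat_products.mult)
qed

lemma mat_products_map_list:
  assumes "A \<in> mat_products (set X \<union> transpose_mat ` set X)"
  shows "map_mat h A \<in> mat_products (set (map (map_mat h) X) \<union> transpose_mat ` set (map (map_mat h) X))"
proof -
  have "map_mat h ` (set X \<union> transpose_mat ` set X) = set (map (map_mat h) X) \<union> transpose_mat ` set (map (map_mat h) X)"
    by (simp add: image_Un image_image map_mat_transpose)
  then show ?thesis using mat_products_map[OF assms] by simp
qed

lemma tableau_with_substitution_map:
  assumes "tableau_with_substitution n T \<phi> X"
  shows "tableau_with_substitution n T \<phi> (map (map_mat h) X)"
proof (rule tableau_with_substitution_replace[OF assms])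
  fix a assume "a \<in> T"
  then show "map (map_mat h) X ! \<phi> a \<in> carrier_mat (n ! tail_col a) (n ! head_col a)"
    using tableau_with_substitution_arrow(1,2)[OF assms] by simp
qed simp

text \<open>Admissible permutations keep all indices within the matrices; \<open>map_mat\<close>
  determines nothing outside them.\<close>

lemma bpf_map:
  assumes tws: "tableau_with_substitution n T \<phi> X"
  shows "bpf n T \<phi> (map (map_mat h) X) = h (bpf n T \<phi> X)"
proof -
  have "map (map_mat h) X ! \<phi> a $$ (\<pi> (tail_col a) (tail_row a), \<pi> (head_col a) (head_row a)) =
      h (X ! \<phi> a $$ (\<pi> (tail_col a) (tail_row a), \<pi> (head_col a) (head_row a)))"
    if \<pi>: "\<pi> \<in> admissible_perms n T \<phi>" and a: "a \<in> T" for \<pi> a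
  proof -
    note tableau_with_substitution_arrow[OF tws a]
    moreover have "\<pi> i r < n ! i" if "(i, r) \<in> cells n" for i r
    proof -
      have "\<pi> i permutes {..<n ! i}" using \<pi> that by (auto simp: admissible_perms_def PiE_iff cells_def)
      then show ?thesis using permutes_in_image[of "\<pi> i" "{..<n ! i}" r] that by (simp add: cells_def)
    qed
    ultimately show ?thesis by simp
  qed
  then show ?thesis
    unfolding bpf_def by (simp add: hom_distribs)
qed

lemma sigma_map:
  assumes "square_mat A"
  shows "sigma k (map_mat h A) = h (sigma k A)"
proof -
  have "A \<in> carrier_mat (dim_row A) (dim_row A)" using assms by auto
  then have "char_poly (map_mat h A) = map_poly h (char_poly A)" by (rule char_poly_hom)
  then show ?thesis by (simp add: sigma_def hom_distribs)
qed

end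

theorem theorem2:
  fixes \<iota> :: "'k::field \<Rightarrow> 'a::comm_ring_1"
    and n :: "nat list" and T :: "arrow set" and \<phi> :: "arrow \<Rightarrow> nat"
    and X :: "'a mat list" and q1 q2 :: nat
  assumes "infinite (UNIV :: 'k set)"
    and "comm_ring_hom \<iota>"
    and "tableau_with_substitution n T \<phi> X"
    and "q1 < q2" and "q2 < length n" and "n ! q1 = n ! q2"
  defines "d \<equiv> nths n (- {q1, q2})"
    and "W \<equiv> mat_products (set X \<union> transpose_mat ` set X)"
  shows "polynomial_in \<iota> \<int>
    ({bpf d D \<psi> Y | D \<psi> Y. tableau_with_substitution d D \<psi> Y \<and> set Y \<subseteq> W} \<union>
     {sigma k h | k h. k \<in> {1..n ! q1} \<and> h \<in> W \<and> square_mat h})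
    (bpf n T \<phi> X)"
proof -
  \<comment> \<open>One indeterminate for each matrix, row and column, the triple being coded as a
    natural number to fit the index type of the variables.\<close>
  let ?code = "\<lambda>j r c. prod_encode (j, prod_encode (r, c))"
  define y where "y v = (case prod_decode v of (j, u) \<Rightarrow> X ! j $$ prod_decode u)" for v
  \<comment> \<open>Integer polynomials map to every commutative ring, so what holds for matrices of
    indeterminates, in characteristic zero, specializes to X in any characteristic.\<close>
  define h :: "((nat \<Rightarrow>\<^sub>0 nat) \<Rightarrow>\<^sub>0 int) \<Rightarrow> 'a" where "h = poly_subst of_int y"
  have hom: "comm_ring_hom h"
    unfolding h_def by (rule comm_ring_hom_poly_subst) (unfold_locales, auto)
  define Z :: "((nat \<Rightarrow>\<^sub>0 nat) \<Rightarrow>\<^sub>0 int) mat list" where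
    "Z = map (\<lambda>j. mat (dim_row (X ! j)) (dim_col (X ! j))
      (\<lambda>(r, c). Poly_Mapping.single (Poly_Mapping.single (?code j r c) 1) 1)) [0..<length X]"
  have "h (Poly_Mapping.single (Poly_Mapping.single (?code j r c) 1) 1) = X ! j $$ (r, c)" for j r c
  proof -
    have "comm_ring_hom (of_int :: int \<Rightarrow> 'a)" by unfold_locales auto
    then show ?thesis by (simp add: h_def poly_subst_single y_def)
  qed
  then have hZ: "map (map_mat h) Z = X"
    by (intro nth_equalityI) (auto simp: Z_def intro!: eq_matI)
  have Z: "tableau_with_substitution n T \<phi> Z"
  proof (rule tableau_with_substitution_replace[OF assms(3)])
    fix a assume "a \<in> T"
    then show "Z ! \<phi> a \<in> carrier_mat (n ! tail_col a) (n ! head_col a)"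
      using tableau_with_substitution_arrow(1,2)[OF assms(3)] by (fastforce simp: Z_def)
  qed (simp add: Z_def)
  let ?V = "mat_products (set Z \<union> transpose_mat ` set Z)"
  have V: "map_mat h A \<in> W" if "A \<in> ?V" for A
    using mat_products_map_list[OF hom that] by (simp add: hZ W_def)
  let ?H = "{bpf d D \<psi> Y | D \<psi> Y. tableau_with_substitution d D \<psi> Y \<and> set Y \<subseteq> ?V} \<union>
     {sigma k g | k g. k \<in> {1..n ! q1} \<and> g \<in> ?V \<and> square_mat g}"
  let ?G = "{bpf d D \<psi> Y | D \<psi> Y. tableau_with_substitution d D \<psi> Y \<and> set Y \<subseteq> W} \<union>
     {sigma k h | k h. k \<in> {1..n ! q1} \<and> h \<in> W \<and> square_mat h}"
  have "h (bpf n T \<phi> Z) \<in> gen_subring ?G"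
  proof (rule gen_subring_hom[OF hom])
    show "bpf n T \<phi> Z \<in> gen_subring ?H"
      unfolding d_def by (rule bpf_in_gen_subring[OF Z assms(4-6)])
    show "h ` ?H \<subseteq> ?G"
    proof (rule image_subsetI)
      fix x assume "x \<in> ?H"
      then consider (bpf) D \<psi> Y where "x = bpf d D \<psi> Y" "tableau_with_substitution d D \<psi> Y" "set Y \<subseteq> ?V"
        | (sigma) k g where "x = sigma k g" "k \<in> {1..n ! q1}" "g \<in> ?V" "square_mat g" by blast
      then show "h x \<in> ?G"
      proof cases
        case bpf
        have "h x = bpf d D \<psi> (map (map_mat h) Y)" using bpf_map[OF hom bpf(2)] bpf(1) by simp
        moreover have "tableau_with_substitution d D \<psi> (map (map_mat h) Y)"
          by (rule tableau_with_substitution_map[OF hom bpf(2)])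
        moreover have "set (map (map_mat h) Y) \<subseteq> W" using V bpf(3) by auto
        ultimately show ?thesis by blast
      next
        case sigma
        have "h x = sigma k (map_mat h g)" using sigma_map[OF hom sigma(4)] sigma(1) by simp
        moreover have "square_mat (map_mat h g)" using sigma(4) by simp
        ultimately show ?thesis using V[OF sigma(3)] sigma(2) by blast
      qed
    qed
  qed
  then show ?thesis
    using bpf_map[OF hom Z] hZ gen_subring_imp_polynomial_in[OF assms(2)] by simp
qed

end
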